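(* Let $(V_1, V_2)$ be an irreducible $3$-finite pair on a Hilbert space $\mathcal{H}$. Then there exist $\lambda \in (0,1)$, a unimodular constant $\gamma$, and an inner function $\varphi\in H^\infty(\mathbb{D}^2)$ (depending on $\lambda$) such that \[ \sigma(C(V_1, V_2)) \cap (0,1) = \{\lambda\}, \qquad \sigma([V_2^*, V_1]) \setminus \{0\} = \{\gamma \lambda\}, \] and $(V_1, V_2)$ is unitarily equivalent to $(\gamma M_z|_{\mathcal{S}_{\lambda}}, M_w|_{\mathcal{S}_{\lambda}})$, where \[ \mathcal{S}_{\lambda} = \varphi \Big(H^2(\mathbb{D}^2) \oplus \overline{\operatorname{span}}\Big\{ z^j \frac{\bar{w}}{1 - \lambda z \bar{w}} : j\ge 0\Big\} \Big)\subseteq L^2(\mathbb{T}^2) \] is a closed subspace of $H^2(\mathbb{D}^2)$ invariant under $M_z$ and $M_w$.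
   Context: All Hilbert spaces are complex and separable. An isometric pair is a pair $(V_1,V_2)$ of commuting isometries on $\mathcal{H}$. An isometry $V$ is a shift if $V^{*m}\to0$ strongly. A BCL pair is an isometric pair with $V_1V_2$ a shift. $[V_2^*,V_1] := V_2^*V_1 - V_1V_2^*$. A compact normal pair is a BCL pair with $[V_2^*,V_1]$ compact and normal. $C(V_1,V_2) := I - V_1V_1^* - V_2V_2^* + V_1V_2V_1^*V_2^*$. A $3$-finite pair is a compact normal pair with $\operatorname{rank} C(V_1,V_2)=3$. Irreducible: no closed subspace other than $\{0\}$, $\mathcal{H}$ invariant under $V_1,V_2,V_1^*,V_2^*$. $H^2(\mathbb{D}^2)$ is the closure of polynomials in $z,w$ in $L^2(\mathbb{T}^2)$, $M_z,M_w$ are multiplication by coordinates; an inner function in $H^\infty(\mathbb{D}^2)$ has unimodular boundary values a.e. Unitary equivalence of pairs means a single unitary intertwining both components. *)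

theory Defs
  imports "HOL-Analysis.Analysis"
begin

class complex_vector = real_vector +
  fixes scaleC :: "complex \<Rightarrow> 'a \<Rightarrow> 'a"  (infixr \<open>*\<^sub>C\<close> 75)
  assumes scaleC_add_right: "a *\<^sub>C (x + y) = a *\<^sub>C x + a *\<^sub>C y"
    and scaleC_add_left: "(a + b) *\<^sub>C x = a *\<^sub>C x + b *\<^sub>C x"
    and scaleC_scaleC: "a *\<^sub>C (b *\<^sub>C x) = (a * b) *\<^sub>C x"
    and scaleC_one: "1 *\<^sub>C x = x"
    and scaleR_scaleC: "scaleR r x = complex_of_real r *\<^sub>C x"

text \<open>A complex inner product space, presented via its real part
  (the real inner product), with multiplication by i orthogonal.\<close>
class complex_inner = complex_vector + real_inner +
  assumes inner_scaleC_ii: "inner (\<i> *\<^sub>C x) (\<i> *\<^sub>C y) = inner x y"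

text \<open>The complex inner product (linear in the first, conjugate linear in the
  second argument): real part = real inner product.\<close>
definition cinner :: "'a::complex_inner \<Rightarrow> 'a \<Rightarrow> complex" where
  "cinner x y = Complex (inner x y) (inner x (\<i> *\<^sub>C y))"

class chilbert_space = complex_inner + complete_space

definition bounded_clinear :: "('a::complex_inner \<Rightarrow> 'b::complex_inner) \<Rightarrow> bool" where
  "bounded_clinear T \<longleftrightarrow> bounded_linear T \<and> (\<forall>c x. T (c *\<^sub>C x) = c *\<^sub>C T x)"

definition adj :: "('a::complex_inner \<Rightarrow> 'a) \<Rightarrow> 'a \<Rightarrow> 'a" where
  "adj T = (SOME S. \<forall>x y. cinner (T x) y = cinner x (S y))"

definition isometry :: "('a::complex_inner \<Rightarrow> 'a) \<Rightarrow> bool" where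
  "isometry V \<longleftrightarrow> bounded_clinear V \<and> (\<forall>x. norm (V x) = norm x)"

definition is_shift :: "('a::complex_inner \<Rightarrow> 'a) \<Rightarrow> bool" where
  "is_shift V \<longleftrightarrow> isometry V \<and> (\<forall>x. (\<lambda>m. (adj V ^^ m) x) \<longlonglongrightarrow> 0)"

definition isometric_pair :: "('a::complex_inner \<Rightarrow> 'a) \<Rightarrow> ('a \<Rightarrow> 'a) \<Rightarrow> bool" where
  "isometric_pair V1 V2 \<longleftrightarrow> isometry V1 \<and> isometry V2 \<and> V1 \<circ> V2 = V2 \<circ> V1"

definition BCL_pair :: "('a::complex_inner \<Rightarrow> 'a) \<Rightarrow> ('a \<Rightarrow> 'a) \<Rightarrow> bool" where
  "BCL_pair V1 V2 \<longleftrightarrow> isometric_pair V1 V2 \<and> is_shift (V1 \<circ> V2)"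

definition cross_comm :: "('a::complex_inner \<Rightarrow> 'a) \<Rightarrow> ('a \<Rightarrow> 'a) \<Rightarrow> 'a \<Rightarrow> 'a" where
  "cross_comm V1 V2 = (\<lambda>x. adj V2 (V1 x) - V1 (adj V2 x))"

definition defect_op :: "('a::complex_inner \<Rightarrow> 'a) \<Rightarrow> ('a \<Rightarrow> 'a) \<Rightarrow> 'a \<Rightarrow> 'a" where
  "defect_op V1 V2 = (\<lambda>x. x - V1 (adj V1 x) - V2 (adj V2 x) + V1 (V2 (adj V1 (adj V2 x))))"

definition compact_op :: "('a::complex_inner \<Rightarrow> 'a) \<Rightarrow> bool" where
  "compact_op T \<longleftrightarrow> bounded_clinear T \<and> compact (closure (T ` cball 0 1))"

definition normal_op :: "('a::complex_inner \<Rightarrow> 'a) \<Rightarrow> bool" where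
  "normal_op T \<longleftrightarrow> bounded_clinear T \<and> adj T \<circ> T = T \<circ> adj T"

definition compact_normal_pair :: "('a::complex_inner \<Rightarrow> 'a) \<Rightarrow> ('a \<Rightarrow> 'a) \<Rightarrow> bool" where
  "compact_normal_pair V1 V2 \<longleftrightarrow> BCL_pair V1 V2 \<and>
     compact_op (cross_comm V1 V2) \<and> normal_op (cross_comm V1 V2)"

definition cspan_fin :: "'a::complex_vector set \<Rightarrow> 'a set" where
  "cspan_fin B = {x. \<exists>c. x = (\<Sum>b\<in>B. c b *\<^sub>C b)}"

definition cindependent_fin :: "'a::complex_vector set \<Rightarrow> bool" where
  "cindependent_fin B \<longleftrightarrow> (\<forall>c. (\<Sum>b\<in>B. c b *\<^sub>C b) = 0 \<longrightarrow> (\<forall>b\<in>B. c b = 0))"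

definition has_rank :: "('a::complex_vector \<Rightarrow> 'a) \<Rightarrow> nat \<Rightarrow> bool" where
  "has_rank T n \<longleftrightarrow> (\<exists>B. finite B \<and> card B = n \<and> cindependent_fin B \<and> range T = cspan_fin B)"

definition three_finite_pair :: "('a::complex_inner \<Rightarrow> 'a) \<Rightarrow> ('a \<Rightarrow> 'a) \<Rightarrow> bool" where
  "three_finite_pair V1 V2 \<longleftrightarrow> compact_normal_pair V1 V2 \<and> has_rank (defect_op V1 V2) 3"

definition csubspace :: "'a::complex_vector set \<Rightarrow> bool" where
  "csubspace M \<longleftrightarrow> 0 \<in> M \<and> (\<forall>x\<in>M. \<forall>y\<in>M. x + y \<in> M) \<and> (\<forall>c. \<forall>x\<in>M. c *\<^sub>C x \<in> M)"

definition irreducible_pair :: "('a::complex_inner \<Rightarrow> 'a) \<Rightarrow> ('a \<Rightarrow> 'a) \<Rightarrow> bool" where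
  "irreducible_pair V1 V2 \<longleftrightarrow>
     (\<forall>M. csubspace M \<and> closed M \<and> V1 ` M \<subseteq> M \<and> V2 ` M \<subseteq> M \<and>
          adj V1 ` M \<subseteq> M \<and> adj V2 ` M \<subseteq> M \<longrightarrow> M = {0} \<or> M = UNIV)"

definition spectrum :: "('a::complex_inner \<Rightarrow> 'a) \<Rightarrow> complex set" where
  "spectrum T = {\<mu>. \<not> (\<exists>S. bounded_clinear S \<and> (\<forall>x. S (T x - \<mu> *\<^sub>C x) = x) \<and>
                                (\<forall>x. T (S x) - \<mu> *\<^sub>C S x = x))}"

definition torus :: "(complex \<times> complex) measure" where
  "torus = distr (restrict_space lborel ({0..<1} \<times> {0..<1})) borel
             (\<lambda>(s::real, t::real). (cis (2 * pi * s), cis (2 * pi * t)))"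

type_synonym tfun = "complex \<times> complex \<Rightarrow> complex"

definition L2 :: "tfun set" where
  "L2 = {f. f \<in> borel_measurable torus \<and> integrable torus (\<lambda>\<zeta>. (cmod (f \<zeta>))\<^sup>2)}"

definition L2_dist :: "tfun \<Rightarrow> tfun \<Rightarrow> real" where
  "L2_dist f g = sqrt (\<integral>\<zeta>. (cmod (f \<zeta> - g \<zeta>))\<^sup>2 \<partial>torus)"

definition L2_closure :: "tfun set \<Rightarrow> tfun set" where
  "L2_closure A = {f \<in> L2. \<forall>\<epsilon>>0. \<exists>g\<in>A. L2_dist f g < \<epsilon>}"

definition L2_closed :: "tfun set \<Rightarrow> bool" where
  "L2_closed S \<longleftrightarrow> S \<subseteq> L2 \<and> L2_closure S \<subseteq> S"

definition polys :: "tfun set" where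
  "polys = {p. \<exists>F c. finite F \<and>
              p = (\<lambda>\<zeta>. \<Sum>(m, n)\<in>F. c (m, n) * fst \<zeta> ^ m * snd \<zeta> ^ n)}"

definition H2 :: "tfun set" where
  "H2 = L2_closure polys"

definition closed_span :: "(nat \<Rightarrow> tfun) \<Rightarrow> tfun set" where
  "closed_span k = L2_closure {g. \<exists>F c. finite F \<and> g = (\<lambda>\<zeta>. \<Sum>j\<in>F. c j * k j \<zeta>)}"

definition kfun :: "real \<Rightarrow> nat \<Rightarrow> tfun" where
  "kfun lam j = (\<lambda>\<zeta>. fst \<zeta> ^ j * cnj (snd \<zeta>) / (1 - complex_of_real lam * fst \<zeta> * cnj (snd \<zeta>)))"

definition radial :: "(complex \<times> complex \<Rightarrow> complex) \<Rightarrow> complex \<times> complex \<Rightarrow> real \<Rightarrow> complex" where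
  "radial \<phi> \<zeta> r = \<phi> (complex_of_real r * fst \<zeta>, complex_of_real r * snd \<zeta>)"

definition bdry :: "(complex \<times> complex \<Rightarrow> complex) \<Rightarrow> tfun" where
  "bdry \<phi> \<zeta> = Lim (at_left 1) (radial \<phi> \<zeta>)"

text \<open>H-infinity of the bidisc: bounded, holomorphic (separately in each variable,
  which by Hartogs is joint holomorphy) on D x D.\<close>
definition H_infty :: "(complex \<times> complex \<Rightarrow> complex) \<Rightarrow> bool" where
  "H_infty \<phi> \<longleftrightarrow>
     (\<exists>B. \<forall>z w. cmod z < 1 \<and> cmod w < 1 \<longrightarrow> cmod (\<phi> (z, w)) \<le> B) \<and>
     (\<forall>w. cmod w < 1 \<longrightarrow> (\<lambda>z. \<phi> (z, w)) holomorphic_on ball 0 1) \<and>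
     (\<forall>z. cmod z < 1 \<longrightarrow> (\<lambda>w. \<phi> (z, w)) holomorphic_on ball 0 1)"

definition inner_function :: "(complex \<times> complex \<Rightarrow> complex) \<Rightarrow> bool" where
  "inner_function \<phi> \<longleftrightarrow> H_infty \<phi> \<and>
     (AE \<zeta> in torus. \<exists>c. cmod c = 1 \<and> (radial \<phi> \<zeta> \<longlongrightarrow> c) (at_left 1))"

definition S_space :: "(complex \<times> complex \<Rightarrow> complex) \<Rightarrow> real \<Rightarrow> tfun set" where
  "S_space \<phi> lam = {f \<in> L2. \<exists>h\<in>H2. \<exists>k\<in>closed_span (kfun lam).
                      AE \<zeta> in torus. f \<zeta> = bdry \<phi> \<zeta> * (h \<zeta> + k \<zeta>)}"

definition unitarily_equiv_model ::
  "('a::complex_inner \<Rightarrow> 'a) \<Rightarrow> ('a \<Rightarrow> 'a) \<Rightarrow> complex \<Rightarrow> tfun set \<Rightarrow> bool" where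
  "unitarily_equiv_model V1 V2 \<gamma> S \<longleftrightarrow>
     (\<exists>U :: 'a \<Rightarrow> tfun.
        (\<forall>x. U x \<in> S) \<and>
        (\<forall>x y. AE \<zeta> in torus. U (x + y) \<zeta> = U x \<zeta> + U y \<zeta>) \<and>
        (\<forall>c x. AE \<zeta> in torus. U (c *\<^sub>C x) \<zeta> = c * U x \<zeta>) \<and>
        (\<forall>x. (norm x)\<^sup>2 = (\<integral>\<zeta>. (cmod (U x \<zeta>))\<^sup>2 \<partial>torus)) \<and>
        (\<forall>f\<in>S. \<exists>x. AE \<zeta> in torus. U x \<zeta> = f \<zeta>) \<and>
        (\<forall>x. AE \<zeta> in torus. U (V1 x) \<zeta> = \<gamma> * fst \<zeta> * U x \<zeta>) \<and>
        (\<forall>x. AE \<zeta> in torus. U (V2 x) \<zeta> = snd \<zeta> * U x \<zeta>))"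

end

theory Submission
  imports Defs "HOL-Complex_Analysis.Complex_Analysis"
    "HOL-Computational_Algebra.Fundamental_Theorem_Algebra"
begin

text \<open>
  Normality forces the cross commutator to annihilate the ranges of \<open>V1\<close> and \<open>V2\<close> and to map into
  \<open>ker V1\<^sup>* \<inter> ker V2\<^sup>*\<close>, which lies in the finite-dimensional range of the defect operator. So there is a
  unit vector \<open>x\<close> with \<open>V1\<^sup>* x = V2\<^sup>* x = 0\<close> and \<open>V2\<^sup>* V1 x = \<mu> x\<close>. The span of the vectors
  \<open>V1\<^sup>a V2\<^sup>b x\<close> is reducing, hence dense, and its Gram matrix depends on \<open>\<mu>\<close> only; rank 3 excludes
  \<open>\<mu> = 0\<close> and \<open>|\<mu>| = 1\<close>, which give ranks 1 and 2. With \<open>\<mu> = \<gamma> \<lambda>\<close>, the same Gram matrix is realised by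
  \<open>\<gamma>\<^sup>a z\<^sup>a w\<^sup>b e\<close> on the torus as soon as \<open>|e|\<^sup>2\<close> is the Poisson kernel of \<open>\<lambda> z (cnj w)\<close>.

  The inner function is explicit. For \<open>Z = z\<^sup>n\<close>, \<open>W = w\<^sup>n\<close> the function \<open>(Z + W)\<^sup>2 / (1 - Z W)\<close> is analytic on
  the bidisc, has real part at least \<open>- 2\<close> there and equal to \<open>- (1 + Re (Z (cnj W)))\<close> on the torus (it
  arises from the singular measure \<open>(1 + Re (Z (cnj W)))\<close> times Haar measure of \<open>{Z W = 1}\<close>). Hence
  \<open>F = (\<Sum>n. \<lambda>\<^sup>n / n * (z\<^sup>n + w\<^sup>n)\<^sup>2 / (1 - z\<^sup>n w\<^sup>n))\<close> satisfies
  \<open>(1 - \<lambda>) |exp (- F)| = 1 / |1 - \<lambda> z (cnj w)|\<close> on the torus, and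
  \<open>\<phi> = (w - \<lambda> z) (1 - \<lambda>) exp (- F)\<close> is inner and cancels the pole of \<open>1 / (w - \<lambda> z)\<close>.
\<close>

section \<open>Complex inner product spaces\<close>

text \<open>Half of the annihilation is free: commutation alone kills \<open>X\<close> on the range
  of \<open>V2\<close> and its adjoint on the range of \<open>V1\<close>. A normal operator and its
  adjoint have the same kernel, which gives the other half.

  The obstacle is the inner function. The logarithm of \<open>|1 - lam z (cnj w)|\<close> has
  Fourier exponents \<open>(n, - n)\<close> and \<open>(- n, n)\<close>, which the real part of an
  analytic function on the bidisc cannot have. A singular measure leaves boundary values unchanged
  almost everywhere and can cancel these exponents. Haar measure of \<open>Z W = 1\<close> has
  coefficient 1 at every \<open>(k, k)\<close>; multiplied by \<open>1 + Re (Z (cnj W))\<close> it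
  also has 1/2 at every \<open>(k + 1, k - 1)\<close> and \<open>(k - 1, k + 1)\<close>. The terms
  with \<open>k = 0\<close> are exactly the coefficients of the function
  \<open>1 + Re (Z (cnj W))\<close>, so subtracting that function leaves only allowed exponents;
  twice the sum over \<open>k > 0\<close> is \<open>(Z + W)^2 / (1 - Z W)\<close>. The summand 1
  keeps the measure nonnegative, whence the lower bound for the real part; its total weight over all
  \<open>n\<close> is \<open>- ln (1 - lam)\<close>, which the factor \<open>1 - lam\<close>
  compensates.\<close>

interpretation cvec: vector_space "scaleC :: complex \<Rightarrow> 'a::complex_vector \<Rightarrow> 'a"
  by unfold_locales (auto simp: scaleC_add_right scaleC_add_left scaleC_scaleC scaleC_one)

lemma Re_cinner [simp]: "Re (cinner x y) = inner x y"
  and Im_cinner: "Im (cinner x y) = inner x (\<i> *\<^sub>C y)"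
  by (simp_all add: cinner_def)

lemma scaleC_ii_ii: "\<i> *\<^sub>C \<i> *\<^sub>C x = - (x::'a::complex_vector)"
  by (simp add: scaleC_scaleC cvec.scale_minus_left)

lemma scaleC_cartesian:
  "c *\<^sub>C (x::'a::complex_vector) = Re c *\<^sub>R x + Im c *\<^sub>R \<i> *\<^sub>C x"
  by (simp add: scaleR_scaleC scaleC_scaleC flip: scaleC_add_left)
     (metis complex_eq mult.commute)

lemma cinner_commute: "cinner y x = cnj (cinner x y)"
proof -
  have "inner y (\<i> *\<^sub>C x) = inner (\<i> *\<^sub>C y) (\<i> *\<^sub>C \<i> *\<^sub>C x)"
    by (simp only: inner_scaleC_ii)
  then show ?thesis
    by (simp add: complex_eq_iff Im_cinner scaleC_ii_ii inner_commute)
qed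

lemma cinner_add_left: "cinner (x + y) z = cinner x z + cinner y z"
  by (simp add: complex_eq_iff Im_cinner inner_add_left)

lemma cinner_add_right: "cinner x (y + z) = cinner x y + cinner x z"
  by (simp add: complex_eq_iff Im_cinner inner_add_right scaleC_add_right)

lemma cinner_scaleC_right: "cinner x (c *\<^sub>C y) = cnj c * cinner x y"
proof -
  have "\<i> *\<^sub>C c *\<^sub>C y = Re c *\<^sub>R \<i> *\<^sub>C y - Im c *\<^sub>R y"
    using scaleC_cartesian[of c "\<i> *\<^sub>C y"] by (simp add: scaleC_scaleC mult.commute)
  then show ?thesis
    by (simp add: complex_eq_iff Im_cinner inner_diff_right)
       (simp add: scaleC_cartesian[of c y] inner_add_right)
qed

lemma cinner_scaleC_left: "cinner (c *\<^sub>C x) y = c * cinner x y"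
  by (metis cinner_commute cinner_scaleC_right complex_cnj_cnj complex_cnj_mult)

lemma cinner_zero_left [simp]: "cinner 0 x = 0"
  and cinner_zero_right [simp]: "cinner x 0 = 0"
  by (simp_all add: complex_eq_iff Im_cinner)

lemma cinner_diff_left: "cinner (x - y) z = cinner x z - cinner y z"
  using cinner_add_left[of "x - y" y z] by simp

lemma cinner_diff_right: "cinner x (y - z) = cinner x y - cinner x z"
  using cinner_add_right[of x "y - z" z] by simp

lemma cinner_self: "cinner x x = complex_of_real ((norm x)\<^sup>2)"
proof -
  have "cnj (cinner x x) = cinner x x"
    by (simp flip: cinner_commute)
  then show ?thesis
    by (simp add: complex_eq_iff power2_norm_eq_inner)
qed

lemma cinner_eqI: "(\<And>x. cinner x a = cinner x b) \<Longrightarrow> a = b"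
  by (metis Re_cinner inner_eq_zero_iff inner_diff_right right_minus_eq)

lemma norm_scaleC: "norm (c *\<^sub>C x) = cmod c * norm (x::'a::complex_inner)"
proof -
  have "cinner (c *\<^sub>C x) (c *\<^sub>C x) = (c * cnj c) * cinner x x"
    by (simp add: cinner_scaleC_left cinner_scaleC_right)
  also have "\<dots> = complex_of_real ((cmod c * norm x)\<^sup>2)"
    by (simp add: cinner_self complex_norm_square[symmetric] power_mult_distrib)
  finally have "(norm (c *\<^sub>C x))\<^sup>2 = (cmod c * norm x)\<^sup>2"
    unfolding cinner_self of_real_eq_iff .
  then show ?thesis
    by simp
qed

lemma norm_cinner_le: "cmod (cinner x y) \<le> norm x * norm y"
proof -
  \<comment> \<open>The conjugate phase turns the inner product into its modulus, so that the real
    Cauchy-Schwarz inequality applies.\<close>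
  define c where "c = cnj (sgn (cinner x y))"
  have "c * cinner x y = complex_of_real (cmod (cinner x y))"
    by (cases "cinner x y = 0")
       (simp_all add: c_def sgn_eq complex_norm_square[symmetric] power2_eq_square mult.commute)
  then have "cmod (cinner x y) = inner (c *\<^sub>C x) y"
    by (metis Re_cinner Re_complex_of_real cinner_scaleC_left)
  also have "\<dots> \<le> norm (c *\<^sub>C x) * norm y"
    by (rule norm_cauchy_schwarz)
  also have "\<dots> \<le> 1 * norm x * norm y"
    by (intro mult_right_mono) (auto simp: norm_scaleC c_def norm_sgn)
  finally show ?thesis by simp
qed

lemma bounded_linear_scaleC_right: "bounded_linear (\<lambda>x::'a::complex_inner. c *\<^sub>C x)"
  by (rule bounded_linear_intro[where K = "cmod c"])
     (auto simp: scaleC_add_right scaleR_scaleC scaleC_scaleC norm_scaleC mult.commute)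

section \<open>Riesz representation and adjoints\<close>

text \<open>The representing vector minimises \<open>J x = |x|^2 / 2 - f x\<close>: the
  parallelogram law makes a minimising sequence Cauchy, and vanishing of the first variation at its
  limit \<open>z\<close> reads \<open>f x = inner x z\<close>. The real version suffices, because a
  complex inner product is determined by its real part.\<close>

lemma riesz_representation:
  fixes f :: "'a::{real_inner, complete_space} \<Rightarrow> real"
  assumes "bounded_linear f"
  shows "\<exists>z. \<forall>x. f x = inner x z"
proof -
  interpret f: bounded_linear f by fact
  obtain K where K: "\<And>x. norm (f x) \<le> norm x * K"
    using f.bounded by blast
  define J where "J x = (norm x)\<^sup>2 / 2 - f x" for x
  have lower: "- K\<^sup>2 / 2 \<le> J x" for x
  proof -
    have "f x \<le> norm x * K" using K[of x] by simp
    moreover have "0 \<le> (norm x - K)\<^sup>2" by simp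
    ultimately show ?thesis
      by (simp add: J_def power2_eq_square algebra_simps)
  qed
  define m where "m = Inf (range J)"
  have bdd: "bdd_below (range J)"
    using lower by (auto intro!: bdd_belowI)
  have m: "m \<le> J x" for x
    unfolding m_def by (rule cInf_lower[OF _ bdd]) auto
  have "\<exists>x. J x < m + 1 / Suc n" for n
    using cInf_lessD[of "range J" "m + 1 / Suc n"] unfolding m_def by auto
  then obtain X where X: "\<And>n. J (X n) < m + 1 / Suc n" by metis
  have par: "(norm (x - y))\<^sup>2 \<le> 4 * (J x + J y - 2 * m)" for x y
  proof -
    have "2 * J ((1/2) *\<^sub>R (x + y)) + (norm (x - y))\<^sup>2 / 4 = J x + J y"
      by (simp add: J_def f.scaleR f.add power2_norm_eq_inner inner_add inner_diff inner_commute
          field_simps)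
    with m[of "(1/2) *\<^sub>R (x + y)"] show ?thesis by simp
  qed
  have "Cauchy X"
  proof (rule CauchyI)
    fix e :: real assume "0 < e"
    obtain N where N: "8 / e\<^sup>2 < real (Suc N)"
      by (metis of_nat_Suc reals_Archimedean2 less_trans lessI of_nat_less_iff)
    show "\<exists>M. \<forall>m\<ge>M. \<forall>n\<ge>M. norm (X m - X n) < e"
    proof (intro exI allI impI)
      fix i j assume ij: "N \<le> i" "N \<le> j"
      have le: "1 / Suc k \<le> 1 / real (Suc N)" if "N \<le> k" for k
        using that by (intro divide_left_mono) auto
      have "(norm (X i - X j))\<^sup>2 \<le> 4 * (J (X i) + J (X j) - 2 * m)"
        by (rule par)
      also have "\<dots> < 8 / real (Suc N)"
        using X[of i] X[of j] le[OF ij(1)] le[OF ij(2)] by simp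
      also have "\<dots> < e\<^sup>2"
        using N \<open>0 < e\<close> by (simp add: field_simps)
      finally show "norm (X i - X j) < e"
        using \<open>0 < e\<close> by (simp add: power2_less_imp_less)
    qed
  qed
  then obtain z where z: "X \<longlonglongrightarrow> z"
    using Cauchy_convergent convergent_def by blast
  have "(\<lambda>n. J (X n)) \<longlonglongrightarrow> J z"
    unfolding J_def by (intro tendsto_intros z f.tendsto) auto
  moreover have "(\<lambda>n. m + 1 / real (Suc n)) \<longlonglongrightarrow> m + 0"
    using tendsto_add[OF tendsto_const LIMSEQ_inverse_real_of_nat] by (simp add: inverse_eq_divide)
  ultimately have Jz: "J z \<le> m"
    using X by (intro LIMSEQ_le[of "\<lambda>n. J (X n)" "J z" "\<lambda>n. m + 1 / real (Suc n)" m]) (auto intro: less_imp_le)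
  have "f x = inner x z" for x
  proof (rule ccontr)
    assume "f x \<noteq> inner x z"
    define d where "d = inner x z - f x"
    have "d \<noteq> 0" using \<open>f x \<noteq> inner x z\<close> by (simp add: d_def)
    have q: "0 \<le> t * d + t\<^sup>2 * (norm x)\<^sup>2 / 2" for t
    proof -
      have "J z \<le> J (z + t *\<^sub>R x)" using Jz m[of "z + t *\<^sub>R x"] by simp
      moreover have "(norm (z + t *\<^sub>R x))\<^sup>2 = (norm z)\<^sup>2 + 2 * (t * inner x z) + t\<^sup>2 * (norm x)\<^sup>2"
        unfolding power2_norm_eq_inner by (simp add: inner_add inner_commute power2_eq_square algebra_simps)
      ultimately show ?thesis
        by (simp add: J_def d_def f.add f.scaleR algebra_simps)
    qed
    \<comment> \<open>The variation is tested at \<open>t = - s d\<close>. Since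
      \<open>s |x|^2 <= 1\<close>, the quadratic term costs at most half of the linear gain; the
      \<open>+ 1\<close> covers \<open>x = 0\<close>.\<close>
    define s where "s = 1 / ((norm x)\<^sup>2 + 1)"
    have "s > 0" unfolding s_def by (simp add: add_nonneg_pos)
    have "s * ((norm x)\<^sup>2 + 1) = 1"
      unfolding s_def by (smt (verit) nonzero_eq_divide_eq zero_le_power2)
    then have "s * (norm x)\<^sup>2 \<le> 1" using \<open>s > 0\<close> by (simp add: algebra_simps)
    have "0 \<le> - s * d * d + (s * d)\<^sup>2 * (norm x)\<^sup>2 / 2"
      using q[of "- s * d"] by simp
    also have "\<dots> = s * d\<^sup>2 * (s * (norm x)\<^sup>2 / 2 - 1)"
      by (simp add: power2_eq_square algebra_simps)
    also have "\<dots> < 0"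
      using \<open>s > 0\<close> \<open>d \<noteq> 0\<close> \<open>s * (norm x)\<^sup>2 \<le> 1\<close> by (intro mult_pos_neg) auto
    finally show False by simp
  qed
  then show ?thesis by blast
qed

lemma bounded_clinear_linear: "bounded_clinear T \<Longrightarrow> bounded_linear T"
  by (simp add: bounded_clinear_def)

lemma bounded_clinear_scaleC: "bounded_clinear T \<Longrightarrow> T (c *\<^sub>C x) = c *\<^sub>C T x"
  by (simp add: bounded_clinear_def)

lemma bounded_clinear_add: "bounded_clinear T \<Longrightarrow> T (x + y) = T x + T y"
  by (simp add: bounded_clinear_def linear_simps)

lemma bounded_clinear_diff: "bounded_clinear T \<Longrightarrow> T (x - y) = T x - T y"
  by (simp add: bounded_clinear_def linear_simps)

lemma bounded_clinear_zero: "bounded_clinear T \<Longrightarrow> T 0 = 0"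
  by (simp add: bounded_clinear_def linear_simps)

lemma bounded_clinear_uminus: "bounded_clinear T \<Longrightarrow> T (- x) = - T x"
  by (simp add: bounded_clinear_def linear_simps)

lemma bounded_clinear_sum: "bounded_clinear T \<Longrightarrow> T (sum f A) = (\<Sum>i\<in>A. T (f i))"
  by (simp add: bounded_clinear_def bounded_linear.linear linear_sum)

lemma bounded_clinear_continuous: "bounded_clinear T \<Longrightarrow> continuous_on UNIV T"
  by (simp add: bounded_clinear_def linear_continuous_on)

text \<open>\<open>adj\<close> is a choice by \<open>SOME\<close>, so its characteristic equation
  rests on existence. Riesz gives a vector matching the real parts; the imaginary parts follow since
  \<open>T\<close> commutes with \<open>\<i>\<close> and multiplication by \<open>\<i>\<close> is
  skew for the real inner product.\<close>

lemma cinner_adj: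
  fixes T :: "'a::chilbert_space \<Rightarrow> 'a"
  assumes "bounded_clinear T"
  shows "cinner (T x) y = cinner x (adj T y)"
proof -
  have "\<exists>z. \<forall>x. cinner (T x) y = cinner x z" for y
  proof -
    have "bounded_linear (\<lambda>x. inner (T x) y)"
      using assms bounded_linear_compose[OF bounded_linear_inner_left bounded_clinear_linear] by blast
    then obtain z where z: "\<And>x. inner (T x) y = inner x z"
      using riesz_representation by blast
    have "cinner (T x) y = cinner x z" for x
    proof (rule complex_eqI)
      have ii: "inner u (\<i> *\<^sub>C v) = - inner (\<i> *\<^sub>C u) v" for u v :: 'a
        using inner_scaleC_ii[of u "\<i> *\<^sub>C v"] by (simp add: scaleC_ii_ii)
      show "Im (cinner (T x) y) = Im (cinner x z)"
        by (simp add: Im_cinner ii z flip: bounded_clinear_scaleC[OF assms])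
    qed (simp add: z)
    then show ?thesis by blast
  qed
  then have "\<exists>S. \<forall>x y. cinner (T x) y = cinner x (S y)" by metis
  from someI_ex[OF this] show ?thesis
    unfolding adj_def by blast
qed

lemma cinner_adj':
  fixes T :: "'a::chilbert_space \<Rightarrow> 'a"
  assumes "bounded_clinear T"
  shows "cinner (adj T x) y = cinner x (T y)"
  by (metis assms cinner_adj cinner_commute)

lemma adj_eqI:
  fixes T :: "'a::chilbert_space \<Rightarrow> 'a"
  assumes "bounded_clinear T" and "\<And>x y. cinner (T x) y = cinner x (S y)"
  shows "adj T = S"
  by (intro ext cinner_eqI) (metis assms cinner_adj)

lemma bounded_clinear_adj:
  fixes T :: "'a::chilbert_space \<Rightarrow> 'a"
  assumes T: "bounded_clinear T"
  shows "bounded_clinear (adj T)"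
proof -
  obtain K where K: "\<And>x. norm (T x) \<le> norm x * K" "K \<ge> 0"
    using bounded_linear.nonneg_bounded[OF bounded_clinear_linear[OF T]] by metis
  have add: "adj T (x + y) = adj T x + adj T y" for x y
    by (rule cinner_eqI) (simp add: cinner_add_right flip: cinner_adj[OF T])
  have scale: "adj T (c *\<^sub>C x) = c *\<^sub>C adj T x" for c x
    by (rule cinner_eqI) (simp add: cinner_scaleC_right flip: cinner_adj[OF T])
  have "norm (adj T x) \<le> norm x * K" for x
  proof -
    have "inner (T (adj T x)) x = inner (adj T x) (adj T x)"
      using arg_cong[OF cinner_adj[OF T, of "adj T x" x], of Re] by (simp only: Re_cinner)
    then have "norm (adj T x) * norm (adj T x) = inner (T (adj T x)) x"
      by (simp only: power2_norm_eq_inner[symmetric] power2_eq_square)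
    also have "\<dots> \<le> norm (T (adj T x)) * norm x"
      by (rule norm_cauchy_schwarz)
    also have "\<dots> \<le> norm (adj T x) * K * norm x"
      by (intro mult_right_mono K) auto
    finally have "norm (adj T x) * norm (adj T x) \<le> norm (adj T x) * (norm x * K)"
      by (simp add: ac_simps)
    then show ?thesis
      using K(2) by (cases "adj T x = 0") auto
  qed
  then have "bounded_linear (adj T)"
    by (intro bounded_linear_intro[where K = K]) (auto simp: add scale scaleR_scaleC)
  with scale show ?thesis by (simp add: bounded_clinear_def)
qed

lemma bounded_clinear_compose:
  "bounded_clinear S \<Longrightarrow> bounded_clinear T \<Longrightarrow> bounded_clinear (\<lambda>x. S (T x))"
  by (simp add: bounded_clinear_def bounded_linear_compose)

lemma bounded_clinear_plus:
  "bounded_clinear S \<Longrightarrow> bounded_clinear T \<Longrightarrow> bounded_clinear (\<lambda>x. S x + T x)"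
  by (simp add: bounded_clinear_def bounded_linear_add scaleC_add_right)

lemma bounded_clinear_minus:
  "bounded_clinear S \<Longrightarrow> bounded_clinear T \<Longrightarrow> bounded_clinear (\<lambda>x. S x - T x)"
  by (simp add: bounded_clinear_def bounded_linear_sub cvec.scale_right_diff_distrib)

lemma bounded_clinear_scale:
  "bounded_clinear T \<Longrightarrow> bounded_clinear (\<lambda>x. c *\<^sub>C T x)"
  by (simp add: bounded_clinear_def bounded_linear_compose[OF bounded_linear_scaleC_right]
      scaleC_scaleC mult.commute)

lemma bounded_clinear_id: "bounded_clinear (\<lambda>x. x)"
  by (simp add: bounded_clinear_def)

section \<open>Polynomials of an operator\<close>

definition poly_op :: "complex poly \<Rightarrow> ('a::complex_vector \<Rightarrow> 'a) \<Rightarrow> 'a \<Rightarrow> 'a" where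
  "poly_op p T x = (\<Sum>i\<le>degree p. coeff p i *\<^sub>C (T ^^ i) x)"

lemma poly_op_eq_sum:
  assumes "degree p \<le> n"
  shows "poly_op p T x = (\<Sum>i\<le>n. coeff p i *\<^sub>C (T ^^ i) x)"
  unfolding poly_op_def using assms
  by (intro sum.mono_neutral_left) (auto simp: coeff_eq_0)

lemma poly_op_pCons:
  assumes "bounded_clinear T"
  shows "poly_op (pCons a p) T x = a *\<^sub>C x + T (poly_op p T x)"
proof -
  have "poly_op (pCons a p) T x = (\<Sum>i\<le>Suc (degree p). coeff (pCons a p) i *\<^sub>C (T ^^ i) x)"
    by (rule poly_op_eq_sum) (simp add: degree_pCons_le)
  also have "\<dots> = a *\<^sub>C x + (\<Sum>i\<le>degree p. coeff p i *\<^sub>C T ((T ^^ i) x))"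
    by (subst sum.atMost_Suc_shift) simp
  finally show ?thesis
    by (simp add: poly_op_def bounded_clinear_sum[OF assms] bounded_clinear_scaleC[OF assms])
qed

lemma poly_op_0 [simp]: "poly_op 0 T x = 0"
  by (simp add: poly_op_def)

lemma poly_op_add: "poly_op (p + q) T x = poly_op p T x + poly_op q T x"
proof -
  define n where "n = max (degree p) (degree q)"
  have "degree (p + q) \<le> n" "degree p \<le> n" "degree q \<le> n"
    by (auto simp: n_def degree_add_le_max)
  then show ?thesis
    by (simp add: poly_op_eq_sum scaleC_add_left sum.distrib)
qed

lemma poly_op_smult: "poly_op (smult c p) T x = c *\<^sub>C poly_op p T x"
  by (subst poly_op_eq_sum[of _ "degree p"])
     (simp_all add: degree_smult_le poly_op_def cvec.scale_sum_right scaleC_scaleC)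

lemma bounded_clinear_poly_op:
  assumes "bounded_clinear T"
  shows "bounded_clinear (poly_op p T)"
proof (induction p)
  case 0
  have "poly_op 0 T = (\<lambda>_. 0)" by (rule ext) simp
  then show ?case by (simp add: bounded_clinear_def)
next
  case (pCons a p)
  have "poly_op (pCons a p) T = (\<lambda>x. a *\<^sub>C x + T (poly_op p T x))"
    using poly_op_pCons[OF assms] by blast
  then show ?case
    by (simp only:) (intro bounded_clinear_plus bounded_clinear_scale bounded_clinear_id
        bounded_clinear_compose[OF assms] pCons)
qed

lemma poly_op_mult:
  assumes T: "bounded_clinear T"
  shows "poly_op (p * q) T x = poly_op p T (poly_op q T x)"
proof (induction p)
  case (pCons a p)
  then show ?case
    by (simp add: mult_pCons_left poly_op_add poly_op_smult poly_op_pCons[OF T])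
qed simp

text \<open>Division of \<open>p\<close> by \<open>[:- \<mu>, 1:]\<close> leaves the remainder
  \<open>poly p \<mu>\<close>. If that is nonzero, the vanishing of \<open>p\<close> at
  \<open>T\<close> turns the rescaled quotient into a bounded two-sided inverse of
  \<open>T - \<mu>\<close>.\<close>

lemma spectrum_poly_op_zero:
  fixes T :: "'a::complex_inner \<Rightarrow> 'a"
  assumes T: "bounded_clinear T" and zero: "\<And>x. poly_op p T x = 0" and "\<mu> \<in> spectrum T"
  shows "poly p \<mu> = 0"
proof (rule ccontr)
  assume nz: "poly p \<mu> \<noteq> 0"
  define q where "q = smult (- 1 / poly p \<mu>) (synthetic_div p \<mu>)"
  have "p = [:- \<mu>, 1:] * synthetic_div p \<mu> + [:poly p \<mu>:]"
    using synthetic_div_correct'[of \<mu> p] by (simp add: add.commute)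
  then have "[:- \<mu>, 1:] * synthetic_div p \<mu> = p - [:poly p \<mu>:]"
    by (metis add_diff_cancel_right')
  then have *: "[:- \<mu>, 1:] * q = smult (- 1 / poly p \<mu>) p + 1"
    using nz by (simp add: q_def smult_diff_right mult_smult_right del: mult_pCons_left)
  have one: "poly_op 1 T x = x" for x
    by (simp add: poly_op_def)
  have lin: "poly_op [:- \<mu>, 1:] T x = T x - \<mu> *\<^sub>C x" for x
    by (simp add: poly_op_pCons[OF T] bounded_clinear_zero[OF T] cvec.scale_minus_left)
  have "poly_op (smult (- 1 / poly p \<mu>) p + 1) T x = x" for x
    by (simp only: poly_op_add poly_op_smult zero one) simp
  then have "poly_op ([:- \<mu>, 1:] * q) T x = x" for x
    by (simp only: *)
  then have "T (poly_op q T x) - \<mu> *\<^sub>C poly_op q T x = x" "poly_op q T (T x - \<mu> *\<^sub>C x) = x" for x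
    by (metis poly_op_mult[OF T] lin, metis poly_op_mult[OF T] lin mult.commute)
  then have "\<mu> \<notin> spectrum T"
    unfolding spectrum_def using bounded_clinear_poly_op[OF T] by blast
  with assms(3) show False by simp
qed

lemma eigenvalue_in_spectrum:
  assumes "T x = \<mu> *\<^sub>C x" and "x \<noteq> 0"
  shows "\<mu> \<in> spectrum T"
proof -
  have False if "bounded_clinear S" "\<And>x. S (T x - \<mu> *\<^sub>C x) = x" for S
    using that(2)[of x] assms bounded_clinear_zero[OF that(1)] by simp
  then show ?thesis by (auto simp: spectrum_def)
qed

text \<open>Linear factors of \<open>p\<close> are applied one by one until the vector is killed;
  the last nonzero vector is an eigenvector. Its form \<open>poly_op q T v\<close> matters: later
  \<open>v\<close> lies in the range of \<open>X\<close>, and the eigenvector has to lie there as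
  well.\<close>

lemma poly_op_kernel_eigenvector:
  fixes T :: "'a::complex_inner \<Rightarrow> 'a"
  assumes T: "bounded_clinear T"
  shows "p \<noteq> 0 \<Longrightarrow> v \<noteq> 0 \<Longrightarrow> poly_op p T v = 0 \<Longrightarrow> \<exists>q c. poly_op q T v \<noteq> 0 \<and> T (poly_op q T v) = c *\<^sub>C poly_op q T v"
proof (induction "degree p" arbitrary: p v)
  case 0
  then obtain a where "p = [:a:]" by (metis degree_eq_zeroE)
  with 0 show ?case by (auto simp: poly_op_pCons[OF T] bounded_clinear_zero[OF T])
next
  case (Suc n)
  then have "\<not> constant (poly p)" by (simp add: constant_degree)
  then obtain c where "poly p c = 0" using fundamental_theorem_of_algebra by blast
  then obtain r where r: "p = [:- c, 1:] * r" by (auto simp: poly_eq_0_iff_dvd)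
  with Suc have "r \<noteq> 0" by auto
  have "degree r = n"
    using Suc(2) \<open>r \<noteq> 0\<close> unfolding r by (subst (asm) degree_mult_eq) auto
  define w where "w = poly_op [:- c, 1:] T v"
  have w: "w = T v - c *\<^sub>C v"
    by (simp add: w_def poly_op_pCons[OF T] bounded_clinear_zero[OF T] cvec.scale_minus_left)
  show ?case
  proof (cases "w = 0")
    case True
    then show ?thesis
      using \<open>v \<noteq> 0\<close> w by (intro exI[of _ 1] exI[of _ c]) (simp add: poly_op_def)
  next
    case False
    have "poly_op r T w = 0"
      using Suc(5) unfolding r w_def by (metis poly_op_mult[OF T] mult.commute)
    then obtain q d where "poly_op q T w \<noteq> 0 \<and> T (poly_op q T w) = d *\<^sub>C poly_op q T w"
      using Suc(1)[of r w] \<open>degree r = n\<close> \<open>r \<noteq> 0\<close> False by blast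
    then show ?thesis
      unfolding w_def by (metis poly_op_mult[OF T])
  qed
qed

section \<open>Complex spans, closures and ranks\<close>

lemma csubspace_iff: "csubspace = cvec.subspace"
  by (simp add: fun_eq_iff csubspace_def cvec.subspace_def)

lemma cspan_fin_eq: "finite B \<Longrightarrow> cspan_fin B = cvec.span B"
  by (auto simp: cspan_fin_def cvec.span_finite)

lemma cindependent_fin_iff: "finite B \<Longrightarrow> cindependent_fin B \<longleftrightarrow> cvec.independent B"
  by (auto simp: cindependent_fin_def cvec.dependent_finite)

lemma csubspace_closure:
  fixes M :: "'a::complex_inner set"
  assumes "csubspace M"
  shows "csubspace (closure M)"
  unfolding csubspace_def
proof (intro conjI allI ballI)
  show "0 \<in> closure M"
    using assms closure_subset by (auto simp: csubspace_def)
next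
  fix x y assume "x \<in> closure M" "y \<in> closure M"
  then obtain f g where "\<And>n. f n \<in> M" "f \<longlonglongrightarrow> x" "\<And>n. g n \<in> M" "g \<longlonglongrightarrow> y"
    by (auto simp: closure_sequential)
  with assms show "x + y \<in> closure M"
    unfolding closure_sequential csubspace_def
    by (intro exI[of _ "\<lambda>n. f n + g n"]) (auto intro: tendsto_add)
next
  fix c x assume "x \<in> closure M"
  then obtain f where "\<And>n. f n \<in> M" "f \<longlonglongrightarrow> x"
    by (auto simp: closure_sequential)
  with assms show "c *\<^sub>C x \<in> closure M"
    unfolding closure_sequential csubspace_def
    by (intro exI[of _ "\<lambda>n. c *\<^sub>C f n"])
       (auto intro: bounded_linear.tendsto[OF bounded_linear_scaleC_right])
qed

lemma bounded_clinear_span: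
  assumes T: "bounded_clinear T" and "T ` S \<subseteq> cvec.span S'"
  shows "T ` cvec.span S \<subseteq> cvec.span S'"
proof (clarify)
  fix x assume "x \<in> cvec.span S"
  then show "T x \<in> cvec.span S'"
  proof (induction rule: cvec.span_induct_alt)
    case base
    then show ?case by (simp add: bounded_clinear_zero[OF T] cvec.span_zero)
  next
    case (step c x y)
    then show ?case
      using assms(2) by (auto simp: bounded_clinear_add[OF T] bounded_clinear_scaleC[OF T]
          intro!: cvec.span_add cvec.span_scale)
  qed
qed

lemma bounded_clinear_closure_span:
  assumes T: "bounded_clinear T" and "T ` S \<subseteq> cvec.span S'"
  shows "T ` closure (cvec.span S) \<subseteq> closure (cvec.span S')"
  using closure_mono[OF bounded_clinear_span[OF assms]]
    image_closure_subset[OF continuous_on_subset[OF bounded_clinear_continuous[OF T]],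
      of "cvec.span S" "closure (cvec.span S')"] closure_subset
    bounded_clinear_span[OF assms] by blast

text \<open>Operator identities below are verified only on the vectors \<open>w x a b\<close>, whose
  span turns out to be dense.\<close>

lemma bounded_clinear_eq_dense:
  assumes T: "bounded_clinear T" and T': "bounded_clinear T'"
    and "closure (cvec.span S) = UNIV" and "\<And>x. x \<in> S \<Longrightarrow> T x = T' x"
  shows "T x = T' x"
proof -
  have "(\<lambda>x. T x - T' x) ` S \<subseteq> cvec.span {}"
    using assms(4) by auto
  then have "(\<lambda>x. T x - T' x) ` closure (cvec.span S) \<subseteq> closure (cvec.span {})"
    by (rule bounded_clinear_closure_span[OF bounded_clinear_minus[OF T T']])
  then have "T x - T' x \<in> closure (cvec.span {})"
    unfolding assms(3) by blast
  then show ?thesis by simp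
qed

lemma poly_op_dvd_zero:
  assumes T: "bounded_clinear T" and "q dvd p" and "poly_op q T u = 0"
  shows "poly_op p T u = 0"
proof -
  obtain r where "p = r * q" using assms(2) by (metis dvdE mult.commute)
  then show ?thesis
    by (simp add: poly_op_mult[OF T] assms(3) bounded_clinear_zero[OF bounded_clinear_poly_op[OF T]])
qed

lemma has_rank_le_card:
  assumes "has_rank T n" and "finite S" and "range T \<subseteq> cvec.span S"
  shows "n \<le> card S"
proof -
  obtain B where B: "finite B" "card B = n" "cindependent_fin B" "range T = cspan_fin B"
    using assms(1) by (auto simp: has_rank_def)
  have "B \<subseteq> cvec.span S"
    using B assms(3) cvec.span_superset by (fastforce simp: cspan_fin_eq)
  then show ?thesis
    using cvec.independent_span_bound[OF assms(2)] B by (auto simp: cindependent_fin_iff)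
qed

text \<open>More than \<open>card B\<close> iterates of \<open>T\<close> at \<open>v\<close> are
  linearly dependent, and a dependence between iterates is a polynomial.\<close>

lemma poly_op_annihilator_exists:
  fixes T :: "'a::complex_vector \<Rightarrow> 'a"
  assumes "finite B" and "\<And>i. (T ^^ i) v \<in> cvec.span B"
  shows "\<exists>p\<noteq>0. poly_op p T v = 0"
proof -
  define n where "n = card B"
  define f where "f i = (T ^^ i) v" for i
  show ?thesis
  \<comment> \<open>Dependence is a property of sets and yields coefficients only for distinct
    iterates. If two iterates coincide, the difference of two monomials annihilates
    \<open>v\<close>.\<close>
  proof (cases "inj_on f {..n}")
    case True
    then have "card (f ` {..n}) = Suc n" by (simp add: card_image)
    then have "cvec.dependent (f ` {..n})"
      using cvec.independent_span_bound[OF assms(1), of "f ` {..n}"] assms(2)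
      by (auto simp: n_def f_def)
    then obtain u where u: "(\<Sum>w\<in>f ` {..n}. u w *\<^sub>C w) = 0" "\<exists>w\<in>f ` {..n}. u w \<noteq> 0"
      by (auto simp: cvec.dependent_finite)
    define p where "p = (\<Sum>i\<le>n. monom (u (f i)) i)"
    have coeff: "coeff p k = (if k \<le> n then u (f k) else 0)" for k
      by (simp add: p_def coeff_sum)
    have "degree p \<le> n" by (rule degree_le) (simp add: coeff)
    then have "poly_op p T v = (\<Sum>i\<le>n. u (f i) *\<^sub>C f i)"
      by (simp add: poly_op_eq_sum coeff f_def)
    also have "\<dots> = 0" using u(1) by (simp add: sum.reindex[OF True])
    finally have "poly_op p T v = 0" .
    moreover have "p \<noteq> 0" using u(2) coeff by (metis (mono_tags, lifting) coeff_0 imageE atMost_iff)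
    ultimately show ?thesis by blast
  next
    case False
    then obtain i j where ij: "i \<noteq> j" "f i = f j" by (auto simp: inj_on_def)
    define p :: "complex poly" where "p = monom 1 i + smult (-1) (monom 1 j)"
    have mon: "poly_op (monom 1 k) T v = f k" for k
    proof -
      have "poly_op (monom 1 k) T v = (\<Sum>i\<le>k. coeff (monom 1 k) i *\<^sub>C (T ^^ i) v)"
        by (rule poly_op_eq_sum) (simp add: degree_monom_eq)
      also have "\<dots> = (\<Sum>i\<le>k. if i = k then f k else 0)"
        by (intro sum.cong) (auto simp: f_def)
      finally show ?thesis by simp
    qed
    have "poly_op p T v = 0"
      using ij(2) by (simp add: p_def poly_op_add poly_op_smult mon cvec.scale_minus_left
          del: smult_minus_left)
    moreover have "coeff p i = 1" using ij(1) by (simp add: p_def)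
    then have "p \<noteq> 0" by auto
    ultimately show ?thesis by blast
  qed
qed

section \<open>Commuting isometries\<close>

lemma isometry_cinner:
  assumes "isometry V"
  shows "cinner (V x) (V y) = cinner x y"
proof -
  have V: "bounded_clinear V" "\<And>x. norm (V x) = norm x"
    using assms by (auto simp: isometry_def)
  have i: "inner (V x) (V y) = inner x y" for x y
    by (simp add: dot_norm V(2) flip: bounded_clinear_add[OF V(1)])
  then show ?thesis
    by (simp add: complex_eq_iff Im_cinner flip: bounded_clinear_scaleC[OF V(1)])
qed

lemma adj_isometry:
  fixes V :: "'a::chilbert_space \<Rightarrow> 'a"
  assumes "isometry V"
  shows "adj V (V x) = x"
  by (rule cinner_eqI)
     (metis assms cinner_adj isometry_cinner isometry_def)

locale commuting_isometries =
  fixes V1 V2 :: "'a::chilbert_space \<Rightarrow> 'a"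
  assumes isometry1: "isometry V1" and isometry2: "isometry V2"
    and commute: "V1 (V2 x) = V2 (V1 x)"
begin

abbreviation "A \<equiv> adj V1"
abbreviation "B \<equiv> adj V2"
abbreviation "X \<equiv> cross_comm V1 V2"
abbreviation "Y \<equiv> cross_comm V2 V1"
abbreviation "D \<equiv> defect_op V1 V2"

lemma bcl: "bounded_clinear V1" "bounded_clinear V2" "bounded_clinear A" "bounded_clinear B"
  using isometry1 isometry2 by (auto simp: isometry_def bounded_clinear_adj)

lemmas lin_simps =
  bcl[THEN bounded_clinear_add] bcl[THEN bounded_clinear_diff] bcl[THEN bounded_clinear_zero]
  bcl[THEN bounded_clinear_scaleC]

lemma AV1 [simp]: "A (V1 x) = x" and BV2 [simp]: "B (V2 x) = x"
  by (simp_all add: adj_isometry isometry1 isometry2)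

lemma adj_commute: "A (B x) = B (A x)"
  by (rule cinner_eqI) (simp add: commute flip: cinner_adj[OF bcl(1)] cinner_adj[OF bcl(2)])

lemma bounded_clinear_X: "bounded_clinear X"
  unfolding cross_comm_def
  by (rule bounded_clinear_minus[OF bounded_clinear_compose[OF bcl(4,1)] bounded_clinear_compose[OF bcl(1,4)]])

lemma bounded_clinear_D: "bounded_clinear D"
  unfolding defect_op_def
  by (rule bounded_clinear_plus[OF
        bounded_clinear_minus[OF
          bounded_clinear_minus[OF bounded_clinear_id bounded_clinear_compose[OF bcl(1,3)]]
          bounded_clinear_compose[OF bcl(2,4)]]
        bounded_clinear_compose[OF bcl(1)
          bounded_clinear_compose[OF bcl(2) bounded_clinear_compose[OF bcl(3,4)]]]])

text \<open>Exchanging the two isometries in the cross commutator amounts to taking its adjoint, so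
  every fact on \<open>X\<close> has a mirror image on \<open>Y\<close>.\<close>

lemma adj_X: "adj X = Y"
  by (rule adj_eqI[OF bounded_clinear_X])
     (simp add: cross_comm_def cinner_diff_left cinner_diff_right cinner_adj[OF bcl(1)]
      cinner_adj'[OF bcl(2)])

text \<open>Here \<open>B V1 V2 = B V2 V1 = V1\<close>, so commutation alone is enough. The two
  remaining ranges are the ones for which normality is used.\<close>

lemma X_V2 [simp]: "X (V2 x) = 0"
  by (simp add: cross_comm_def commute)

lemma Y_V1 [simp]: "Y (V1 x) = 0"
  by (simp add: cross_comm_def flip: commute)

lemma A_X [simp]: "A (X x) = 0"
  by (simp add: cross_comm_def lin_simps adj_commute)

definition w :: "'a \<Rightarrow> nat \<Rightarrow> nat \<Rightarrow> 'a" where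
  "w x a b = (V1 ^^ a) ((V2 ^^ b) x)"

lemma w_0_0 [simp]: "w x 0 0 = x"
  and V1_w [simp]: "V1 (w x a b) = w x (Suc a) b"
  by (simp_all add: w_def)

lemma V2_w [simp]: "V2 (w x a b) = w x a (Suc b)"
proof -
  have "V2 ((V1 ^^ a) y) = (V1 ^^ a) (V2 y)" for y
    by (induction a) (simp_all flip: commute)
  then show ?thesis by (simp add: w_def)
qed

lemma A_w_Suc [simp]: "A (w x (Suc a) b) = w x a b"
  by (simp flip: V1_w)

lemma B_w_Suc [simp]: "B (w x a (Suc b)) = w x a b"
  by (simp flip: V2_w)

end

section \<open>Consequences of normality of the cross commutator\<close>

locale normal_cross_comm = commuting_isometries +
  assumes normal: "normal_op X"
begin

lemma X_Y_commute: "X (Y x) = Y (X x)"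
  using normal by (metis normal_op_def adj_X comp_apply)

text \<open>\<open>X - \<mu>\<close> is normal along with \<open>X\<close>, and a normal operator
  and its adjoint have equal norms at every vector. For \<open>\<mu> = 0\<close> this identifies the
  kernels of \<open>X\<close> and \<open>Y\<close>.\<close>

lemma norm_X_Y: "norm (X x - \<mu> *\<^sub>C x) = norm (Y x - cnj \<mu> *\<^sub>C x)"
proof -
  have XY: "cinner (X u) v = cinner u (Y v)" "cinner (Y u) v = cinner u (X v)" for u v
    using cinner_adj[OF bounded_clinear_X] cinner_adj'[OF bounded_clinear_X] by (auto simp: adj_X)
  have "cinner (X x - \<mu> *\<^sub>C x) (X x - \<mu> *\<^sub>C x)
      = cinner (Y x - cnj \<mu> *\<^sub>C x) (Y x - cnj \<mu> *\<^sub>C x)"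
    by (simp add: cinner_diff_left cinner_diff_right cinner_scaleC_left cinner_scaleC_right XY
        X_Y_commute algebra_simps)
  then have "(norm (X x - \<mu> *\<^sub>C x))\<^sup>2 = (norm (Y x - cnj \<mu> *\<^sub>C x))\<^sup>2"
    unfolding cinner_self of_real_eq_iff .
  then show ?thesis by simp
qed

lemma X_eigen_imp_Y_eigen: "X x = \<mu> *\<^sub>C x \<Longrightarrow> Y x = cnj \<mu> *\<^sub>C x"
  using norm_X_Y[of x \<mu>] by simp

lemma X_zero_iff: "X x = 0 \<longleftrightarrow> Y x = 0"
  using norm_X_Y[of x 0] by (metis cvec.scale_zero_left complex_cnj_zero diff_zero norm_eq_zero)

lemma X_V1 [simp]: "X (V1 x) = 0" and Y_V2 [simp]: "Y (V2 x) = 0"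
  using X_zero_iff X_V2 Y_V1 by blast+

text \<open>The range of \<open>X\<close> is orthogonal to the range of \<open>V2\<close> because
  the adjoint \<open>Y\<close> kills the latter. Together with \<open>A_X\<close> this puts the
  range of \<open>X\<close> into both kernels.\<close>

lemma B_X [simp]: "B (X x) = 0"
proof (rule cinner_eqI)
  fix u
  have "cinner u (B (X x)) = cinner (V2 u) (X x)"
    by (simp add: cinner_adj bcl)
  also have "\<dots> = cinner (Y (V2 u)) x"
    using cinner_adj'[OF bounded_clinear_X] by (simp only: adj_X)
  finally show "cinner u (B (X x)) = cinner u 0" by simp
qed

text \<open>An eigenvector of \<open>X\<close> that lies in the range of \<open>X\<close> is
  automatically killed by \<open>A\<close> and \<open>B\<close>. If \<open>X = 0\<close>, any
  nonzero vector in the range of \<open>D\<close> serves instead, with eigenvalue 0.\<close>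

lemma exists_wandering_eigenvector:
  assumes rank: "has_rank D n" and "n > 0"
  obtains x \<mu> where "norm x = 1" "A x = 0" "B x = 0" "X x = \<mu> *\<^sub>C x"
proof -
  obtain S where S: "finite S" "card S = n" "cindependent_fin S" "range D = cspan_fin S"
    using rank by (auto simp: has_rank_def)
  have "\<exists>x \<mu>. x \<noteq> 0 \<and> A x = 0 \<and> B x = 0 \<and> X x = \<mu> *\<^sub>C x"
  proof (cases "\<forall>u. X u = 0")
    case True
    then have Y0: "Y u = 0" for u by (simp flip: X_zero_iff)
    obtain b where b: "b \<in> S" using S(2) \<open>n > 0\<close> by fastforce
    have "cvec.independent S" using S by (simp add: cindependent_fin_iff)
    then have "b \<noteq> 0" using b cvec.dependent_zero by blast
    have "b \<in> range D" using S b by (simp add: cspan_fin_eq cvec.span_base)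
    then obtain u where u: "b = D u" by blast
    \<comment> \<open>In general \<open>A D = - Y B\<close> and \<open>B D = - X A\<close>, so the
      range of \<open>D\<close> lies in both kernels once the two commutators vanish.\<close>
    have "A b = - Y (B u)" "B b = - X (A u)"
      unfolding u by (simp_all add: defect_op_def cross_comm_def lin_simps adj_commute)
         (simp_all add: commute)
    then show ?thesis
      using True Y0 \<open>b \<noteq> 0\<close> by (intro exI[of _ b] exI[of _ 0]) simp
  next
    case False
    then obtain u where u: "X u \<noteq> 0" by blast
    have range: "X y \<in> cvec.span S" for y
    proof -
      \<comment> \<open>By \<open>A X = B X = 0\<close> the defect operator is the identity on the
        range of \<open>X\<close>, which is therefore finite-dimensional.\<close>
      have "D (X y) = X y" by (simp add: defect_op_def lin_simps)
      then show ?thesis using S by (metis cspan_fin_eq rangeI)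
    qed
    have "(X ^^ i) (X u) \<in> cvec.span S" for i
      using range by (induction i) auto
    then obtain p where p: "p \<noteq> 0" "poly_op p X (X u) = 0"
      using poly_op_annihilator_exists[OF S(1)] by blast
    obtain q c where q: "poly_op q X (X u) \<noteq> 0"
      "X (poly_op q X (X u)) = c *\<^sub>C poly_op q X (X u)"
      using poly_op_kernel_eigenvector[OF bounded_clinear_X p(1) u p(2)] by blast
    \<comment> \<open>Polynomials in \<open>X\<close> commute with \<open>X\<close>, so the
      eigenvector lies in the range of \<open>X\<close> and is killed by \<open>A\<close> and
      \<open>B\<close>.\<close>
    have "poly_op q X (X u) = X (poly_op q X u)"
      using poly_op_mult[OF bounded_clinear_X, of q "[:0, 1:]" u]
        poly_op_mult[OF bounded_clinear_X, of "[:0, 1:]" q u]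
      by (simp add: poly_op_pCons[OF bounded_clinear_X] mult.commute
          bounded_clinear_zero[OF bounded_clinear_X])
    then show ?thesis
      using q by (intro exI[of _ "poly_op q X (X u)"] exI[of _ c]) simp
  qed
  then obtain x \<mu> where x: "x \<noteq> 0" "A x = 0" "B x = 0" "X x = \<mu> *\<^sub>C x" by blast
  show ?thesis
    by (rule that[of "complex_of_real (1 / norm x) *\<^sub>C x" \<mu>])
       (use x in \<open>simp_all add: norm_scaleC lin_simps bounded_clinear_scaleC[OF bounded_clinear_X]
          scaleC_scaleC norm_divide mult.commute\<close>)
qed

end

section \<open>The orbit of a wandering eigenvector\<close>

locale wandering_eigenvector = normal_cross_comm +
  fixes x :: 'a and \<mu> :: complex
  assumes norm_x: "norm x = 1" and A_x [simp]: "A x = 0" and B_x [simp]: "B x = 0"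
    and X_x: "X x = \<mu> *\<^sub>C x"
    and irreducible: "irreducible_pair V1 V2"
begin

lemma Y_x: "Y x = cnj \<mu> *\<^sub>C x"
  by (rule X_eigen_imp_Y_eigen[OF X_x])

text \<open>Moving \<open>B\<close> past one \<open>V1\<close> costs the term \<open>X\<close>,
  which vanishes on the range of \<open>V1\<close>. Only the innermost \<open>V1\<close>, applied to
  \<open>x\<close> itself, contributes, and there \<open>X x = \<mu> x\<close>.\<close>

lemma B_w_0: "B (w x (Suc a) 0) = \<mu> *\<^sub>C w x a 0"
proof (induction a)
  case 0
  show ?case using X_x by (simp add: cross_comm_def lin_simps flip: V1_w)
next
  case (Suc a)
  have "B (V1 (w x (Suc a) 0)) = X (w x (Suc a) 0) + V1 (B (w x (Suc a) 0))"
    by (simp add: cross_comm_def)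
  also have "X (w x (Suc a) 0) = 0" by (simp flip: V1_w)
  finally show ?case by (simp add: Suc lin_simps)
qed

lemma A_w_0: "A (w x 0 (Suc b)) = cnj \<mu> *\<^sub>C w x 0 b"
proof (induction b)
  case 0
  show ?case using Y_x by (simp add: cross_comm_def lin_simps flip: V2_w)
next
  case (Suc b)
  have "A (V2 (w x 0 (Suc b))) = Y (w x 0 (Suc b)) + V2 (A (w x 0 (Suc b)))"
    by (simp add: cross_comm_def)
  also have "Y (w x 0 (Suc b)) = 0" by (simp flip: V2_w)
  finally show ?case by (simp add: Suc lin_simps)
qed

abbreviation "W \<equiv> range (\<lambda>(a, b). w x a b)"

lemma w_in_span: "w x a b \<in> cvec.span W"
  by (rule cvec.span_base) auto

text \<open>Off the axes \<open>A\<close> and \<open>B\<close> merely lower an exponent; on the axes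
  \<open>A_w_0\<close> and \<open>B_w_0\<close> keep the span invariant.\<close>

lemma dense: "closure (cvec.span W) = UNIV"
proof -
  let ?M = "closure (cvec.span W)"
  have "V1 ` W \<subseteq> cvec.span W" "V2 ` W \<subseteq> cvec.span W"
    by (auto intro: w_in_span)
  moreover have "A ` W \<subseteq> cvec.span W"
  proof clarsimp
    fix a b
    show "A (w x a b) \<in> cvec.span W"
      by (cases a; cases b) (auto simp: A_w_0 cvec.span_zero intro!: w_in_span cvec.span_scale)
  qed
  moreover have "B ` W \<subseteq> cvec.span W"
  proof clarsimp
    fix a b
    show "B (w x a b) \<in> cvec.span W"
      by (cases a; cases b) (auto simp: B_w_0 cvec.span_zero intro!: w_in_span cvec.span_scale)
  qed
  ultimately have "V1 ` ?M \<subseteq> ?M" "V2 ` ?M \<subseteq> ?M" "A ` ?M \<subseteq> ?M" "B ` ?M \<subseteq> ?M"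
    by (intro bounded_clinear_closure_span bcl; simp)+
  moreover have "csubspace ?M"
    by (rule csubspace_closure) (simp add: csubspace_iff)
  ultimately have "?M = {0} \<or> ?M = UNIV"
    using irreducible by (simp add: irreducible_pair_def)
  moreover have "x \<in> ?M" using w_in_span[of 0 0] closure_subset by auto
  moreover have "x \<noteq> 0" using norm_x by auto
  ultimately show ?thesis by auto
qed

text \<open>A \<open>V2\<close> moved to the other side becomes \<open>B\<close>, which removes one
  \<open>V1\<close> at the cost of a factor \<open>\<mu>\<close>. Unequal powers end with
  \<open>x\<close> against a vector in the range of \<open>V1\<close> or \<open>V2\<close>, where
  orthogonality holds.\<close>

lemma cinner_V1_V2: "cinner (w x n 0) (w x 0 m) = (if n = m then \<mu> ^ n else 0)"
proof (induction n arbitrary: m)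
  case 0
  show ?case
  proof (cases m)
    case 0
    then show ?thesis by (simp add: cinner_self norm_x)
  next
    case (Suc k)
    then show ?thesis by (simp add: cinner_adj'[symmetric] bcl flip: V2_w)
  qed
next
  case (Suc n)
  show ?case
  proof (cases m)
    case 0
    then show ?thesis by (simp add: cinner_adj bcl flip: V1_w)
  next
    case (Suc k)
    have "cinner (w x (Suc n) 0) (V2 (w x 0 k)) = cinner (B (w x (Suc n) 0)) (w x 0 k)"
      by (simp only: cinner_adj' bcl)
    then show ?thesis
      using Suc by (simp add: B_w_0 cinner_scaleC_left Suc.IH)
  qed
qed

lemma cinner_w_shift: "cinner (w x (k + a) (l + b)) (w x (k + c) (l + d)) = cinner (w x a b) (w x c d)"
proof -
  have "cinner (w x (k + a) b) (w x (k + c) d) = cinner (w x a b) (w x c d)" for a b c d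
    by (induction k) (simp_all add: isometry_cinner[OF isometry1] flip: V1_w)
  moreover have "cinner (w x a (l + b)) (w x c (l + d)) = cinner (w x a b) (w x c d)" for a b c d
    by (induction l) (simp_all add: isometry_cinner[OF isometry2] flip: V2_w)
  ultimately show ?thesis by simp
qed

lemma cinner_x_w: "cinner x (w x a b) = (if a = 0 \<and> b = 0 then 1 else 0)"
proof (cases a)
  case 0
  then show ?thesis using cinner_V1_V2[of 0 b] by simp
next
  case (Suc k)
  then show ?thesis by (simp add: cinner_adj'[symmetric] bcl flip: V1_w)
qed

text \<open>Isometry strips the common powers of \<open>V1\<close> and of \<open>V2\<close>. Four
  sign patterns remain: in two of them one vector is \<open>x\<close> and orthogonality decides, in
  the other two a pure power of \<open>V1\<close> meets a pure power of \<open>V2\<close>.\<close>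

lemma gram:
  "cinner (w x a b) (w x c d) =
     (if a + b = c + d then (if c \<le> a then \<mu> ^ (a - c) else cnj \<mu> ^ (c - a)) else 0)"
proof -
  consider n m where "a = c + n" "b = d + m" | n m where "c = a + n" "d = b + m"
    | n m where "a = c + n" "d = b + m" | n m where "c = a + n" "b = d + m"
    by (metis le_iff_add nat_le_linear)
  then show ?thesis
  proof cases
    case (1 n m)
    then show ?thesis
      using cinner_w_shift[of c n d m 0 0] cinner_x_w[of n m]
      by (simp add: cinner_commute[of "w x n m" x] split: if_splits)
  next
    case (2 n m)
    then show ?thesis using cinner_w_shift[of a 0 b 0 n m] cinner_x_w[of n m]
      by (simp split: if_splits)
  next
    case (3 n m)
    then show ?thesis using cinner_w_shift[of c n b 0 0 m] cinner_V1_V2[of n m]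
      by simp
  next
    case (4 n m)
    then show ?thesis using cinner_w_shift[of a 0 d m n 0] cinner_V1_V2[of n m]
      by (simp add: cinner_commute[of "w x 0 m" "w x n 0"] split: if_splits)
  qed
qed

text \<open>The defect operator fixes \<open>x\<close>, exchanges \<open>V1 x\<close> and
  \<open>V2 x\<close> up to the factors \<open>- \<mu>\<close> and \<open>- cnj \<mu>\<close>, and
  kills the rest of the orbit. Rank and spectrum are read off from this and the next lemmas.\<close>

lemma D_x: "D x = x"
  by (simp add: defect_op_def lin_simps)

lemma D_w_1_0: "D (w x (Suc 0) 0) = - \<mu> *\<^sub>C w x 0 (Suc 0)"
  by (simp add: defect_op_def lin_simps B_w_0 cvec.scale_minus_left adj_commute) (simp add: w_def)

lemma D_w_0_1: "D (w x 0 (Suc 0)) = - cnj \<mu> *\<^sub>C w x (Suc 0) 0"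
  by (simp add: defect_op_def lin_simps A_w_0 cvec.scale_minus_left) (simp add: w_def)

lemma D_w: "a + b \<ge> 2 \<Longrightarrow> D (w x a b) = 0"
proof -
  assume ab: "a + b \<ge> 2"
  consider i j where "a = Suc i" "b = Suc j" | i where "a = Suc (Suc i)" "b = 0"
    | i where "a = 0" "b = Suc (Suc i)"
    using ab by (cases a; cases b; cases "a - 1"; cases "b - 1") auto
  then show ?thesis
    by cases (simp_all add: defect_op_def lin_simps A_w_0 B_w_0 adj_commute)
qed

text \<open>\<open>\<mu>\<close> is the inner product of the unit vectors \<open>V1 x\<close> and
  \<open>V2 x\<close>.\<close>

lemma cmod_\<mu>_le: "cmod \<mu> \<le> 1"
proof -
  have norm_w: "norm (w x a b) = 1" for a b
  proof -
    have "complex_of_real ((norm (w x a b))\<^sup>2) = of_real 1"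
      unfolding cinner_self[symmetric] by (simp add: gram)
    then have "(norm (w x a b))\<^sup>2 = 1\<^sup>2"
      unfolding of_real_eq_iff by simp
    then show ?thesis by (rule power2_eq_imp_eq) auto
  qed
  show ?thesis
    using norm_cinner_le[of "w x 1 0" "w x 0 1"] by (simp add: gram norm_w)
qed

text \<open>In both extreme cases the range of \<open>D\<close> lies in the span of the two vectors
  \<open>x\<close> and \<open>V2 x\<close>, against rank 3.\<close>

lemma \<mu>_bounds:
  assumes "has_rank D 3"
  shows "0 < cmod \<mu>" "cmod \<mu> < 1"
proof -
  have False if "cmod \<mu> = 0 \<or> cmod \<mu> = 1"
  proof -
    \<comment> \<open>One formula for both cases: for \<open>\<mu> = 0\<close> it is the projection
      onto \<open>x\<close>; for modulus 1 it is that projection minus the one onto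
      \<open>V2 x\<close>.\<close>
    let ?T = "\<lambda>u. cinner u x *\<^sub>C x - complex_of_real ((cmod \<mu>)\<^sup>2) *\<^sub>C cinner u (w x 0 1) *\<^sub>C w x 0 1"
    have bc: "bounded_clinear (\<lambda>u. cinner u v *\<^sub>C v')" for v v' :: 'a
      unfolding bounded_clinear_def
    proof
      show "bounded_linear (\<lambda>u. cinner u v *\<^sub>C v')"
      proof (rule bounded_linear_intro[where K = "norm v * norm v'"])
        fix u show "norm (cinner u v *\<^sub>C v') \<le> norm u * (norm v * norm v')"
          using norm_cinner_le[of u v] by (simp add: norm_scaleC mult_right_mono flip: mult.assoc)
      qed (simp_all add: cinner_add_left scaleC_add_left scaleR_scaleC cinner_scaleC_left scaleC_scaleC)
    qed (simp add: cinner_scaleC_left scaleC_scaleC)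
    then have T: "bounded_clinear ?T"
      by (intro bounded_clinear_minus bounded_clinear_scale)
    have rel: "cnj \<mu> *\<^sub>C w x 1 0 = complex_of_real ((cmod \<mu>)\<^sup>2) *\<^sub>C w x 0 1"
    proof (cases "\<mu> = 0")
      case False
      with that have c: "\<mu> * cnj \<mu> = 1" by (simp add: complex_norm_square[symmetric])
      let ?d = "w x 1 0 - \<mu> *\<^sub>C w x 0 1"
      \<comment> \<open>Equality in Cauchy-Schwarz: for \<open>\<mu>\<close> of modulus 1 the unit
        vectors \<open>V1 x\<close> and \<open>\<mu> V2 x\<close> have inner product 1, hence
        coincide.\<close>
      have "cinner ?d ?d = 0"
        using c by (simp add: cinner_diff_left cinner_diff_right cinner_scaleC_left
            cinner_scaleC_right gram algebra_simps)
      then have "w x 1 0 = \<mu> *\<^sub>C w x 0 1" by (simp add: cinner_self)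
      then show ?thesis
        using complex_norm_square[of \<mu>] by (simp add: scaleC_scaleC mult.commute)
    qed simp
    have "D u = ?T u" for u
    proof (rule bounded_clinear_eq_dense[OF bounded_clinear_D T dense])
      fix v assume "v \<in> W"
      then obtain a b where v: "v = w x a b" by auto
      consider "a = 0" "b = 0" | "a = 1" "b = 0" | "a = 0" "b = 1" | "a + b \<ge> 2" by linarith
      then show "D v = ?T v"
      proof cases
        case 1
        then show ?thesis
          using gram[of 0 0 0 0] gram[of 0 0 0 1] by (simp add: v D_x)
      next
        case 2
        have "\<mu> * (complex_of_real (cmod \<mu>))\<^sup>2 = \<mu>" using that by auto
        then show ?thesis
          using gram[of 1 0 0 0] gram[of 1 0 0 1] 2
          by (simp add: v D_w_1_0 scaleC_scaleC mult.commute cvec.scale_minus_left)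
      next
        case 3
        then show ?thesis
          using gram[of 0 1 0 0] gram[of 0 1 0 1] rel
          by (simp add: v D_w_0_1 scaleC_scaleC mult.commute cvec.scale_minus_left)
      next
        case 4
        then show ?thesis
          using gram[of a b 0 0] gram[of a b 0 1] by (auto simp: v D_w)
      qed
    qed
    moreover have "?T u \<in> cvec.span {x, w x 0 1}" for u
      by (intro cvec.span_diff cvec.span_scale cvec.span_base) auto
    ultimately have "range D \<subseteq> cvec.span {x, w x 0 1}"
      by (metis image_subsetI)
    then have "3 \<le> card {x, w x 0 1}"
      using has_rank_le_card[OF assms, of "{x, w x 0 1}"] by simp
    also have "\<dots> \<le> 2" by (simp add: card_insert_if)
    finally show False by simp
  qed
  then show "0 < cmod \<mu>" "cmod \<mu> < 1" using cmod_\<mu>_le by force+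
qed

text \<open>\<open>X\<close> multiplies \<open>x\<close> by \<open>\<mu>\<close> and kills every
  other orbit vector, so \<open>X (X - \<mu>) = 0\<close>.\<close>

lemma spectrum_X: "\<mu> \<noteq> 0 \<Longrightarrow> spectrum X - {0} = {\<mu>}"
proof -
  assume "\<mu> \<noteq> 0"
  let ?p = "[:0, 1:] * [:- \<mu>, 1:]"
  note pc = poly_op_pCons[OF bounded_clinear_X] bounded_clinear_zero[OF bounded_clinear_X]
  have "poly_op ?p X u = 0" for u
  proof (rule bounded_clinear_eq_dense[OF bounded_clinear_poly_op[OF bounded_clinear_X] _ dense])
    show "bounded_clinear (\<lambda>_. 0 :: 'a)" by (simp add: bounded_clinear_def)
    fix v assume "v \<in> W"
    then obtain a b where v: "v = w x a b" by auto
    have "poly_op [:- \<mu>, 1:] X v = 0 \<or> poly_op [:0, 1:] X v = 0"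
    proof (cases a)
      case (Suc i)
      then have "X v = 0" by (simp add: v flip: V1_w)
      then show ?thesis by (simp add: pc)
    next
      case 0
      show ?thesis
      proof (cases b)
        case (Suc j)
        then have "X v = 0" by (simp add: v flip: V2_w)
        then show ?thesis by (simp add: pc)
      next
        case 0
        with \<open>a = 0\<close> show ?thesis by (simp add: v pc X_x cvec.scale_minus_left)
      qed
    qed
    then show "poly_op ?p X v = 0"
      using poly_op_dvd_zero[OF bounded_clinear_X] by (metis dvd_triv_left dvd_triv_right)
  qed
  then have "spectrum X \<subseteq> {0, \<mu>}"
    using spectrum_poly_op_zero[OF bounded_clinear_X, of ?p] by fastforce
  moreover have "\<mu> \<in> spectrum X"
    using eigenvalue_in_spectrum[of X x \<mu>] X_x norm_x by force
  ultimately show ?thesis using \<open>\<mu> \<noteq> 0\<close> by auto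
qed

text \<open>On the orbit \<open>D (D - 1) (D^2 - l^2) = 0\<close> with \<open>l = |\<mu>|\<close>,
  and among the roots 0, 1, \<open>l\<close>, \<open>- l\<close> only \<open>l\<close> lies in the
  open interval.\<close>

lemma spectrum_D:
  assumes "0 < cmod \<mu>" "cmod \<mu> < 1"
  shows "spectrum D \<inter> complex_of_real ` {0<..<1} = {complex_of_real (cmod \<mu>)}"
proof -
  define l where "l = complex_of_real (cmod \<mu>)"
  have l2: "\<mu> * cnj \<mu> = l\<^sup>2" using complex_norm_square[of \<mu>] by (simp add: l_def)
  let ?q = "[:- (l\<^sup>2), 0, 1:]"
  let ?p = "[:0, 1:] * [:- 1, 1:] * ?q"
  note pc = poly_op_pCons[OF bounded_clinear_D] bounded_clinear_zero[OF bounded_clinear_D]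
    bounded_clinear_scaleC[OF bounded_clinear_D] bounded_clinear_uminus[OF bounded_clinear_D]
  have "poly_op ?p D u = 0" for u
  proof (rule bounded_clinear_eq_dense[OF bounded_clinear_poly_op[OF bounded_clinear_D] _ dense])
    show "bounded_clinear (\<lambda>_. 0 :: 'a)" by (simp add: bounded_clinear_def)
    fix v assume "v \<in> W"
    then obtain a b where v: "v = w x a b" by auto
    consider "a = 0" "b = 0" | "a = 1" "b = 0" | "a = 0" "b = 1" | "a + b \<ge> 2" by linarith
    then have "poly_op [:0, 1:] D v = 0 \<or> poly_op [:- 1, 1:] D v = 0 \<or> poly_op ?q D v = 0"
      by cases (simp_all add: v pc D_x D_w_1_0 D_w_0_1 D_w scaleC_scaleC l2 mult.commute[of "cnj \<mu>"]
          cvec.scale_minus_left)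
    then show "poly_op ?p D v = 0"
      using poly_op_dvd_zero[OF bounded_clinear_D] by (metis dvd_triv_left dvd_triv_right dvd_mult2)
  qed
  then have "poly ?p z = 0" if "z \<in> spectrum D" for z
    using spectrum_poly_op_zero[OF bounded_clinear_D] that by blast
  moreover have "poly ?p z = z * (z - 1) * (z\<^sup>2 - l\<^sup>2)" for z
    by (simp add: algebra_simps power2_eq_square)
  ultimately have roots: "z = 0 \<or> z = 1 \<or> z\<^sup>2 = l\<^sup>2" if "z \<in> spectrum D" for z
    using that by (metis mult_eq_0_iff right_minus_eq)
  have "l \<in> spectrum D"
  proof (rule eigenvalue_in_spectrum)
    \<comment> \<open>With \<open>g\<close> the phase of \<open>\<mu>\<close>, the block of
      \<open>D\<close> exchanging \<open>V1 x\<close> and \<open>V2 x\<close> has eigenvector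
      \<open>V1 x - g V2 x\<close> for \<open>l\<close>. It is nonzero, since otherwise
      \<open>\<mu> = g\<close> would have modulus 1.\<close>
    define g where "g = \<mu> / l"
    have "l \<noteq> 0" using assms by (simp add: l_def)
    then have g: "\<mu> = g * l" "g * cnj \<mu> = l"
      by (simp_all add: g_def l2 power2_eq_square)
    have "cmod g = 1" using assms by (simp add: g_def l_def norm_divide)
    show "D (w x 1 0 - g *\<^sub>C w x 0 1) = l *\<^sub>C (w x 1 0 - g *\<^sub>C w x 0 1)"
      by (simp add: bounded_clinear_diff[OF bounded_clinear_D] pc D_w_1_0 D_w_0_1 scaleC_scaleC g(2)
          cvec.scale_right_diff_distrib cvec.scale_minus_left)
         (simp add: g(1) mult.commute)
    show "w x 1 0 - g *\<^sub>C w x 0 1 \<noteq> 0"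
    proof
      assume "w x 1 0 - g *\<^sub>C w x 0 1 = 0"
      then have "cinner (w x 1 0) (w x 0 1) = cinner (g *\<^sub>C w x 0 1) (w x 0 1)" by simp
      then have "\<mu> = g" by (simp add: gram cinner_scaleC_left)
      with \<open>cmod g = 1\<close> assms show False by simp
    qed
  qed
  moreover have "z = l" if "z \<in> spectrum D" "z = complex_of_real r" "0 < r" "r < 1" for z r
    using roots[OF that(1)] that(2-) assms
    by (auto simp: l_def power2_eq_iff simp flip: of_real_minus)
  ultimately have "spectrum D \<inter> complex_of_real ` {0<..<1} \<subseteq> {l}" and "l \<in> spectrum D"
    by auto
  moreover have "l \<in> complex_of_real ` {0<..<1}"
    using assms unfolding l_def by (intro imageI) simp
  ultimately show ?thesis
    unfolding l_def by blast
qed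

end

section \<open>The torus\<close>

text \<open>The measure \<open>torus\<close> has all pairs of complex numbers as its space; this set
  of full measure is where pointwise identities and bounds are available.\<close>

definition unit_torus :: "(complex \<times> complex) set" where
  "unit_torus = {\<zeta>. cmod (fst \<zeta>) = 1 \<and> cmod (snd \<zeta>) = 1}"

lemma unit_torus_measurable [measurable]: "unit_torus \<in> sets borel"
proof -
  have "closed unit_torus"
    unfolding unit_torus_def by (intro closed_Collect_conj closed_Collect_eq continuous_intros)
  then show ?thesis by simp
qed

lemma sets_torus [simp]: "sets torus = sets borel"
  and space_torus [simp]: "space torus = UNIV"
  by (simp_all add: torus_def)

lemma sets_torus_pair [measurable_cong]: "sets torus = sets (borel \<Otimes>\<^sub>M borel)"
  by (simp only: sets_torus borel_prod)

lemma cnj_measurable [measurable]: "cnj \<in> borel_measurable borel"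
  by (intro borel_measurable_continuous_onI continuous_intros)

lemma cis_measurable [measurable]: "cis \<in> borel_measurable borel"
  by (intro borel_measurable_continuous_onI continuous_intros)

lemma torus_param_measurable:
  "(\<lambda>(s::real, t::real). (cis (2 * pi * s), cis (2 * pi * t)))
     \<in> borel_measurable (restrict_space lborel ({0..<1} \<times> {0..<1}))"
proof (rule measurable_restrict_space1)
  have "(\<lambda>(s::real, t::real). (cis (2 * pi * s), cis (2 * pi * t))) \<in> borel_measurable borel"
    by (rule borel_measurable_continuous_onI) (auto simp: split_beta intro!: continuous_intros)
  then show "(\<lambda>(s::real, t::real). (cis (2 * pi * s), cis (2 * pi * t))) \<in> borel_measurable lborel"
    by simp
qed

lemma unit_square_sets: "{0..<1} \<times> {0..<1} \<in> sets (borel :: (real \<times> real) measure)"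
  by (simp add: borel_prod[symmetric])

lemma emeasure_torus_UNIV: "emeasure torus UNIV = 1"
proof -
  have "emeasure torus UNIV = emeasure (restrict_space lborel ({0..<1} \<times> {0..<1}))
      (space (restrict_space lborel ({0..<1::real} \<times> {0..<1::real})))"
    unfolding torus_def by (subst emeasure_distr[OF torus_param_measurable]) auto
  also have "\<dots> = emeasure lborel ({0..<1::real} \<times> {0..<1::real})"
    by (subst emeasure_restrict_space) (use unit_square_sets in \<open>auto simp: space_restrict_space\<close>)
  also have "\<dots> = emeasure lborel {0..<1::real} * emeasure lborel {0..<1::real}"
    by (simp add: lborel_prod[symmetric] lborel.emeasure_pair_measure_Times)
  finally show ?thesis by simp
qed

interpretation torus: finite_measure torus
  by standard (simp add: emeasure_torus_UNIV)

lemma measure_torus_UNIV: "measure torus UNIV = 1"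
  by (simp add: measure_def emeasure_torus_UNIV)

lemma AE_unit_torus: "AE \<zeta> in torus. \<zeta> \<in> unit_torus"
  unfolding torus_def
  by (subst AE_distr_iff[OF torus_param_measurable])
     (use unit_torus_measurable in \<open>auto simp: unit_torus_def\<close>)

lemma integral_torus:
  assumes "f \<in> borel_measurable torus"
  shows "(\<integral>\<zeta>. f \<zeta> \<partial>torus) =
    (\<integral>x. indicator ({0..<1} \<times> {0..<1}) x *\<^sub>R
        (f (cis (2 * pi * fst x), cis (2 * pi * snd x)) :: complex) \<partial>lborel)"
proof -
  have "(\<integral>\<zeta>. f \<zeta> \<partial>torus) = (\<integral>x. f ((\<lambda>(s, t). (cis (2 * pi * s), cis (2 * pi * t))) x)
      \<partial>restrict_space lborel ({0..<1} \<times> {0..<1}))"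
    unfolding torus_def by (rule integral_distr[OF torus_param_measurable])
       (use assms in \<open>simp add: measurable_cong_sets[OF sets_torus refl]\<close>)
  also have "\<dots> = (\<integral>x. indicator ({0..<1} \<times> {0..<1}) x *\<^sub>R
      f ((\<lambda>(s, t). (cis (2 * pi * s), cis (2 * pi * t))) x) \<partial>lborel)"
    by (rule integral_restrict_space) (use unit_square_sets in simp)
  finally show ?thesis by (simp add: split_beta)
qed

section \<open>Fourier monomials with integer exponents\<close>

definition tmono :: "int \<Rightarrow> int \<Rightarrow> tfun" where
  "tmono k l \<zeta> = fst \<zeta> powi k * snd \<zeta> powi l"

lemma powi_measurable [measurable]:
  "f \<in> borel_measurable M \<Longrightarrow> (\<lambda>x. (f x :: complex) powi k) \<in> borel_measurable M"
  by (cases "k \<ge> 0") (simp_all add: power_int_def)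

lemma tmono_measurable [measurable]: "tmono k l \<in> borel_measurable torus"
  unfolding tmono_def[abs_def] by measurable

lemma unit_torusD: "\<zeta> \<in> unit_torus \<Longrightarrow> cmod (fst \<zeta>) = 1" "\<zeta> \<in> unit_torus \<Longrightarrow> cmod (snd \<zeta>) = 1"
  "\<zeta> \<in> unit_torus \<Longrightarrow> fst \<zeta> \<noteq> 0" "\<zeta> \<in> unit_torus \<Longrightarrow> snd \<zeta> \<noteq> 0"
  by (auto simp: unit_torus_def)

lemma cnj_unit: "cmod z = 1 \<Longrightarrow> cnj z = inverse z"
  by (metis complex_mod_cnj complex_norm_square inverse_unique mult.commute of_real_1 power_one)

lemma cmod_tmono: "\<zeta> \<in> unit_torus \<Longrightarrow> cmod (tmono k l \<zeta>) = 1"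
  by (simp add: tmono_def norm_mult norm_power_int unit_torusD)

lemma tmono_mult: "\<zeta> \<in> unit_torus \<Longrightarrow> tmono k l \<zeta> * tmono k' l' \<zeta> = tmono (k + k') (l + l') \<zeta>"
  by (simp add: tmono_def power_int_add unit_torusD)

lemma cnj_tmono: "\<zeta> \<in> unit_torus \<Longrightarrow> cnj (tmono k l \<zeta>) = tmono (- k) (- l) \<zeta>"
  by (simp add: cnj_unit cmod_tmono) (simp add: tmono_def power_int_minus)

lemma integral_cis_powi:
  "(\<integral>s. indicator {0..<1} s *\<^sub>R (cis (2 * pi * s) powi k) \<partial>lborel) = (if k = 0 then 1 else 0)"
proof -
  \<comment> \<open>The measure is built on the half-open interval, the fundamental theorem of
    calculus needs the closed one; they differ by a null set.\<close>
  have AE: "AE s::real in lborel. (indicator {0..<1} s :: real) = indicator {0..1} s"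
    using AE_lborel_singleton[of "1::real"] by eventually_elim (auto simp: indicator_def)
  have eq: "(\<integral>s. indicator {0..<1} s *\<^sub>R (cis (2 * pi * s) powi k) \<partial>lborel)
      = (\<integral>s. indicator {0..1} s *\<^sub>R (cis (2 * pi * s) powi k) \<partial>lborel)"
    by (rule integral_cong_AE) (use AE in \<open>auto elim!: eventually_mono\<close>)
  show ?thesis
  proof (cases "k = 0")
    case True
    then show ?thesis unfolding eq by simp
  next
    case False
    define c where "c = 2 * pi * real_of_int k"
    have "c \<noteq> 0" using False by (simp add: c_def)
    have pow: "cis (2 * pi * s) powi k = cis (c * s)" for s
      by (simp add: cis_power_int c_def mult_ac)
    have der: "((\<lambda>s. cis (c * s) / (\<i> * of_real c)) has_vector_derivative cis (c * s)) (at s within S)" for s S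
    proof -
      have "((\<lambda>s. exp (\<i> * of_real (c * s)) / (\<i> * of_real c)) has_vector_derivative exp (\<i> * of_real (c * s)))
          (at s within S)"
        using \<open>c \<noteq> 0\<close>
        by (auto intro!: derivative_eq_intros has_vector_derivative_real_field
            simp: field_simps of_real_mult)
      then show ?thesis by (simp add: cis_conv_exp)
    qed
    have "(\<integral>s. indicator {0..1} s *\<^sub>R cis (c * s) \<partial>lborel)
        = cis (c * 1) / (\<i> * of_real c) - cis (c * 0) / (\<i> * of_real c)"
      by (rule integral_FTC_atLeastAtMost) (auto intro!: der continuous_intros)
    also have "cis (c * 1) = 1"
      unfolding c_def by (metis cis_multiple_2pi mult.right_neutral Ints_of_int mult.commute)
    finally show ?thesis unfolding eq unfolding pow using False by simp
  qed
qed

lemma integral_tmono: "(\<integral>\<zeta>. tmono k l \<zeta> \<partial>torus) = (if k = 0 \<and> l = 0 then 1 else 0)"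
proof -
  define g where "g k s = indicator {0..<1} s *\<^sub>R (cis (2 * pi * s) powi k)" for k :: int and s :: real
  have [measurable]: "g k \<in> borel_measurable borel" for k
    unfolding g_def[abs_def] by measurable
  have "(\<integral>\<zeta>. tmono k l \<zeta> \<partial>torus) = (\<integral>x. g k (fst x) * g l (snd x) \<partial>(lborel \<Otimes>\<^sub>M lborel))"
    unfolding integral_torus[OF tmono_measurable] lborel_prod
    by (intro Bochner_Integration.integral_cong refl)
       (auto simp: g_def tmono_def indicator_def split_beta)
  also have "\<dots> = (\<integral>s. (\<integral>t. g k s * g l t \<partial>lborel) \<partial>lborel)"
  proof -
    have "integrable (lborel \<Otimes>\<^sub>M lborel) (\<lambda>x. g k (fst x) * g l (snd x))"
    proof (rule integrableI_bounded_set[where A = "{0..<1} \<times> {0..<1}" and B = 1])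
      show "(\<lambda>x. g k (fst x) * g l (snd x)) \<in> borel_measurable (lborel \<Otimes>\<^sub>M lborel)"
        by measurable
      show "emeasure (lborel \<Otimes>\<^sub>M lborel) ({0..<1::real} \<times> {0..<1::real}) < \<infinity>"
        by (simp add: lborel.emeasure_pair_measure_Times)
    qed (auto simp: g_def indicator_def norm_mult norm_power_int intro!: AE_I2)
    from lborel_pair.integral_fst'[OF this] show ?thesis by simp
  qed
  also have "\<dots> = (\<integral>s. g k s \<partial>lborel) * (\<integral>t. g l t \<partial>lborel)"
    by simp
  finally show ?thesis
    unfolding g_def integral_cis_powi by simp
qed

lemma integrable_torus_bounded:
  assumes "f \<in> borel_measurable torus" and "\<And>\<zeta>. \<zeta> \<in> unit_torus \<Longrightarrow> norm (f \<zeta>) \<le> K"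
  shows "integrable torus (f :: _ \<Rightarrow> 'b::{banach, second_countable_topology})"
  using assms by (intro torus.integrable_const_bound[where B = K] eventually_mono[OF AE_unit_torus]) auto

lemma integral_tmono_cnj:
  "(\<integral>\<zeta>. tmono k l \<zeta> * cnj (tmono k' l' \<zeta>) \<partial>torus) = (if k = k' \<and> l = l' then 1 else 0)"
proof -
  have "(\<integral>\<zeta>. tmono k l \<zeta> * cnj (tmono k' l' \<zeta>) \<partial>torus) = (\<integral>\<zeta>. tmono (k - k') (l - l') \<zeta> \<partial>torus)"
    by (intro integral_cong_AE eventually_mono[OF AE_unit_torus])
       (auto simp: cnj_tmono tmono_mult)
  then show ?thesis by (simp add: integral_tmono)
qed

text \<open>The sum below is a Fejer kernel: its square has mean \<open>N\<close>, while it is at least \<open>N\<^sup>2 / 4\<close>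
  where \<open>(z w)\<^sup>n\<close> is within \<open>1 / N\<close> of 1.\<close>

lemma measure_near_one:
  assumes "n > 0" and "N > 0"
  shows "measure torus {\<zeta>. cmod (1 - (fst \<zeta> * snd \<zeta>) ^ n) < 1 / real N} \<le> 4 / real N"
proof -
  define u where "u \<zeta> = (fst \<zeta> * snd \<zeta>) ^ n" for \<zeta> :: "complex \<times> complex"
  define S where "S \<zeta> = (\<Sum>k<N. tmono (int (n * k)) (int (n * k)) \<zeta>)" for \<zeta>
  have [measurable]: "S \<in> borel_measurable torus"
    unfolding S_def[abs_def] by measurable
  have Su: "S \<zeta> = (\<Sum>k<N. u \<zeta> ^ k)" for \<zeta>
    by (simp add: S_def u_def tmono_def power_int_def power_mult_distrib flip: power_mult)
       (metis (no_types, lifting) nat_int of_nat_mult)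
  have "complex_of_real (\<integral>\<zeta>. (cmod (S \<zeta>))\<^sup>2 \<partial>torus) = (\<integral>\<zeta>. S \<zeta> * cnj (S \<zeta>) \<partial>torus)"
    by (simp flip: integral_complex_of_real complex_norm_square)
  also have "\<dots> = (\<integral>\<zeta>. (\<Sum>k<N. \<Sum>j<N. tmono (int (n * k)) (int (n * k)) \<zeta>
      * cnj (tmono (int (n * j)) (int (n * j)) \<zeta>)) \<partial>torus)"
    by (simp add: S_def sum_product)
  also have "\<dots> = (\<Sum>k<N. \<Sum>j<N. (\<integral>\<zeta>. tmono (int (n * k)) (int (n * k)) \<zeta>
      * cnj (tmono (int (n * j)) (int (n * j)) \<zeta>) \<partial>torus))"
  proof -
    have int: "integrable torus (\<lambda>\<zeta>. tmono k l \<zeta> * cnj (tmono k' l' \<zeta>))" for k l k' l'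
    proof (rule integrable_torus_bounded[where K = 1])
      show "(\<lambda>\<zeta>. tmono k l \<zeta> * cnj (tmono k' l' \<zeta>)) \<in> borel_measurable torus" by measurable
    qed (simp add: norm_mult cmod_tmono)
    show ?thesis
      by (subst Bochner_Integration.integral_sum) (intro int Bochner_Integration.integrable_sum,
          intro sum.cong refl Bochner_Integration.integral_sum int)
  qed
  also have "\<dots> = (\<Sum>k<N. \<Sum>j<N. if k = j then 1 else 0)"
    unfolding integral_tmono_cnj using \<open>n > 0\<close> by simp
  also have "\<dots> = complex_of_real (real N)"
    by simp
  finally have int: "(\<integral>\<zeta>. (cmod (S \<zeta>))\<^sup>2 \<partial>torus) = real N"
    by (simp only: of_real_eq_iff)
  have bound: "(real N)\<^sup>2 / 4 \<le> (cmod (S \<zeta>))\<^sup>2"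
    if "\<zeta> \<in> unit_torus" and close: "cmod (1 - u \<zeta>) < 1 / real N" for \<zeta>
  proof -
    have u1: "cmod (u \<zeta>) = 1"
      using that(1) by (simp add: u_def norm_power norm_mult unit_torusD)
    \<comment> \<open>The linear growth \<open>|1 - u^k| <= k |1 - u|\<close> shows that the
      \<open>N\<close> powers in \<open>S\<close> differ from 1 by less than \<open>N / 2\<close> in
      total, so they cannot cancel.\<close>
    have pow: "cmod (1 - u \<zeta> ^ k) \<le> real k * (1 / real N)" for k
    proof (induction k)
      case (Suc k)
      have "1 - u \<zeta> ^ Suc k = (1 - u \<zeta> ^ k) + u \<zeta> ^ k * (1 - u \<zeta>)" by (simp add: algebra_simps)
      then have "cmod (1 - u \<zeta> ^ Suc k) \<le> cmod (1 - u \<zeta> ^ k) + cmod (1 - u \<zeta>)"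
        by (metis norm_triangle_ineq norm_mult norm_power u1 power_one mult_1)
      with Suc close show ?case by (simp add: add_divide_distrib)
    qed simp
    have "cmod (of_nat N - S \<zeta>) = cmod (\<Sum>k<N. 1 - u \<zeta> ^ k)"
      by (simp add: Su sum_subtractf)
    also have "\<dots> \<le> (\<Sum>k<N. real k * (1 / real N))"
      by (intro sum_norm_le pow)
    also have "\<dots> = (\<Sum>k<N. real k) / real N"
      by (simp add: sum_divide_distrib)
    also have "(\<Sum>k<N. real k) = real N * (real N - 1) / 2"
      by (induction N) (simp_all add: field_simps)
    also have "real N * (real N - 1) / 2 / real N = (real N - 1) / 2"
      using \<open>N > 0\<close> by simp
    finally have "cmod (of_nat N - S \<zeta>) \<le> real N / 2"
      by simp
    moreover have "cmod (of_nat N) \<le> cmod (S \<zeta>) + cmod (of_nat N - S \<zeta>)"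
      by (metis add.commute diff_add_cancel norm_triangle_ineq)
    ultimately have "real N / 2 \<le> cmod (S \<zeta>)" by simp
    then have "(real N / 2)\<^sup>2 \<le> (cmod (S \<zeta>))\<^sup>2"
      by (intro power_mono) auto
    then show ?thesis by (simp add: power_divide)
  qed
  have S_le: "cmod (S \<zeta>) \<le> real N" if "\<zeta> \<in> unit_torus" for \<zeta>
    unfolding S_def using that sum_norm_le[of "{..<N}" "\<lambda>k. tmono (int (n * k)) (int (n * k)) \<zeta>" "\<lambda>_. 1"]
    by (simp add: cmod_tmono)
  have integ: "integrable torus (\<lambda>\<zeta>. (cmod (S \<zeta>))\<^sup>2)"
    by (rule integrable_torus_bounded[where K = "(real N)\<^sup>2"]) (auto intro!: power_mono S_le)
  have "measure torus {\<zeta>. cmod (1 - u \<zeta>) < 1 / real N}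
      = measure torus {\<zeta>. \<zeta> \<in> unit_torus \<and> cmod (1 - u \<zeta>) < 1 / real N}"
  proof (intro measure_eq_AE eventually_mono[OF AE_unit_torus])
    have [measurable]: "u \<in> borel_measurable torus" unfolding u_def[abs_def] by measurable
    have [measurable]: "unit_torus \<in> sets torus" by simp
    have "{\<zeta> \<in> space torus. cmod (1 - u \<zeta>) < 1 / real N} \<in> sets torus"
      "{\<zeta> \<in> space torus. \<zeta> \<in> unit_torus \<and> cmod (1 - u \<zeta>) < 1 / real N} \<in> sets torus"
      by measurable
    then show "{\<zeta>. cmod (1 - u \<zeta>) < 1 / real N} \<in> sets torus"
      "{\<zeta>. \<zeta> \<in> unit_torus \<and> cmod (1 - u \<zeta>) < 1 / real N} \<in> sets torus"
      by (simp_all only: space_torus UNIV_I simp_thms)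
  qed auto
  also have "\<dots> \<le> measure torus {\<zeta> \<in> space torus. (real N)\<^sup>2 / 4 \<le> (cmod (S \<zeta>))\<^sup>2}"
  proof (rule torus.finite_measure_mono)
    show "{\<zeta> \<in> space torus. (real N)\<^sup>2 / 4 \<le> (cmod (S \<zeta>))\<^sup>2} \<in> sets torus"
      by measurable
  qed (use bound in auto)
  also have "\<dots> \<le> (\<integral>\<zeta>. (cmod (S \<zeta>))\<^sup>2 \<partial>torus) / ((real N)\<^sup>2 / 4)"
    using integral_Markov_inequality_measure[OF integ, of "{}" "(real N)\<^sup>2 / 4"] \<open>N > 0\<close> by simp
  also have "\<dots> = 4 / real N"
    unfolding int using \<open>N > 0\<close> by (simp add: power2_eq_square)
  finally show ?thesis by (simp add: u_def)
qed

text \<open>Borel-Cantelli, with \<open>N = (n + 1)^2\<close> in \<open>measure_near_one\<close>: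
  the exceptional sets have measure at most \<open>4 / (n + 1)^2\<close>, which is summable.\<close>

lemma AE_powers_away_from_one:
  "AE \<zeta> in torus. eventually (\<lambda>n. 1 / real ((Suc n)\<^sup>2) \<le> cmod (1 - (fst \<zeta> * snd \<zeta>) ^ n)) sequentially"
proof -
  \<comment> \<open>Index 0 is left out, because the 0-th power equals 1 everywhere.\<close>
  define E where "E n = (if n = 0 then {} else
      {\<zeta> :: complex \<times> complex. cmod (1 - (fst \<zeta> * snd \<zeta>) ^ n) < 1 / real ((Suc n)\<^sup>2)})" for n
  have "AE \<zeta> in torus. eventually (\<lambda>n. \<zeta> \<in> space torus - E n) sequentially"
  proof (rule borel_cantelli_AE1)
    show "E n \<in> sets torus" for n
    proof -
      have "{\<zeta> \<in> space torus. cmod (1 - (fst \<zeta> * snd \<zeta>) ^ n) < 1 / real ((Suc n)\<^sup>2)} \<in> sets torus"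
        by measurable
      then show ?thesis
        unfolding E_def by (simp only: space_torus UNIV_I simp_thms) auto
    qed
    show "emeasure torus (E n) < \<infinity>" for n
      by (simp add: torus.emeasure_eq_measure)
    show "summable (\<lambda>n. measure torus (E n))"
    proof (rule summable_comparison_test')
      show "summable (\<lambda>n. 4 * inverse (real (Suc n) ^ 2))"
        using inverse_power_summable[of 2, where 'a = real]
        by (intro summable_mult) (subst summable_Suc_iff, simp)
      show "norm (measure torus (E n)) \<le> 4 * inverse (real (Suc n) ^ 2)" for n
        using measure_near_one[of n "(Suc n)\<^sup>2"] by (auto simp: E_def divide_inverse)
    qed
  qed
  then show ?thesis
  proof eventually_elim
    case (elim \<zeta>)
    from elim eventually_gt_at_top[of 0] show ?case
      by eventually_elim (auto simp: E_def)
  qed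
qed

section \<open>Square integrable functions on the torus\<close>

text \<open>Elements are functions rather than classes, so on \<open>L2\<close> this is a seminorm
  that vanishes exactly on the functions that are 0 almost everywhere.\<close>

definition L2_norm :: "tfun \<Rightarrow> real" where
  "L2_norm f = sqrt (\<integral>\<zeta>. (cmod (f \<zeta>))\<^sup>2 \<partial>torus)"

definition L2_inner :: "tfun \<Rightarrow> tfun \<Rightarrow> complex" where
  "L2_inner f g = (\<integral>\<zeta>. f \<zeta> * cnj (g \<zeta>) \<partial>torus)"

lemma L2_dist_eq: "L2_dist f g = L2_norm (\<lambda>\<zeta>. f \<zeta> - g \<zeta>)"
  by (simp add: L2_dist_def L2_norm_def)

lemma L2_norm_nonneg [simp]: "0 \<le> L2_norm f"
  by (simp add: L2_norm_def)

lemma L2_norm_square: "(L2_norm f)\<^sup>2 = (\<integral>\<zeta>. (cmod (f \<zeta>))\<^sup>2 \<partial>torus)"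
  by (simp add: L2_norm_def)

lemma L2_measurable: "f \<in> L2 \<Longrightarrow> f \<in> borel_measurable torus"
  and L2_integrable: "f \<in> L2 \<Longrightarrow> integrable torus (\<lambda>\<zeta>. (cmod (f \<zeta>))\<^sup>2)"
  by (simp_all add: L2_def)

lemma L2_AE_bounded:
  assumes "f \<in> borel_measurable torus" and "AE \<zeta> in torus. cmod (f \<zeta>) \<le> K"
  shows "f \<in> L2"
  unfolding L2_def using assms
  by (auto intro!: torus.integrable_const_bound[where B = "K\<^sup>2"] power_mono elim!: eventually_mono)

lemma L2_bounded:
  assumes "f \<in> borel_measurable torus" and "\<And>\<zeta>. \<zeta> \<in> unit_torus \<Longrightarrow> cmod (f \<zeta>) \<le> K"
  shows "f \<in> L2"
  using assms by (intro L2_AE_bounded[where K = K] eventually_mono[OF AE_unit_torus])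

lemma L2_mult:
  assumes f: "f \<in> L2" and b: "b \<in> borel_measurable torus" "AE \<zeta> in torus. cmod (b \<zeta>) \<le> K"
  shows "(\<lambda>\<zeta>. b \<zeta> * f \<zeta>) \<in> L2"
  unfolding L2_def mem_Collect_eq
proof
  note [measurable] = L2_measurable[OF f] b(1)
  show "(\<lambda>\<zeta>. b \<zeta> * f \<zeta>) \<in> borel_measurable torus" by measurable
  show "integrable torus (\<lambda>\<zeta>. (cmod (b \<zeta> * f \<zeta>))\<^sup>2)"
  proof (rule Bochner_Integration.integrable_bound)
    show "integrable torus (\<lambda>\<zeta>. K\<^sup>2 * (cmod (f \<zeta>))\<^sup>2)"
      by (intro integrable_mult_right L2_integrable f)
    show "AE \<zeta> in torus. norm ((cmod (b \<zeta> * f \<zeta>))\<^sup>2) \<le> norm (K\<^sup>2 * (cmod (f \<zeta>))\<^sup>2)"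
      using b(2) by eventually_elim (auto simp: norm_mult power_mult_distrib intro!: mult_right_mono power_mono)
  qed measurable
qed

lemma L2_add:
  assumes f: "f \<in> L2" and g: "g \<in> L2"
  shows "(\<lambda>\<zeta>. f \<zeta> + g \<zeta>) \<in> L2"
  unfolding L2_def mem_Collect_eq
proof
  note [measurable] = L2_measurable[OF f] L2_measurable[OF g]
  show "(\<lambda>\<zeta>. f \<zeta> + g \<zeta>) \<in> borel_measurable torus" by measurable
  have le: "(cmod (f \<zeta> + g \<zeta>))\<^sup>2 \<le> 2 * (cmod (f \<zeta>))\<^sup>2 + 2 * (cmod (g \<zeta>))\<^sup>2" for \<zeta>
  proof -
    have "(cmod (f \<zeta> + g \<zeta>))\<^sup>2 \<le> (cmod (f \<zeta>) + cmod (g \<zeta>))\<^sup>2"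
      by (intro power_mono norm_triangle_ineq) auto
    moreover have "0 \<le> (cmod (f \<zeta>) - cmod (g \<zeta>))\<^sup>2" by simp
    ultimately show ?thesis by (simp add: power2_eq_square algebra_simps)
  qed
  show "integrable torus (\<lambda>\<zeta>. (cmod (f \<zeta> + g \<zeta>))\<^sup>2)"
  proof (rule Bochner_Integration.integrable_bound)
    show "integrable torus (\<lambda>\<zeta>. 2 * (cmod (f \<zeta>))\<^sup>2 + 2 * (cmod (g \<zeta>))\<^sup>2)"
      by (intro Bochner_Integration.integrable_add integrable_mult_right L2_integrable f g)
  qed (use le in \<open>auto intro!: AE_I2\<close>)
qed

lemma L2_scale: "f \<in> L2 \<Longrightarrow> (\<lambda>\<zeta>. c * f \<zeta>) \<in> L2"
  by (rule L2_mult[where K = "cmod c"]) auto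

lemma L2_diff: "f \<in> L2 \<Longrightarrow> g \<in> L2 \<Longrightarrow> (\<lambda>\<zeta>. f \<zeta> - g \<zeta>) \<in> L2"
  using L2_add[of f "\<lambda>\<zeta>. - 1 * g \<zeta>"] L2_scale[of g "- 1"] by simp

lemma L2_norm_cong_AE:
  assumes "f \<in> borel_measurable torus" "g \<in> borel_measurable torus" "AE \<zeta> in torus. cmod (f \<zeta>) = cmod (g \<zeta>)"
  shows "L2_norm f = L2_norm g"
  unfolding L2_norm_def using assms
  by (intro arg_cong[where f = sqrt] integral_cong_AE) (auto elim!: eventually_mono)

lemma L2_norm_scale: "L2_norm (\<lambda>\<zeta>. c * f \<zeta>) = cmod c * L2_norm f"
  by (simp add: L2_norm_def norm_mult power_mult_distrib real_sqrt_mult)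

lemma L2_norm_minus_commute: "L2_norm (\<lambda>\<zeta>. f \<zeta> - g \<zeta>) = L2_norm (\<lambda>\<zeta>. g \<zeta> - f \<zeta>)"
  by (simp add: L2_norm_def norm_minus_commute)

lemma L2_norm_eq_0_iff:
  assumes "f \<in> L2"
  shows "L2_norm f = 0 \<longleftrightarrow> (AE \<zeta> in torus. f \<zeta> = 0)"
  unfolding L2_norm_def using integral_nonneg_eq_0_iff_AE[OF L2_integrable[OF assms]] by simp

text \<open>Minkowski's inequality comes from
  \<open>|u + v|^2 <= (1 + t) |u|^2 + (1 + 1 / t) |v|^2\<close>, integrated and then optimised over
  \<open>t\<close>.\<close>

lemma L2_norm_add_le:
  assumes f: "f \<in> L2" and g: "g \<in> L2"
  shows "L2_norm (\<lambda>\<zeta>. f \<zeta> + g \<zeta>) \<le> L2_norm f + L2_norm g"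
proof -
  define a b where "a = L2_norm f" and "b = L2_norm g"
  have ab: "0 \<le> a" "0 \<le> b" by (simp_all add: a_def b_def)
  have weighted: "(L2_norm (\<lambda>\<zeta>. f \<zeta> + g \<zeta>))\<^sup>2 \<le> (1 + t) * a\<^sup>2 + (1 + 1 / t) * b\<^sup>2" if "t > 0" for t
  proof -
    have le: "(cmod (f \<zeta> + g \<zeta>))\<^sup>2 \<le> (1 + t) * (cmod (f \<zeta>))\<^sup>2 + (1 + 1 / t) * (cmod (g \<zeta>))\<^sup>2" for \<zeta>
    proof -
      have "(cmod (f \<zeta> + g \<zeta>))\<^sup>2 \<le> (cmod (f \<zeta>) + cmod (g \<zeta>))\<^sup>2"
        by (intro power_mono norm_triangle_ineq) auto
      also have "\<dots> = (1 + t) * (cmod (f \<zeta>))\<^sup>2 + (1 + 1 / t) * (cmod (g \<zeta>))\<^sup>2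
          - (t * cmod (f \<zeta>) - cmod (g \<zeta>))\<^sup>2 / t"
        using that by (simp add: power2_eq_square field_simps)
      also have "\<dots> \<le> (1 + t) * (cmod (f \<zeta>))\<^sup>2 + (1 + 1 / t) * (cmod (g \<zeta>))\<^sup>2"
        using that by simp
      finally show ?thesis .
    qed
    have "(L2_norm (\<lambda>\<zeta>. f \<zeta> + g \<zeta>))\<^sup>2
        \<le> (\<integral>\<zeta>. (1 + t) * (cmod (f \<zeta>))\<^sup>2 + (1 + 1 / t) * (cmod (g \<zeta>))\<^sup>2 \<partial>torus)"
      unfolding L2_norm_square
      by (intro integral_mono le Bochner_Integration.integrable_add integrable_mult_right
          L2_integrable f g L2_add)
    also have "\<dots> = (1 + t) * a\<^sup>2 + (1 + 1 / t) * b\<^sup>2"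
      using L2_integrable[OF f] L2_integrable[OF g] by (simp add: a_def b_def L2_norm_square)
    finally show ?thesis .
  qed
  have "(L2_norm (\<lambda>\<zeta>. f \<zeta> + g \<zeta>))\<^sup>2 \<le> (a + b)\<^sup>2"
  proof (rule field_le_epsilon)
    fix e :: real assume "e > 0"
    \<comment> \<open>The optimal weight is \<open>t = b / a\<close>. Adding \<open>d\<close> to
      both norms keeps it defined and positive when one of them is 0, and this \<open>d\<close>
      makes the loss \<open>2 d (a + b)\<close> at most \<open>e\<close>.\<close>
    define d where "d = e / (2 * (a + b + 1))"
    have "d > 0" using \<open>e > 0\<close> ab by (simp add: d_def)
    define t where "t = (b + d) / (a + d)"
    have "t > 0" using \<open>d > 0\<close> ab by (simp add: t_def)
    have "(1 + t) * a\<^sup>2 = (a + b + 2 * d) * a * (a / (a + d))"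
      using ab \<open>d > 0\<close> by (simp add: t_def field_simps power2_eq_square)
    also have "\<dots> \<le> (a + b + 2 * d) * a * 1"
      using ab \<open>d > 0\<close> by (intro mult_left_mono) auto
    finally have 1: "(1 + t) * a\<^sup>2 \<le> (a + b + 2 * d) * a" by simp
    have "(1 + 1 / t) * b\<^sup>2 = (a + b + 2 * d) * b * (b / (b + d))"
      using ab \<open>d > 0\<close> by (simp add: t_def field_simps power2_eq_square)
    also have "\<dots> \<le> (a + b + 2 * d) * b * 1"
      using ab \<open>d > 0\<close> by (intro mult_left_mono) auto
    finally have 2: "(1 + 1 / t) * b\<^sup>2 \<le> (a + b + 2 * d) * b" by simp
    have "2 * d * (a + b) \<le> 2 * d * (a + b + 1)"
      using \<open>d > 0\<close> by simp
    also have "\<dots> = e"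
    proof -
      define c where "c = a + b + 1"
      have "c > 0" using ab by (simp add: c_def)
      then show ?thesis by (simp add: d_def flip: c_def)
    qed
    finally have 3: "2 * d * (a + b) \<le> e" .
    have "(L2_norm (\<lambda>\<zeta>. f \<zeta> + g \<zeta>))\<^sup>2 \<le> (a + b + 2 * d) * a + (a + b + 2 * d) * b"
      using weighted[OF \<open>t > 0\<close>] 1 2 by linarith
    also have "\<dots> = (a + b)\<^sup>2 + 2 * d * (a + b)"
      by (simp add: power2_eq_square algebra_simps)
    finally show "(L2_norm (\<lambda>\<zeta>. f \<zeta> + g \<zeta>))\<^sup>2 \<le> (a + b)\<^sup>2 + e"
      using 3 by linarith
  qed
  then show ?thesis
    unfolding a_def b_def by (rule power2_le_imp_le) simp
qed

lemma L2_norm_diff_triangle: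
  assumes "f \<in> L2" "g \<in> L2" "h \<in> L2"
  shows "L2_norm (\<lambda>\<zeta>. f \<zeta> - h \<zeta>) \<le> L2_norm (\<lambda>\<zeta>. f \<zeta> - g \<zeta>) + L2_norm (\<lambda>\<zeta>. g \<zeta> - h \<zeta>)"
  using L2_norm_add_le[OF L2_diff[OF assms(1,2)] L2_diff[OF assms(2,3)]] by simp

text \<open>Riesz-Fischer: a fast subsequence converges almost everywhere, and Fatou's lemma
  upgrades its pointwise limit to a norm limit of the whole sequence.\<close>

theorem L2_complete:
  assumes f: "\<And>n. f n \<in> L2"
    and Cauchy: "\<And>e. e > 0 \<Longrightarrow> \<exists>N. \<forall>m\<ge>N. \<forall>n\<ge>N. L2_norm (\<lambda>\<zeta>. f m \<zeta> - f n \<zeta>) < e"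
  obtains g where "g \<in> L2" "(\<lambda>n. L2_norm (\<lambda>\<zeta>. f n \<zeta> - g \<zeta>)) \<longlonglongrightarrow> 0"
proof -
  note [measurable] = L2_measurable[OF f]
  have "\<exists>N. \<forall>m\<ge>N. \<forall>n\<ge>N. L2_norm (\<lambda>\<zeta>. f m \<zeta> - f n \<zeta>) < (1/2) ^ k" for k
    by (rule Cauchy) simp
  then obtain N where N: "\<And>k m n. N k \<le> m \<Longrightarrow> N k \<le> n \<Longrightarrow> L2_norm (\<lambda>\<zeta>. f m \<zeta> - f n \<zeta>) < (1/2) ^ k"
    by metis
  \<comment> \<open>Summing makes the indices monotone, so \<open>r j\<close> is at least
    \<open>N k\<close> for every \<open>j >= k\<close>.\<close>
  define r where "r k = (\<Sum>i\<le>k. N i)" for k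
  have r: "N k \<le> r k" "N k \<le> r (Suc k)" for k
    by (auto simp: r_def intro: order_trans[OF member_le_sum[of k "{..k}"]])
  define d where "d k \<zeta> = f (r (Suc k)) \<zeta> - f (r k) \<zeta>" for k \<zeta>
  have d: "L2_norm (d k) < (1/2) ^ k" for k
    unfolding d_def[abs_def] by (rule N) (rule r)+
  have dL2: "d k \<in> L2" for k
    unfolding d_def[abs_def] by (intro L2_diff f)
  have [measurable]: "d k \<in> borel_measurable torus" for k
    by (rule L2_measurable[OF dL2])
  \<comment> \<open>Since the square of \<open>L2_norm (d k)\<close> is below
    \<open>(1/4)^k\<close>, the weight \<open>2 ^ k\<close> still leaves a convergent sum, and it is
    what yields absolute convergence of the \<open>d k\<close> pointwise.\<close>
  have "(\<integral>\<^sup>+\<zeta>. (\<Sum>k. ennreal (2 ^ k * (cmod (d k \<zeta>))\<^sup>2)) \<partial>torus)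
      = (\<Sum>k. \<integral>\<^sup>+\<zeta>. ennreal (2 ^ k * (cmod (d k \<zeta>))\<^sup>2) \<partial>torus)"
    by (rule nn_integral_suminf) measurable
  also have "\<dots> \<le> (\<Sum>k. ennreal ((1/2) ^ k))"
  proof (rule suminf_le)
    fix k
    have "(\<integral>\<^sup>+\<zeta>. ennreal (2 ^ k * (cmod (d k \<zeta>))\<^sup>2) \<partial>torus)
        = ennreal (\<integral>\<zeta>. 2 ^ k * (cmod (d k \<zeta>))\<^sup>2 \<partial>torus)"
      by (intro nn_integral_eq_integral integrable_mult_right L2_integrable dL2) auto
    also have "(\<integral>\<zeta>. 2 ^ k * (cmod (d k \<zeta>))\<^sup>2 \<partial>torus) = 2 ^ k * (L2_norm (d k))\<^sup>2"
      by (simp add: L2_norm_square)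
    also have "ennreal \<dots> \<le> ennreal (2 ^ k * ((1/2) ^ k)\<^sup>2)"
      by (intro ennreal_leI mult_left_mono power_mono less_imp_le[OF d]) auto
    also have "2 ^ k * ((1/2) ^ k)\<^sup>2 = (1/2 :: real) ^ k"
      by (simp add: power2_eq_square field_simps flip: power_mult_distrib)
    finally show "(\<integral>\<^sup>+\<zeta>. ennreal (2 ^ k * (cmod (d k \<zeta>))\<^sup>2) \<partial>torus) \<le> ennreal ((1/2) ^ k)" .
  qed auto
  also have "\<dots> = ennreal (\<Sum>k. (1/2) ^ k)"
    by (intro suminf_ennreal2) (auto intro!: summable_geometric)
  also have "\<dots> < \<infinity>" by simp
  finally have "AE \<zeta> in torus. (\<Sum>k. ennreal (2 ^ k * (cmod (d k \<zeta>))\<^sup>2)) \<noteq> \<infinity>"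
    by (intro nn_integral_noteq_infinite) auto
  then have conv: "AE \<zeta> in torus. convergent (\<lambda>k. f (r k) \<zeta>)"
  proof eventually_elim
    case (elim \<zeta>)
    have summable: "summable (\<lambda>k. 2 ^ k * (cmod (d k \<zeta>))\<^sup>2)"
      by (rule summable_suminf_not_top) (use elim in auto)
    have "summable (\<lambda>k. d k \<zeta>)"
    proof (rule summable_comparison_test')
      show "summable (\<lambda>k. (1/2) ^ k + 2 ^ k * (cmod (d k \<zeta>))\<^sup>2)"
        by (intro summable_add summable summable_geometric) simp
      fix k
      define x y where "x = cmod (d k \<zeta>)" and "y = (2::real) ^ k"
      have "y > 0" by (simp add: y_def)
      \<comment> \<open>This is \<open>2 x <= 1 / y + y x^2\<close>, which bounds
        \<open>|d k|\<close> by a geometric term plus a summable one.\<close>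
      have "0 \<le> (1 - y * x)\<^sup>2 / y" "0 \<le> x * y" using \<open>y > 0\<close> by (auto simp: x_def)
      then have "x \<le> 1 / y + y * x\<^sup>2"
        using \<open>y > 0\<close> by (simp add: power2_eq_square field_simps)
      then show "norm (d k \<zeta>) \<le> (1/2) ^ k + 2 ^ k * (cmod (d k \<zeta>))\<^sup>2"
        by (simp add: x_def y_def power_one_over)
    qed
    then have "convergent (\<lambda>n. \<Sum>k<n. d k \<zeta>)"
      by (simp add: summable_iff_convergent)
    moreover have "(\<Sum>k<n. d k \<zeta>) = f (r n) \<zeta> - f (r 0) \<zeta>" for n
      unfolding d_def by (rule sum_lessThan_telescope)
    ultimately have "convergent (\<lambda>n. (f (r n) \<zeta> - f (r 0) \<zeta>) + f (r 0) \<zeta>)"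
      using convergent_add convergent_const by fastforce
    then show ?case by simp
  qed
  define g where "g \<zeta> = lim (\<lambda>k. f (r k) \<zeta>)" for \<zeta>
  have [measurable]: "g \<in> borel_measurable torus"
    unfolding g_def[abs_def] by measurable
  have lim: "AE \<zeta> in torus. (\<lambda>k. f (r k) \<zeta>) \<longlonglongrightarrow> g \<zeta>"
    using conv by eventually_elim (simp add: g_def convergent_LIMSEQ_iff)
  have dist: "(\<integral>\<^sup>+\<zeta>. ennreal ((cmod (f n \<zeta> - g \<zeta>))\<^sup>2) \<partial>torus) \<le> ennreal (((1/2) ^ k)\<^sup>2)" if "N k \<le> n" for n k
  proof -
    have "(\<integral>\<^sup>+\<zeta>. ennreal ((cmod (f n \<zeta> - g \<zeta>))\<^sup>2) \<partial>torus)
        = (\<integral>\<^sup>+\<zeta>. liminf (\<lambda>j. ennreal ((cmod (f n \<zeta> - f (r j) \<zeta>))\<^sup>2)) \<partial>torus)"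
    proof (rule nn_integral_cong_AE)
      show "AE \<zeta> in torus. ennreal ((cmod (f n \<zeta> - g \<zeta>))\<^sup>2)
          = liminf (\<lambda>j. ennreal ((cmod (f n \<zeta> - f (r j) \<zeta>))\<^sup>2))"
        using lim
      proof eventually_elim
        case (elim \<zeta>)
        then have "(\<lambda>j. ennreal ((cmod (f n \<zeta> - f (r j) \<zeta>))\<^sup>2)) \<longlonglongrightarrow> ennreal ((cmod (f n \<zeta> - g \<zeta>))\<^sup>2)"
          by (intro tendsto_intros)
        then show ?case by (intro lim_imp_Liminf[symmetric]) auto
      qed
    qed
    also have "\<dots> \<le> liminf (\<lambda>j. \<integral>\<^sup>+\<zeta>. ennreal ((cmod (f n \<zeta> - f (r j) \<zeta>))\<^sup>2) \<partial>torus)"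
      by (rule nn_integral_liminf) measurable
    also have "\<dots> \<le> limsup (\<lambda>j. \<integral>\<^sup>+\<zeta>. ennreal ((cmod (f n \<zeta> - f (r j) \<zeta>))\<^sup>2) \<partial>torus)"
      by (rule Liminf_le_Limsup) simp
    also have "\<dots> \<le> ennreal (((1/2) ^ k)\<^sup>2)"
    proof (rule Limsup_bounded)
      show "\<forall>\<^sub>F j in sequentially. (\<integral>\<^sup>+\<zeta>. ennreal ((cmod (f n \<zeta> - f (r j) \<zeta>))\<^sup>2) \<partial>torus) \<le> ennreal (((1/2) ^ k)\<^sup>2)"
        using eventually_ge_at_top[of k]
      proof eventually_elim
        case (elim j)
        have "N k \<le> r j"
          using elim by (auto simp: r_def intro: member_le_sum)
        have "(\<integral>\<^sup>+\<zeta>. ennreal ((cmod (f n \<zeta> - f (r j) \<zeta>))\<^sup>2) \<partial>torus)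
            = ennreal ((L2_norm (\<lambda>\<zeta>. f n \<zeta> - f (r j) \<zeta>))\<^sup>2)"
          unfolding L2_norm_square by (intro nn_integral_eq_integral L2_integrable L2_diff f) auto
        also have "\<dots> \<le> ennreal (((1/2) ^ k)\<^sup>2)"
          by (intro ennreal_leI power_mono less_imp_le[OF N]) (use that \<open>N k \<le> r j\<close> in auto)
        finally show ?case .
      qed
    qed
    finally show ?thesis .
  qed
  have diff_L2: "(\<lambda>\<zeta>. f n \<zeta> - g \<zeta>) \<in> L2" and diff_le: "L2_norm (\<lambda>\<zeta>. f n \<zeta> - g \<zeta>) \<le> (1/2) ^ k"
    if "N k \<le> n" for n k
  proof -
    have int: "integrable torus (\<lambda>\<zeta>. (cmod (f n \<zeta> - g \<zeta>))\<^sup>2)"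
      using dist[OF that] by (intro integrableI_bounded) (auto simp: less_top[symmetric] top_unique)
    then show "(\<lambda>\<zeta>. f n \<zeta> - g \<zeta>) \<in> L2" by (simp add: L2_def)
    have "ennreal ((L2_norm (\<lambda>\<zeta>. f n \<zeta> - g \<zeta>))\<^sup>2) \<le> ennreal (((1/2) ^ k)\<^sup>2)"
      using dist[OF that] unfolding L2_norm_square by (subst (asm) nn_integral_eq_integral[OF int]) auto
    then show "L2_norm (\<lambda>\<zeta>. f n \<zeta> - g \<zeta>) \<le> (1/2) ^ k"
      unfolding ennreal_le_iff[OF zero_le_power2] by (rule power2_le_imp_le) simp
  qed
  have "g \<in> L2"
    using L2_diff[OF f[of "N 0"] diff_L2[of 0 "N 0"]] by simp
  moreover have "(\<lambda>n. L2_norm (\<lambda>\<zeta>. f n \<zeta> - g \<zeta>)) \<longlonglongrightarrow> 0"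
  proof (rule LIMSEQ_I)
    fix e :: real assume "e > 0"
    then obtain k where k: "(1/2) ^ k < e"
      using real_arch_pow_inv[of e "1/2"] by auto
    show "\<exists>no. \<forall>n\<ge>no. norm (L2_norm (\<lambda>\<zeta>. f n \<zeta> - g \<zeta>) - 0) < e"
      using diff_le k by (intro exI[of _ "N k"]) (auto intro: le_less_trans)
  qed
  ultimately show ?thesis by (rule that)
qed

section \<open>Closed subspaces of square integrable functions\<close>

definition L2_subspace :: "tfun set \<Rightarrow> bool" where
  "L2_subspace A \<longleftrightarrow> A \<subseteq> L2 \<and> (\<lambda>_. 0) \<in> A \<and>
     (\<forall>f\<in>A. \<forall>g\<in>A. (\<lambda>\<zeta>. f \<zeta> + g \<zeta>) \<in> A) \<and> (\<forall>c. \<forall>f\<in>A. (\<lambda>\<zeta>. c * f \<zeta>) \<in> A)"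

lemma L2_subspaceD:
  assumes "L2_subspace A"
  shows "f \<in> A \<Longrightarrow> f \<in> L2" and "f \<in> A \<Longrightarrow> g \<in> A \<Longrightarrow> (\<lambda>\<zeta>. f \<zeta> + g \<zeta>) \<in> A"
    and "f \<in> A \<Longrightarrow> (\<lambda>\<zeta>. c * f \<zeta>) \<in> A" and "(\<lambda>_. 0) \<in> A"
  using assms by (auto simp: L2_subspace_def)

lemma LIMSEQ_0_le:
  fixes f :: "nat \<Rightarrow> real"
  assumes "g \<longlonglongrightarrow> 0" and "\<And>n. 0 \<le> f n" and "\<And>n. f n \<le> g n"
  shows "f \<longlonglongrightarrow> 0"
  by (rule tendsto_sandwich[OF _ _ tendsto_const assms(1)]) (simp_all add: assms)

lemma L2_closure_iff_LIMSEQ: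
  "f \<in> L2_closure A \<longleftrightarrow> f \<in> L2 \<and> (\<exists>g. (\<forall>n. g n \<in> A) \<and> (\<lambda>n. L2_norm (\<lambda>\<zeta>. f \<zeta> - g n \<zeta>)) \<longlonglongrightarrow> 0)"
proof
  assume f: "f \<in> L2_closure A"
  then have "\<exists>g\<in>A. L2_norm (\<lambda>\<zeta>. f \<zeta> - g \<zeta>) < 1 / real (Suc n)" for n
    by (auto simp: L2_closure_def L2_dist_eq)
  then obtain g where g: "\<And>n. g n \<in> A" "\<And>n. L2_norm (\<lambda>\<zeta>. f \<zeta> - g n \<zeta>) < 1 / real (Suc n)"
    by metis
  have "(\<lambda>n. L2_norm (\<lambda>\<zeta>. f \<zeta> - g n \<zeta>)) \<longlonglongrightarrow> 0"
  proof (rule LIMSEQ_0_le)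
    show "(\<lambda>n. 1 / real (Suc n)) \<longlonglongrightarrow> 0"
      using LIMSEQ_inverse_real_of_nat by (simp only: inverse_eq_divide)
  qed (simp, rule less_imp_le[OF g(2)])
  with f g(1) show "f \<in> L2 \<and> (\<exists>g. (\<forall>n. g n \<in> A) \<and> (\<lambda>n. L2_norm (\<lambda>\<zeta>. f \<zeta> - g n \<zeta>)) \<longlonglongrightarrow> 0)"
    by (auto simp: L2_closure_def)
next
  assume "f \<in> L2 \<and> (\<exists>g. (\<forall>n. g n \<in> A) \<and> (\<lambda>n. L2_norm (\<lambda>\<zeta>. f \<zeta> - g n \<zeta>)) \<longlonglongrightarrow> 0)"
  then obtain g where g: "f \<in> L2" "\<And>n. g n \<in> A" "(\<lambda>n. L2_norm (\<lambda>\<zeta>. f \<zeta> - g n \<zeta>)) \<longlonglongrightarrow> 0"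
    by blast
  show "f \<in> L2_closure A"
    unfolding L2_closure_def mem_Collect_eq L2_dist_eq
  proof (intro conjI allI impI g(1))
    fix e :: real assume "e > 0"
    with g(3) obtain n where "norm (L2_norm (\<lambda>\<zeta>. f \<zeta> - g n \<zeta>) - 0) < e"
      using LIMSEQ_D by blast
    then show "\<exists>g\<in>A. L2_norm (\<lambda>\<zeta>. f \<zeta> - g \<zeta>) < e"
      using g(2) by auto
  qed
qed

lemma L2_closureE:
  assumes "f \<in> L2_closure A"
  obtains g where "f \<in> L2" "\<And>n. g n \<in> A" "(\<lambda>n. L2_norm (\<lambda>\<zeta>. f \<zeta> - g n \<zeta>)) \<longlonglongrightarrow> 0"
  using assms unfolding L2_closure_iff_LIMSEQ by blast

lemma L2_closureI:
  assumes "f \<in> L2" "\<And>n. g n \<in> A" "(\<lambda>n. L2_norm (\<lambda>\<zeta>. f \<zeta> - g n \<zeta>)) \<longlonglongrightarrow> 0"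
  shows "f \<in> L2_closure A"
  using assms unfolding L2_closure_iff_LIMSEQ by blast

lemma L2_norm_zero [simp]: "L2_norm (\<lambda>_. 0) = 0"
  by (simp add: L2_norm_def)

lemma L2_closure_superset: "A \<subseteq> L2 \<Longrightarrow> A \<subseteq> L2_closure A"
  by (auto intro!: L2_closureI)

lemma L2_closure_L2: "f \<in> L2_closure A \<Longrightarrow> f \<in> L2"
  by (simp add: L2_closure_def)

lemma L2_closure_closed:
  assumes A: "A \<subseteq> L2"
  shows "L2_closure (L2_closure A) \<subseteq> L2_closure A"
proof
  fix f assume f: "f \<in> L2_closure (L2_closure A)"
  show "f \<in> L2_closure A"
    unfolding L2_closure_def mem_Collect_eq L2_dist_eq
  proof (intro conjI allI impI)
    show "f \<in> L2" using f by (rule L2_closure_L2)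
    fix e :: real assume "e > 0"
    then obtain g where g: "g \<in> L2_closure A" "L2_norm (\<lambda>\<zeta>. f \<zeta> - g \<zeta>) < e / 2"
      using f unfolding L2_closure_def[of "L2_closure A"] L2_dist_eq by (auto dest: spec[of _ "e / 2"])
    then obtain h where h: "h \<in> A" "L2_norm (\<lambda>\<zeta>. g \<zeta> - h \<zeta>) < e / 2"
      using \<open>e > 0\<close> unfolding L2_closure_def L2_dist_eq by (auto dest: spec[of _ "e / 2"])
    have "L2_norm (\<lambda>\<zeta>. f \<zeta> - h \<zeta>) < e"
      using L2_norm_diff_triangle[of f g h] g h A f L2_closure_L2 by fastforce
    with h(1) show "\<exists>g\<in>A. L2_norm (\<lambda>\<zeta>. f \<zeta> - g \<zeta>) < e" by blast
  qed
qed

lemma L2_norm_mult_le: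
  assumes f: "f \<in> L2" and b: "b \<in> borel_measurable torus" "AE \<zeta> in torus. cmod (b \<zeta>) \<le> K"
  shows "L2_norm (\<lambda>\<zeta>. b \<zeta> * f \<zeta>) \<le> \<bar>K\<bar> * L2_norm f"
proof -
  have "(L2_norm (\<lambda>\<zeta>. b \<zeta> * f \<zeta>))\<^sup>2 \<le> (\<integral>\<zeta>. K\<^sup>2 * (cmod (f \<zeta>))\<^sup>2 \<partial>torus)"
    unfolding L2_norm_square
  proof (rule integral_mono_AE)
    show "AE \<zeta> in torus. (cmod (b \<zeta> * f \<zeta>))\<^sup>2 \<le> K\<^sup>2 * (cmod (f \<zeta>))\<^sup>2"
      using b(2) by eventually_elim (auto simp: norm_mult power_mult_distrib intro!: mult_right_mono power_mono)
  qed (intro integrable_mult_right L2_integrable L2_mult[OF _ b] f)+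
  also have "\<dots> = (\<bar>K\<bar> * L2_norm f)\<^sup>2"
    by (simp add: L2_norm_square power_mult_distrib)
  finally show ?thesis by (rule power2_le_imp_le) simp
qed

text \<open>A bounded multiplier is continuous, so only generators have to be checked; their
  products need to lie merely in the closure of \<open>B\<close>, not in \<open>B\<close>.\<close>

lemma L2_closure_mult:
  assumes "A \<subseteq> L2" and "B \<subseteq> L2" and b: "b \<in> borel_measurable torus" "AE \<zeta> in torus. cmod (b \<zeta>) \<le> K"
    and "\<And>f. f \<in> A \<Longrightarrow> (\<lambda>\<zeta>. b \<zeta> * f \<zeta>) \<in> L2_closure B" and "f \<in> L2_closure A"
  shows "(\<lambda>\<zeta>. b \<zeta> * f \<zeta>) \<in> L2_closure B"
proof -
  obtain g where g: "f \<in> L2" "\<And>n. g n \<in> A" "(\<lambda>n. L2_norm (\<lambda>\<zeta>. f \<zeta> - g n \<zeta>)) \<longlonglongrightarrow> 0"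
    using L2_closureE[OF assms(6)] by blast
  have gL2: "g n \<in> L2" for n using g(2) assms(1) by blast
  have le: "L2_norm (\<lambda>\<zeta>. b \<zeta> * f \<zeta> - b \<zeta> * g n \<zeta>) \<le> \<bar>K\<bar> * L2_norm (\<lambda>\<zeta>. f \<zeta> - g n \<zeta>)" for n
    using L2_norm_mult_le[OF L2_diff[OF g(1) gL2] b, of n] by (simp add: algebra_simps)
  have lim: "(\<lambda>n. L2_norm (\<lambda>\<zeta>. b \<zeta> * f \<zeta> - b \<zeta> * g n \<zeta>)) \<longlonglongrightarrow> 0"
  proof (rule LIMSEQ_0_le)
    show "(\<lambda>n. \<bar>K\<bar> * L2_norm (\<lambda>\<zeta>. f \<zeta> - g n \<zeta>)) \<longlonglongrightarrow> 0"
      using tendsto_mult_left[OF g(3), of "\<bar>K\<bar>"] by simp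
  qed (simp, rule le)
  have "(\<lambda>\<zeta>. b \<zeta> * f \<zeta>) \<in> L2_closure (L2_closure B)"
    by (rule L2_closureI[OF L2_mult[OF g(1) b] assms(5)[OF g(2)] lim])
  then show ?thesis
    using L2_closure_closed[OF assms(2)] by blast
qed

lemma L2_LIMSEQ_add:
  assumes "f \<in> L2" "\<And>n. u n \<in> L2" "(\<lambda>n. L2_norm (\<lambda>\<zeta>. f \<zeta> - u n \<zeta>)) \<longlonglongrightarrow> 0"
    and "g \<in> L2" "\<And>n. v n \<in> L2" "(\<lambda>n. L2_norm (\<lambda>\<zeta>. g \<zeta> - v n \<zeta>)) \<longlonglongrightarrow> 0"
  shows "(\<lambda>n. L2_norm (\<lambda>\<zeta>. f \<zeta> + g \<zeta> - (u n \<zeta> + v n \<zeta>))) \<longlonglongrightarrow> 0"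
proof (rule LIMSEQ_0_le)
  show "(\<lambda>n. L2_norm (\<lambda>\<zeta>. f \<zeta> - u n \<zeta>) + L2_norm (\<lambda>\<zeta>. g \<zeta> - v n \<zeta>)) \<longlonglongrightarrow> 0"
    using tendsto_add[OF assms(3,6)] by simp
  show "L2_norm (\<lambda>\<zeta>. f \<zeta> + g \<zeta> - (u n \<zeta> + v n \<zeta>))
      \<le> L2_norm (\<lambda>\<zeta>. f \<zeta> - u n \<zeta>) + L2_norm (\<lambda>\<zeta>. g \<zeta> - v n \<zeta>)" for n
    using L2_norm_add_le[OF L2_diff[OF assms(1) assms(2)[of n]] L2_diff[OF assms(4) assms(5)[of n]]]
    by (simp add: add_diff_add)
qed simp

lemma L2_closure_add:
  assumes A: "L2_subspace A" and "f \<in> L2_closure A" "g \<in> L2_closure A"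
  shows "(\<lambda>\<zeta>. f \<zeta> + g \<zeta>) \<in> L2_closure A"
proof -
  obtain u where u: "f \<in> L2" "\<And>n. u n \<in> A" "(\<lambda>n. L2_norm (\<lambda>\<zeta>. f \<zeta> - u n \<zeta>)) \<longlonglongrightarrow> 0"
    using L2_closureE[OF assms(2)] by blast
  obtain v where v: "g \<in> L2" "\<And>n. v n \<in> A" "(\<lambda>n. L2_norm (\<lambda>\<zeta>. g \<zeta> - v n \<zeta>)) \<longlonglongrightarrow> 0"
    using L2_closureE[OF assms(3)] by blast
  have L2: "u n \<in> L2" "v n \<in> L2" for n
    using u(2) v(2) L2_subspaceD(1)[OF A] by blast+
  show ?thesis
    by (rule L2_closureI[OF L2_add[OF u(1) v(1)] L2_subspaceD(2)[OF A u(2) v(2)]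
          L2_LIMSEQ_add[OF u(1) L2(1) u(3) v(1) L2(2) v(3)]])
qed

lemma L2_subspace_closure:
  assumes A: "L2_subspace A"
  shows "L2_subspace (L2_closure A)"
proof -
  have sub: "A \<subseteq> L2" using L2_subspaceD(1)[OF A] by blast
  have "(\<lambda>\<zeta>. c * f \<zeta>) \<in> L2_closure A" if "f \<in> L2_closure A" for c f
    by (rule L2_closure_mult[OF sub sub, where K = "cmod c"])
       (use that L2_closure_superset[OF sub] L2_subspaceD(3)[OF A] in auto)
  then show ?thesis
    unfolding L2_subspace_def
    using L2_closure_L2 L2_closure_add[OF A] L2_closure_superset[OF sub] L2_subspaceD(4)[OF A] by auto
qed

lemma L2_closure_cong_AE:
  assumes "f \<in> L2_closure A" and "A \<subseteq> L2" and "g \<in> L2" and "AE \<zeta> in torus. f \<zeta> = g \<zeta>"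
  shows "g \<in> L2_closure A"
proof -
  obtain u where u: "f \<in> L2" "\<And>n. u n \<in> A" "(\<lambda>n. L2_norm (\<lambda>\<zeta>. f \<zeta> - u n \<zeta>)) \<longlonglongrightarrow> 0"
    using L2_closureE[OF assms(1)] by blast
  have "u n \<in> L2" for n using u(2) assms(2) by blast
  note [measurable] = L2_measurable[OF u(1)] L2_measurable[OF this] L2_measurable[OF assms(3)]
  have "L2_norm (\<lambda>\<zeta>. f \<zeta> - u n \<zeta>) = L2_norm (\<lambda>\<zeta>. g \<zeta> - u n \<zeta>)" for n
    by (rule L2_norm_cong_AE) (use assms(4) in \<open>auto elim: eventually_mono\<close>)
  with u show ?thesis
    by (intro L2_closureI[OF assms(3), of u]) auto
qed

lemma L2_norm_le_bound:
  assumes "f \<in> borel_measurable torus" and "\<And>\<zeta>. \<zeta> \<in> unit_torus \<Longrightarrow> cmod (f \<zeta>) \<le> K" and "K \<ge> 0"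
  shows "L2_norm f \<le> K"
proof -
  have "(L2_norm f)\<^sup>2 \<le> (\<integral>\<zeta>. K\<^sup>2 \<partial>torus)"
    unfolding L2_norm_square
    by (intro integral_mono_AE L2_integrable L2_bounded[OF assms(1,2)] eventually_mono[OF AE_unit_torus])
       (auto intro!: power_mono assms)
  also have "(\<integral>\<zeta>. K\<^sup>2 \<partial>torus) = K\<^sup>2"
    by (simp add: measure_torus_UNIV)
  finally show ?thesis
    using \<open>K \<ge> 0\<close> by (rule power2_le_imp_le)
qed

text \<open>Dominated convergence turns pointwise into norm convergence. It is used to pass from the
  radial dilates of \<open>G\<close> to \<open>G\<close> on the torus.\<close>

lemma L2_closure_dominated:
  assumes A: "A \<subseteq> L2" and f: "\<And>n. f n \<in> L2_closure A" and g: "g \<in> borel_measurable torus"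
    and bound: "\<And>n. AE \<zeta> in torus. cmod (f n \<zeta>) \<le> K" and lim: "AE \<zeta> in torus. (\<lambda>n. f n \<zeta>) \<longlonglongrightarrow> g \<zeta>"
  shows "g \<in> L2_closure A"
proof -
  note [measurable] = L2_measurable[OF L2_closure_L2[OF f]] g
  have "AE \<zeta> in torus. \<forall>n. cmod (f n \<zeta>) \<le> K"
    using bound by (simp add: AE_all_countable)
  with lim have gK: "AE \<zeta> in torus. cmod (g \<zeta>) \<le> K \<and> (\<forall>n. cmod (f n \<zeta>) \<le> K)"
  proof eventually_elim
    case (elim \<zeta>)
    then show ?case by (auto intro!: LIMSEQ_le_const2[OF tendsto_norm[OF elim(1)]])
  qed
  then have gL2: "g \<in> L2"
    by (intro L2_AE_bounded[OF g, of K]) (auto elim: eventually_mono)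
  have "(\<lambda>n. \<integral>\<zeta>. (cmod (g \<zeta> - f n \<zeta>))\<^sup>2 \<partial>torus) \<longlonglongrightarrow> (\<integral>\<zeta>. 0 \<partial>torus)"
  proof (rule integral_dominated_convergence[where w = "\<lambda>_. (2 * K)\<^sup>2"])
    show "AE \<zeta> in torus. (\<lambda>n. (cmod (g \<zeta> - f n \<zeta>))\<^sup>2) \<longlonglongrightarrow> 0"
      using lim
    proof eventually_elim
      case (elim \<zeta>)
      have "(\<lambda>n. (cmod (g \<zeta> - f n \<zeta>))\<^sup>2) \<longlonglongrightarrow> (cmod (g \<zeta> - g \<zeta>))\<^sup>2"
        by (intro tendsto_intros elim)
      then show ?case by simp
    qed
    show "AE \<zeta> in torus. norm ((cmod (g \<zeta> - f n \<zeta>))\<^sup>2) \<le> (2 * K)\<^sup>2" for n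
      using gK
    proof eventually_elim
      case (elim \<zeta>)
      have "cmod (g \<zeta> - f n \<zeta>) \<le> 2 * K"
        using norm_triangle_ineq4[of "g \<zeta>" "f n \<zeta>"] elim by (auto dest: spec[of _ n])
      then show ?case
        unfolding real_norm_def abs_of_nonneg[OF zero_le_power2] by (rule power_mono) simp
    qed
  qed auto
  then have "(\<lambda>n. L2_norm (\<lambda>\<zeta>. g \<zeta> - f n \<zeta>)) \<longlonglongrightarrow> sqrt 0"
    unfolding L2_norm_def by (intro tendsto_real_sqrt) simp
  then have "g \<in> L2_closure (L2_closure A)"
    by (intro L2_closureI[OF gL2 f]) simp
  then show ?thesis using L2_closure_closed[OF A] by blast
qed

section \<open>Polynomials and their uniform limits\<close>

lemma polys_monom: "(\<lambda>\<zeta>. c * fst \<zeta> ^ m * snd \<zeta> ^ n) \<in> polys"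
  unfolding polys_def by (intro CollectI exI[of _ "{(m, n)}"] exI[of _ "\<lambda>_. c"]) simp

lemma polys_add:
  assumes "p \<in> polys" "q \<in> polys"
  shows "(\<lambda>\<zeta>. p \<zeta> + q \<zeta>) \<in> polys"
proof -
  define mon :: "nat \<times> nat \<Rightarrow> tfun" where "mon = (\<lambda>(m, n) \<zeta>. fst \<zeta> ^ m * snd \<zeta> ^ n)"
  have split: "(\<Sum>(m, n)\<in>F. c (m, n) * fst \<zeta> ^ m * snd \<zeta> ^ n) = (\<Sum>i\<in>F. c i * mon i \<zeta>)" for F c \<zeta>
    by (simp add: mon_def split_beta mult.assoc)
  obtain F c where p: "finite F" "p = (\<lambda>\<zeta>. \<Sum>i\<in>F. c i * mon i \<zeta>)"
    using assms(1) unfolding polys_def split by blast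
  obtain G d where q: "finite G" "q = (\<lambda>\<zeta>. \<Sum>i\<in>G. d i * mon i \<zeta>)"
    using assms(2) unfolding polys_def split by blast
  define e where "e i = (if i \<in> F then c i else 0) + (if i \<in> G then d i else 0)" for i
  have "(\<Sum>i\<in>F \<union> G. e i * mon i \<zeta>) = p \<zeta> + q \<zeta>" for \<zeta>
  proof -
    have "(\<Sum>i\<in>F \<union> G. e i * mon i \<zeta>)
        = (\<Sum>i\<in>F \<union> G. if i \<in> F then c i * mon i \<zeta> else 0) + (\<Sum>i\<in>F \<union> G. if i \<in> G then d i * mon i \<zeta> else 0)"
      by (simp add: e_def distrib_right flip: sum.distrib) (intro sum.cong, auto)
    then show ?thesis
      using p q by (simp add: sum.If_cases Int_absorb1)
  qed
  then show ?thesis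
    using p(1) q(1) unfolding polys_def split
    by (intro CollectI exI[of _ "F \<union> G"] exI[of _ e]) (auto simp: fun_eq_iff)
qed

lemma polys_sum: "(\<And>i. i \<in> I \<Longrightarrow> f i \<in> polys) \<Longrightarrow> (\<lambda>\<zeta>. \<Sum>i\<in>I. f i \<zeta>) \<in> polys"
proof (induction I rule: infinite_finite_induct)
  case (insert i I)
  then show ?case using polys_add[of "f i" "\<lambda>\<zeta>. \<Sum>i\<in>I. f i \<zeta>"] by simp
qed (use polys_monom[of 0 0 0] in auto)

lemma polysE:
  assumes "p \<in> polys"
  obtains F c where "finite F" "\<And>\<zeta>. p \<zeta> = (\<Sum>i\<in>F. c i * fst \<zeta> ^ fst i * snd \<zeta> ^ snd i)"
  using assms that unfolding polys_def by (auto simp: split_beta)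

lemma polys_mult:
  assumes "p \<in> polys" "q \<in> polys"
  shows "(\<lambda>\<zeta>. p \<zeta> * q \<zeta>) \<in> polys"
proof -
  obtain F c where p: "\<And>\<zeta>. p \<zeta> = (\<Sum>i\<in>F. c i * fst \<zeta> ^ fst i * snd \<zeta> ^ snd i)"
    using polysE[OF assms(1)] by metis
  obtain G d where q: "\<And>\<zeta>. q \<zeta> = (\<Sum>i\<in>G. d i * fst \<zeta> ^ fst i * snd \<zeta> ^ snd i)"
    using polysE[OF assms(2)] by metis
  have "p \<zeta> * q \<zeta> = (\<Sum>i\<in>F. \<Sum>j\<in>G. c i * d j * fst \<zeta> ^ (fst i + fst j) * snd \<zeta> ^ (snd i + snd j))" for \<zeta>
    by (simp add: p q sum_product power_add mult_ac)
  then show ?thesis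
    by (simp only:) (intro polys_sum polys_monom)
qed

lemma polys_const: "(\<lambda>_. c) \<in> polys"
  and polys_fst: "fst \<in> polys" and polys_snd: "snd \<in> polys"
  using polys_monom[of c 0 0] polys_monom[of 1 1 0] polys_monom[of 1 0 1] by simp_all

lemma polys_measurable: "p \<in> polys \<Longrightarrow> p \<in> borel_measurable torus"
proof (elim polysE)
  fix F c assume "\<And>\<zeta>. p \<zeta> = (\<Sum>i\<in>F. c i * fst \<zeta> ^ fst i * snd \<zeta> ^ snd i)"
  then have "p = (\<lambda>\<zeta>. \<Sum>i\<in>F. c i * fst \<zeta> ^ fst i * snd \<zeta> ^ snd i)" by blast
  then show ?thesis by simp
qed

lemma polys_bounded:
  assumes "p \<in> polys"
  obtains K where "\<And>\<zeta>. \<zeta> \<in> unit_torus \<Longrightarrow> cmod (p \<zeta>) \<le> K"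
proof -
  obtain F c where p: "\<And>\<zeta>. p \<zeta> = (\<Sum>i\<in>F. c i * fst \<zeta> ^ fst i * snd \<zeta> ^ snd i)"
    using polysE[OF assms(1)] by metis
  have "cmod (p \<zeta>) \<le> (\<Sum>i\<in>F. cmod (c i))" if "\<zeta> \<in> unit_torus" for \<zeta>
    unfolding p by (rule sum_norm_le) (use that in \<open>simp add: norm_mult norm_power unit_torusD\<close>)
  then show ?thesis by (rule that)
qed

lemma polys_L2: "polys \<subseteq> L2"
proof
  fix p assume p: "p \<in> polys"
  obtain K where "\<And>\<zeta>. \<zeta> \<in> unit_torus \<Longrightarrow> cmod (p \<zeta>) \<le> K"
    using polys_bounded[OF p] by blast
  then show "p \<in> L2" by (rule L2_bounded[OF polys_measurable[OF p]])
qed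

lemma L2_subspace_polys: "L2_subspace polys"
  unfolding L2_subspace_def using polys_L2 polys_const polys_add polys_mult[OF polys_const] by blast

lemma L2_subspace_H2: "L2_subspace H2"
  unfolding H2_def by (rule L2_subspace_closure[OF L2_subspace_polys])

lemma polys_H2: "polys \<subseteq> H2"
  unfolding H2_def by (rule L2_closure_superset[OF polys_L2])

lemma H2_mult_polys:
  assumes "p \<in> polys" and "h \<in> H2"
  shows "(\<lambda>\<zeta>. p \<zeta> * h \<zeta>) \<in> H2"
proof -
  obtain K where K: "\<And>\<zeta>. \<zeta> \<in> unit_torus \<Longrightarrow> cmod (p \<zeta>) \<le> K"
    using polys_bounded[OF assms(1)] by blast
  show ?thesis
    unfolding H2_def
  proof (rule L2_closure_mult[OF polys_L2 polys_L2 polys_measurable[OF assms(1)]])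
    show "AE \<zeta> in torus. cmod (p \<zeta>) \<le> K"
      by (rule eventually_mono[OF AE_unit_torus K])
    show "(\<lambda>\<zeta>. p \<zeta> * f \<zeta>) \<in> L2_closure polys" if "f \<in> polys" for f
      using polys_H2 polys_mult[OF assms(1) that] unfolding H2_def by blast
    show "h \<in> L2_closure polys" using assms(2) by (simp only: H2_def)
  qed
qed

text \<open>In effect the bidisc algebra restricted to the torus. Only values on
  \<open>unit_torus\<close> count and measurability is not built in; the set is closed under
  products, exponentials and geometric series, which are the ingredients of a dilate of
  \<open>G\<close>.\<close>

definition unif_polys :: "tfun set" where
  "unif_polys = {f. \<forall>e>0. \<exists>p\<in>polys. \<forall>\<zeta>\<in>unit_torus. cmod (f \<zeta> - p \<zeta>) < e}"

lemma polys_unif: "p \<in> polys \<Longrightarrow> p \<in> unif_polys"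
  unfolding unif_polys_def by (auto intro!: bexI[of _ p])

lemma unif_polys_bounded:
  assumes "f \<in> unif_polys"
  obtains K where "K > 0" "\<And>\<zeta>. \<zeta> \<in> unit_torus \<Longrightarrow> cmod (f \<zeta>) \<le> K"
proof -
  obtain p where p: "p \<in> polys" "\<And>\<zeta>. \<zeta> \<in> unit_torus \<Longrightarrow> cmod (f \<zeta> - p \<zeta>) < 1"
    using assms unfolding unif_polys_def by (auto dest: spec[of _ 1])
  obtain K where K: "\<And>\<zeta>. \<zeta> \<in> unit_torus \<Longrightarrow> cmod (p \<zeta>) \<le> K"
    using polys_bounded[OF p(1)] by blast
  have "cmod (f \<zeta>) \<le> \<bar>K\<bar> + 1" if "\<zeta> \<in> unit_torus" for \<zeta>
    using norm_triangle_ineq[of "p \<zeta>" "f \<zeta> - p \<zeta>"] p(2)[OF that] K[OF that] by simp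
  then show ?thesis by (intro that[of "\<bar>K\<bar> + 1"]) auto
qed

lemma unif_polys_closed:
  assumes "\<And>e. e > 0 \<Longrightarrow> \<exists>g\<in>unif_polys. \<forall>\<zeta>\<in>unit_torus. cmod (f \<zeta> - g \<zeta>) < e"
  shows "f \<in> unif_polys"
  unfolding unif_polys_def
proof (intro CollectI allI impI)
  fix e :: real assume "e > 0"
  then obtain g where g: "g \<in> unif_polys" "\<And>\<zeta>. \<zeta> \<in> unit_torus \<Longrightarrow> cmod (f \<zeta> - g \<zeta>) < e / 2"
    using assms[of "e / 2"] by auto
  then obtain p where p: "p \<in> polys" "\<And>\<zeta>. \<zeta> \<in> unit_torus \<Longrightarrow> cmod (g \<zeta> - p \<zeta>) < e / 2"
    using \<open>e > 0\<close> unfolding unif_polys_def by (auto dest: spec[of _ "e / 2"])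
  have "cmod (f \<zeta> - p \<zeta>) < e" if "\<zeta> \<in> unit_torus" for \<zeta>
    using norm_triangle_ineq[of "f \<zeta> - g \<zeta>" "g \<zeta> - p \<zeta>"] g(2)[OF that] p(2)[OF that] by simp
  with p(1) show "\<exists>p\<in>polys. \<forall>\<zeta>\<in>unit_torus. cmod (f \<zeta> - p \<zeta>) < e" by blast
qed

lemma unif_polys_add:
  assumes "f \<in> unif_polys" "g \<in> unif_polys"
  shows "(\<lambda>\<zeta>. f \<zeta> + g \<zeta>) \<in> unif_polys"
proof (rule unif_polys_closed)
  fix e :: real assume "e > 0"
  then have "e / 2 > 0" by simp
  obtain p where p: "p \<in> polys" "\<And>\<zeta>. \<zeta> \<in> unit_torus \<Longrightarrow> cmod (f \<zeta> - p \<zeta>) < e / 2"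
    using assms(1) \<open>e / 2 > 0\<close> unfolding unif_polys_def by blast
  obtain q where q: "q \<in> polys" "\<And>\<zeta>. \<zeta> \<in> unit_torus \<Longrightarrow> cmod (g \<zeta> - q \<zeta>) < e / 2"
    using assms(2) \<open>e / 2 > 0\<close> unfolding unif_polys_def by blast
  have "cmod (f \<zeta> + g \<zeta> - (p \<zeta> + q \<zeta>)) < e" if "\<zeta> \<in> unit_torus" for \<zeta>
    using norm_triangle_ineq[of "f \<zeta> - p \<zeta>" "g \<zeta> - q \<zeta>"] p(2)[OF that] q(2)[OF that]
    by (simp add: add_diff_add)
  then show "\<exists>h\<in>unif_polys. \<forall>\<zeta>\<in>unit_torus. cmod (f \<zeta> + g \<zeta> - h \<zeta>) < e"
    by (intro bexI[OF _ polys_unif[OF polys_add[OF p(1) q(1)]]]) blast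
qed

text \<open>One factor is approximated at a time while the other stays bounded; the general product
  reduces to this case by approximating its second factor.\<close>

lemma unif_polys_mult_poly:
  assumes "f \<in> unif_polys" "q \<in> polys"
  shows "(\<lambda>\<zeta>. f \<zeta> * q \<zeta>) \<in> unif_polys"
proof (rule unif_polys_closed)
  fix e :: real assume "e > 0"
  obtain K where K: "K > 0" "\<And>\<zeta>. \<zeta> \<in> unit_torus \<Longrightarrow> cmod (q \<zeta>) \<le> K"
    using unif_polys_bounded[OF polys_unif[OF assms(2)]] by blast
  obtain p where p: "p \<in> polys" "\<And>\<zeta>. \<zeta> \<in> unit_torus \<Longrightarrow> cmod (f \<zeta> - p \<zeta>) < e / K"
    using assms(1) \<open>e > 0\<close> K(1) unfolding unif_polys_def by (auto dest: spec[of _ "e / K"])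
  have "cmod (f \<zeta> * q \<zeta> - p \<zeta> * q \<zeta>) < e" if "\<zeta> \<in> unit_torus" for \<zeta>
  proof -
    have "cmod (f \<zeta> * q \<zeta> - p \<zeta> * q \<zeta>) = cmod (f \<zeta> - p \<zeta>) * cmod (q \<zeta>)"
      by (simp add: norm_mult flip: left_diff_distrib)
    also have "\<dots> \<le> cmod (f \<zeta> - p \<zeta>) * K"
      by (intro mult_left_mono K that) auto
    also have "\<dots> < e"
      using p(2)[OF that] K(1) by (simp add: field_simps)
    finally show ?thesis .
  qed
  then show "\<exists>h\<in>unif_polys. \<forall>\<zeta>\<in>unit_torus. cmod (f \<zeta> * q \<zeta> - h \<zeta>) < e"
    by (intro bexI[OF _ polys_unif[OF polys_mult[OF p(1) assms(2)]]]) blast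
qed

lemma unif_polys_mult:
  assumes "f \<in> unif_polys" "g \<in> unif_polys"
  shows "(\<lambda>\<zeta>. f \<zeta> * g \<zeta>) \<in> unif_polys"
proof (rule unif_polys_closed)
  fix e :: real assume "e > 0"
  obtain K where K: "K > 0" "\<And>\<zeta>. \<zeta> \<in> unit_torus \<Longrightarrow> cmod (f \<zeta>) \<le> K"
    using unif_polys_bounded[OF assms(1)] by blast
  obtain q where q: "q \<in> polys" "\<And>\<zeta>. \<zeta> \<in> unit_torus \<Longrightarrow> cmod (g \<zeta> - q \<zeta>) < e / K"
    using assms(2) \<open>e > 0\<close> K(1) unfolding unif_polys_def by (auto dest: spec[of _ "e / K"])
  have "cmod (f \<zeta> * g \<zeta> - f \<zeta> * q \<zeta>) < e" if "\<zeta> \<in> unit_torus" for \<zeta>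
  proof -
    have "cmod (f \<zeta> * g \<zeta> - f \<zeta> * q \<zeta>) = cmod (f \<zeta>) * cmod (g \<zeta> - q \<zeta>)"
      by (simp add: norm_mult flip: right_diff_distrib)
    also have "\<dots> \<le> K * cmod (g \<zeta> - q \<zeta>)"
      by (intro mult_right_mono K that) auto
    also have "\<dots> < e"
      using q(2)[OF that] K(1) by (simp add: field_simps)
    finally show ?thesis .
  qed
  then show "\<exists>h\<in>unif_polys. \<forall>\<zeta>\<in>unit_torus. cmod (f \<zeta> * g \<zeta> - h \<zeta>) < e"
    by (intro bexI[OF _ unif_polys_mult_poly[OF assms(1) q(1)]]) blast
qed

lemma unif_polys_power: "f \<in> unif_polys \<Longrightarrow> (\<lambda>\<zeta>. f \<zeta> ^ n) \<in> unif_polys"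
  by (induction n) (auto intro: unif_polys_mult polys_unif[OF polys_const])

lemma unif_polys_suminf:
  assumes f: "\<And>n. f n \<in> unif_polys" and le: "\<And>n \<zeta>. \<zeta> \<in> unit_torus \<Longrightarrow> cmod (f n \<zeta>) \<le> M n" and "summable M"
  shows "(\<lambda>\<zeta>. \<Sum>n. f n \<zeta>) \<in> unif_polys"
proof (rule unif_polys_closed)
  fix e :: real assume "e > 0"
  have "uniform_limit unit_torus (\<lambda>n \<zeta>. \<Sum>i<n. f i \<zeta>) (\<lambda>\<zeta>. \<Sum>n. f n \<zeta>) sequentially"
    by (rule Weierstrass_m_test[OF le \<open>summable M\<close>])
  then obtain n where n: "\<And>\<zeta>. \<zeta> \<in> unit_torus \<Longrightarrow> dist (\<Sum>i<n. f i \<zeta>) (\<Sum>n. f n \<zeta>) < e"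
    using \<open>e > 0\<close> unfolding uniform_limit_iff eventually_sequentially by blast
  have "(\<lambda>\<zeta>. \<Sum>i<n. f i \<zeta>) \<in> unif_polys"
    by (induction n) (auto intro: f unif_polys_add polys_unif[OF polys_const])
  with n show "\<exists>g\<in>unif_polys. \<forall>\<zeta>\<in>unit_torus. cmod ((\<Sum>n. f n \<zeta>) - g \<zeta>) < e"
    by (intro bexI[of _ "\<lambda>\<zeta>. \<Sum>i<n. f i \<zeta>"]) (auto simp: dist_norm norm_minus_commute)
qed

lemma unif_polys_cong:
  assumes "f \<in> unif_polys" and "\<And>\<zeta>. \<zeta> \<in> unit_torus \<Longrightarrow> f \<zeta> = g \<zeta>"
  shows "g \<in> unif_polys"
  using assms unfolding unif_polys_def by simp

lemma unif_polys_exp: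
  assumes "f \<in> unif_polys"
  shows "(\<lambda>\<zeta>. exp (f \<zeta>)) \<in> unif_polys"
proof -
  obtain K where K: "K > 0" "\<And>\<zeta>. \<zeta> \<in> unit_torus \<Longrightarrow> cmod (f \<zeta>) \<le> K"
    using unif_polys_bounded[OF assms] by blast
  have "(\<lambda>\<zeta>. \<Sum>n. inverse (fact n) * f \<zeta> ^ n) \<in> unif_polys"
  proof (rule unif_polys_suminf)
    show "(\<lambda>\<zeta>. inverse (fact n) * f \<zeta> ^ n) \<in> unif_polys" for n
      by (intro unif_polys_mult unif_polys_power polys_unif[OF polys_const] assms)
    show "cmod (inverse (fact n) * f \<zeta> ^ n) \<le> inverse (fact n) * K ^ n" if "\<zeta> \<in> unit_torus" for n \<zeta>
      using K(2)[OF that] by (auto simp: norm_mult norm_inverse norm_power intro!: mult_left_mono power_mono)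
    show "summable (\<lambda>n. inverse (fact n) * K ^ n)" by (rule summable_exp)
  qed
  then show ?thesis
    by (simp add: exp_def scaleR_conv_of_real)
qed

lemma unif_polys_geometric:
  assumes "f \<in> unif_polys" and "\<And>\<zeta>. \<zeta> \<in> unit_torus \<Longrightarrow> cmod (f \<zeta>) \<le> r" and "r < 1"
  shows "(\<lambda>\<zeta>. 1 / (1 - f \<zeta>)) \<in> unif_polys"
proof (rule unif_polys_cong)
  have "0 \<le> r" using assms(2)[of "(1, 1)"] by (auto simp: unit_torus_def intro: order_trans[OF norm_ge_zero])
  show "(\<lambda>\<zeta>. \<Sum>n. f \<zeta> ^ n) \<in> unif_polys"
    using assms \<open>0 \<le> r\<close> by (intro unif_polys_suminf[where M = "\<lambda>n. r ^ n"] unif_polys_power)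
      (auto simp: norm_power intro!: power_mono summable_geometric)
  show "(\<Sum>n. f \<zeta> ^ n) = 1 / (1 - f \<zeta>)" if "\<zeta> \<in> unit_torus" for \<zeta>
    using assms(2)[OF that] assms(3) by (intro suminf_geometric) auto
qed

lemma unif_polys_H2:
  assumes "f \<in> unif_polys" and f: "f \<in> borel_measurable torus"
  shows "f \<in> H2"
  unfolding H2_def L2_closure_def mem_Collect_eq L2_dist_eq
proof (intro conjI allI impI)
  obtain K where K: "\<And>\<zeta>. \<zeta> \<in> unit_torus \<Longrightarrow> cmod (f \<zeta>) \<le> K"
    using unif_polys_bounded[OF assms(1)] by blast
  show "f \<in> L2" by (rule L2_bounded[OF f K])
  fix e :: real assume "e > 0"
  then obtain p where p: "p \<in> polys" "\<And>\<zeta>. \<zeta> \<in> unit_torus \<Longrightarrow> cmod (f \<zeta> - p \<zeta>) < e / 2"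
    using assms(1) unfolding unif_polys_def by (auto dest: spec[of _ "e / 2"])
  have "L2_norm (\<lambda>\<zeta>. f \<zeta> - p \<zeta>) \<le> e / 2"
    using \<open>e > 0\<close> p f polys_measurable by (intro L2_norm_le_bound) (auto intro: less_imp_le)
  with \<open>e > 0\<close> p(1) show "\<exists>g\<in>polys. L2_norm (\<lambda>\<zeta>. f \<zeta> - g \<zeta>) < e"
    by (intro bexI[of _ p]) auto
qed

section \<open>The inner function\<close>

text \<open>On the torus, \<open>(Z + W)\<^sup>2 = Z W |Z + W|\<^sup>2\<close>, and \<open>Z W / (1 - Z W)\<close> has real part \<open>- 1/2\<close>.\<close>

lemma Re_kernel:
  fixes Z W :: complex
  defines "A \<equiv> 1 - (cmod Z)\<^sup>2" and "B \<equiv> 1 - (cmod W)\<^sup>2" and "c \<equiv> Re (Z * cnj W)"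
  shows "Re ((Z + W)\<^sup>2 * cnj (1 - Z * W)) =
    2 * (Re Z)\<^sup>2 * B + 2 * (Re W)\<^sup>2 * A + A * B * (1 + c) - (1 + c) * (cmod (1 - Z * W))\<^sup>2"
  unfolding A_def B_def c_def cmod_power2 by (simp add: power2_eq_square) algebra

text \<open>Inside the bidisc all terms of \<open>Re_kernel\<close> are nonnegative except the last,
  which is at least \<open>- 2 |1 - Z W|^2\<close> because
  \<open>Re (Z (cnj W)) <= 1\<close>.\<close>

lemma Re_kernel_ge:
  assumes "cmod Z < 1" "cmod W < 1"
  shows "- 2 \<le> Re ((Z + W)\<^sup>2 / (1 - Z * W))"
proof -
  define c where "c = Re (Z * cnj W)"
  have "\<bar>c\<bar> \<le> cmod Z * cmod W"
    using abs_Re_le_cmod[of "Z * cnj W"] by (simp add: c_def norm_mult)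
  also have "\<dots> \<le> 1 * 1" using assms by (intro mult_mono) auto
  finally have c: "\<bar>c\<bar> \<le> 1" by simp
  have sq: "(cmod Z)\<^sup>2 \<le> 1" "(cmod W)\<^sup>2 \<le> 1"
    using assms by (simp_all add: power_le_one)
  have "cmod (Z * W) < 1"
    using assms mult_strict_mono'[of "cmod Z" 1 "cmod W" 1] by (simp add: norm_mult)
  then have "1 - Z * W \<noteq> 0" by (metis norm_one less_irrefl eq_iff_diff_eq_0)
  then have pos: "(cmod (1 - Z * W))\<^sup>2 > 0" by simp
  have "0 \<le> 2 * (Re Z)\<^sup>2 * (1 - (cmod W)\<^sup>2)" "0 \<le> 2 * (Re W)\<^sup>2 * (1 - (cmod Z)\<^sup>2)"
    "0 \<le> (1 - (cmod Z)\<^sup>2) * (1 - (cmod W)\<^sup>2) * (1 + c)"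
    using sq c by (auto intro!: mult_nonneg_nonneg)
  moreover have "(1 + c) * (cmod (1 - Z * W))\<^sup>2 \<le> 2 * (cmod (1 - Z * W))\<^sup>2"
    using c by (intro mult_right_mono) auto
  ultimately have "- (2 * (cmod (1 - Z * W))\<^sup>2) \<le> Re ((Z + W)\<^sup>2 * cnj (1 - Z * W))"
    unfolding Re_kernel c_def by linarith
  then have "- 2 \<le> Re ((Z + W)\<^sup>2 * cnj (1 - Z * W)) / (cmod (1 - Z * W))\<^sup>2"
    using pos by (simp add: field_simps)
  also have "\<dots> = Re ((Z + W)\<^sup>2 / (1 - Z * W))"
    unfolding complex_div_cnj[of "(Z + W)\<^sup>2"] by (simp only: Re_divide_of_real flip: of_real_power)
  finally show ?thesis .
qed

text \<open>For unimodular \<open>Z\<close> and \<open>W\<close> every term of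
  \<open>Re_kernel\<close> but the last contains a vanishing factor.\<close>

lemma Re_kernel_torus:
  assumes "cmod Z = 1" "cmod W = 1" "Z * W \<noteq> 1"
  shows "Re ((Z + W)\<^sup>2 / (1 - Z * W)) = - (1 + Re (Z * cnj W))"
proof -
  have pos: "(cmod (1 - Z * W))\<^sup>2 > 0" using assms(3) by simp
  have "Re ((Z + W)\<^sup>2 / (1 - Z * W)) = Re ((Z + W)\<^sup>2 * cnj (1 - Z * W)) / (cmod (1 - Z * W))\<^sup>2"
    unfolding complex_div_cnj[of "(Z + W)\<^sup>2"] by (simp only: Re_divide_of_real flip: of_real_power)
  also have "\<dots> = - (1 + Re (Z * cnj W))"
    unfolding Re_kernel using assms(1,2) pos by (simp add: field_simps)
  finally show ?thesis .
qed

text \<open>Compares a denominator on a radius with its value at the boundary, uniformly along the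
  radius. The 2 arises because \<open>1 - t\<close> is itself at most
  \<open>|1 - t u|\<close>.\<close>

lemma cmod_one_minus_scaled:
  assumes "cmod u = 1" "0 \<le> t" "t \<le> 1"
  shows "cmod (1 - u) \<le> 2 * cmod (1 - of_real t * u)"
proof -
  have "cmod (1 - u) \<le> cmod (1 - of_real t * u) + cmod (of_real t * u - u)"
    using norm_triangle_ineq[of "1 - of_real t * u" "of_real t * u - u"] by simp
  also have "cmod (of_real t * u - u) = 1 - t"
  proof -
    have "of_real t * u - u = of_real (t - 1) * u" by (simp add: algebra_simps)
    then show ?thesis using assms by (simp only: norm_mult norm_of_real) simp
  qed
  also have "1 - t \<le> cmod (1 - of_real t * u)"
    using norm_triangle_ineq2[of 1 "of_real t * u"] assms by (simp add: norm_mult)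
  finally show ?thesis by simp
qed

text \<open>At these points \<open>lam ^ n\<close> beats the small denominators \<open>1 - (z w)\<^sup>n\<close> of the series \<open>F\<close> below.\<close>

definition generic :: "complex \<times> complex \<Rightarrow> bool" where
  "generic \<zeta> \<longleftrightarrow> \<zeta> \<in> unit_torus \<and>
     eventually (\<lambda>n. 1 / real ((Suc n)\<^sup>2) \<le> cmod (1 - (fst \<zeta> * snd \<zeta>) ^ n)) sequentially"

lemma AE_generic: "AE \<zeta> in torus. generic \<zeta>"
  using AE_unit_torus AE_powers_away_from_one by eventually_elim (simp add: generic_def)

text \<open>Genericity speaks only of large exponents, but a root of unity returns to 1 at all
  multiples of its order, where the lower bound is violated.\<close>

lemma generic_power_neq_1:
  assumes "generic \<zeta>" "n > 0"
  shows "(fst \<zeta> * snd \<zeta>) ^ n \<noteq> 1"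
proof
  assume eq: "(fst \<zeta> * snd \<zeta>) ^ n = 1"
  obtain N where N: "\<And>m. m \<ge> N \<Longrightarrow> 1 / real ((Suc m)\<^sup>2) \<le> cmod (1 - (fst \<zeta> * snd \<zeta>) ^ m)"
    using assms(1) by (auto simp: generic_def eventually_sequentially)
  have "(fst \<zeta> * snd \<zeta>) ^ (n * N) = 1" by (simp only: power_mult eq power_one)
  moreover have "n * N \<ge> N" using assms(2) by simp
  ultimately have "1 / real ((Suc (n * N))\<^sup>2) \<le> 0" using N[of "n * N"] by simp
  moreover have "0 < 1 / real ((Suc (n * N))\<^sup>2)"
    by (intro divide_pos_pos) (simp_all del: of_nat_power)
  ultimately show False by linarith
qed

locale model =
  fixes lam :: real
  assumes lam: "0 < lam" "lam < 1"
begin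

text \<open>\<open>coef 0 = 0\<close> because division by zero gives zero, so all sums below start at \<open>n = 1\<close>.\<close>

definition coef :: "nat \<Rightarrow> real" where "coef n = lam ^ n / real n"

lemma coef_0 [simp]: "coef 0 = 0"
  by (simp add: coef_def)

lemma coef_bounds: "0 \<le> coef n" "coef n \<le> lam ^ n"
proof -
  show "0 \<le> coef n" using lam by (simp add: coef_def)
  have "lam ^ n / real n \<le> lam ^ n / 1" if "n > 0"
    using lam that by (intro divide_left_mono) auto
  then show "coef n \<le> lam ^ n" using lam by (cases "n = 0") (auto simp: coef_def)
qed

lemma summable_coef: "summable coef"
  by (rule summable_comparison_test'[of "\<lambda>n. lam ^ n"]) (use lam coef_bounds in \<open>auto intro: summable_geometric\<close>)

definition summand :: "nat \<Rightarrow> tfun" where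
  "summand n \<zeta> = of_real (coef n) * ((fst \<zeta> ^ n + snd \<zeta> ^ n)\<^sup>2 / (1 - fst \<zeta> ^ n * snd \<zeta> ^ n))"

definition F :: tfun where "F \<zeta> = (\<Sum>n. summand n \<zeta>)"

text \<open>The factor \<open>1 - lam\<close> cancels the contribution of the constants in the
  kernels, so that on the torus the modulus is exactly
  \<open>1 / |1 - lam z (cnj w)|\<close>.\<close>

definition G :: tfun where "G \<zeta> = of_real (1 - lam) * exp (- F \<zeta>)"

definition \<phi> :: tfun where "\<phi> \<zeta> = (snd \<zeta> - of_real lam * fst \<zeta>) * G \<zeta>"

lemma summand_measurable [measurable]:
  "f \<in> borel_measurable M \<Longrightarrow> g \<in> borel_measurable M \<Longrightarrow> (\<lambda>x. summand n (f x, g x)) \<in> borel_measurable M"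
  unfolding summand_def by simp

lemma F_measurable [measurable]:
  "f \<in> borel_measurable M \<Longrightarrow> g \<in> borel_measurable M \<Longrightarrow> (\<lambda>x. F (f x, g x)) \<in> borel_measurable M"
  unfolding F_def by measurable

lemma exp_measurable:
  "f \<in> borel_measurable M \<Longrightarrow> (\<lambda>x. exp (f x :: complex)) \<in> borel_measurable M"
  by (erule measurable_compose) (intro borel_measurable_continuous_onI continuous_intros)

lemma G_measurable':
  "f \<in> borel_measurable M \<Longrightarrow> g \<in> borel_measurable M \<Longrightarrow> (\<lambda>x. G (f x, g x)) \<in> borel_measurable M"
  unfolding G_def by (intro borel_measurable_times borel_measurable_const exp_measurable
      borel_measurable_uminus F_measurable)

lemma G_measurable [measurable]: "G \<in> borel_measurable torus"
  using G_measurable'[of fst torus snd] by simp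

lemma \<phi>_measurable [measurable]: "\<phi> \<in> borel_measurable torus"
  unfolding \<phi>_def[abs_def] by measurable

text \<open>For \<open>n > 0\<close> the denominator is at least \<open>1 - |z| |w|\<close>, since
  powers only shrink \<open>|z| |w|\<close>. The bound is geometric in \<open>n\<close>, which makes
  the series converge uniformly wherever \<open>|z| |w|\<close> stays away from 1.\<close>

lemma cmod_summand_le:
  assumes "cmod z < 1" "cmod w < 1"
  shows "cmod (summand n (z, w)) \<le> lam ^ n * (4 / (1 - cmod z * cmod w))"
proof (cases "n = 0")
  case True
  have "cmod z * cmod w < 1" using assms mult_strict_mono'[of "cmod z" 1 "cmod w" 1] by simp
  then show ?thesis using True by (simp add: summand_def)
next
  case False
  have zw: "cmod z * cmod w < 1" using assms mult_strict_mono'[of "cmod z" 1 "cmod w" 1] by simp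
  have "cmod (z ^ n + w ^ n) \<le> 1 + 1"
    by (intro order_trans[OF norm_triangle_ineq] add_mono) (use assms in \<open>auto simp: norm_power power_le_one\<close>)
  then have num: "(cmod (z ^ n + w ^ n))\<^sup>2 \<le> 4"
    using power_mono[of "cmod (z ^ n + w ^ n)" 2 2] by simp
  have "(cmod z * cmod w) ^ n \<le> (cmod z * cmod w) ^ 1"
    using False zw by (intro power_decreasing) auto
  then have den: "1 - cmod z * cmod w \<le> cmod (1 - z ^ n * w ^ n)"
    using norm_triangle_ineq2[of 1 "z ^ n * w ^ n"] by (simp add: norm_mult norm_power power_mult_distrib)
  have "cmod (summand n (z, w)) = coef n * ((cmod (z ^ n + w ^ n))\<^sup>2 / cmod (1 - z ^ n * w ^ n))"
    using coef_bounds by (simp add: summand_def norm_mult norm_divide norm_power)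
  also have "\<dots> \<le> lam ^ n * (4 / (1 - cmod z * cmod w))"
    using coef_bounds num den zw lam by (intro mult_mono frac_le) auto
  finally show ?thesis .
qed

lemma summable_summand_disc:
  assumes "cmod z < 1" "cmod w < 1"
  shows "summable (\<lambda>n. summand n (z, w))"
  by (rule summable_comparison_test'[OF summable_mult2[OF summable_geometric] cmod_summand_le[OF assms]])
     (use lam in auto)

lemma F_commute: "F (z, w) = F (w, z)"
  by (simp add: F_def summand_def add.commute mult.commute)

text \<open>The kernel bound \<open>- 2\<close> is summed with weights \<open>coef\<close>. A lower
  bound for the real part is all that boundedness of \<open>exp (- F)\<close> requires.\<close>

lemma Re_F_disc:
  assumes "cmod z < 1" "cmod w < 1"
  shows "- (2 * suminf coef) \<le> Re (F (z, w))"
proof -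
  have "(\<Sum>n. - (2 * coef n)) \<le> (\<Sum>n. Re (summand n (z, w)))"
  proof (rule suminf_le)
    show "- (2 * coef n) \<le> Re (summand n (z, w))" for n
    proof (cases "n = 0")
      case True
      then show ?thesis by (simp add: summand_def)
    next
      case False
      then have "- 2 \<le> Re ((z ^ n + w ^ n)\<^sup>2 / (1 - z ^ n * w ^ n))"
        using assms by (intro Re_kernel_ge) (auto simp: norm_power power_Suc_less_one power_less_one_iff)
      then have "coef n * - 2 \<le> coef n * Re ((z ^ n + w ^ n)\<^sup>2 / (1 - z ^ n * w ^ n))"
        by (intro mult_left_mono coef_bounds)
      moreover have "Re (summand n (z, w)) = coef n * Re ((z ^ n + w ^ n)\<^sup>2 / (1 - z ^ n * w ^ n))"
        by (simp only: summand_def fst_conv snd_conv times_complex.sel Re_complex_of_real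
            Im_complex_of_real mult_zero_left diff_zero)
      ultimately show ?thesis by simp
    qed
    show "summable (\<lambda>n. - (2 * coef n))" by (intro summable_minus summable_mult summable_coef)
    show "summable (\<lambda>n. Re (summand n (z, w)))"
      by (rule summable_Re[OF summable_summand_disc[OF assms]])
  qed
  also have "(\<Sum>n. Re (summand n (z, w))) = Re (F (z, w))"
    unfolding F_def by (rule Re_suminf[OF summable_summand_disc[OF assms], symmetric])
  finally show ?thesis
    by (simp add: suminf_minus[OF summable_mult[OF summable_coef]] suminf_mult[OF summable_coef])
qed

definition bound :: real where "bound = (1 - lam) * exp (2 * suminf coef)"

lemma cmod_G_disc:
  assumes "cmod z < 1" "cmod w < 1"
  shows "cmod (G (z, w)) \<le> bound"
  unfolding G_def bound_def norm_mult norm_of_real norm_exp_eq_Re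
  using Re_F_disc[OF assms] lam by (intro mult_mono) auto

text \<open>With \<open>w\<close> fixed inside the disc the denominators are bounded below on the
  whole disc of \<open>z\<close>, so the M-test works there at once. The other variable follows by
  \<open>F_commute\<close>.\<close>

lemma holomorphic_F:
  assumes "cmod w < 1"
  shows "(\<lambda>z. F (z, w)) holomorphic_on ball 0 1"
proof (rule holomorphic_uniform_sequence[of _ "\<lambda>n z. \<Sum>i<n. summand i (z, w)"])
  show "(\<lambda>z. \<Sum>i<n. summand i (z, w)) holomorphic_on ball 0 1" for n
  proof (intro holomorphic_intros)
    fix i
    have ne: "1 - z ^ i * w ^ i \<noteq> 0" if "z \<in> ball 0 1" "i \<noteq> 0" for z
    proof -
      have "cmod (z ^ i * w ^ i) < 1"
        using that assms mult_strict_mono'[of "cmod z ^ i" 1 "cmod w ^ i" 1]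
        by (simp add: norm_mult norm_power power_less_one_iff)
      then show ?thesis by (metis norm_one less_irrefl eq_iff_diff_eq_0)
    qed
    show "(\<lambda>z. summand i (z, w)) holomorphic_on ball 0 1"
    proof (cases "i = 0")
      case True
      then show ?thesis by (simp add: summand_def)
    next
      case False
      then show ?thesis unfolding summand_def fst_conv snd_conv by (intro holomorphic_intros) (use ne in auto)
    qed
  qed
  fix z0 :: complex assume "z0 \<in> ball 0 1"
  then obtain d where d: "d > 0" "cball z0 d \<subseteq> ball 0 1"
    by (meson open_ball open_contains_cball)
  have "uniform_limit (ball 0 1) (\<lambda>n z. \<Sum>i<n. summand i (z, w)) (\<lambda>z. F (z, w)) sequentially"
    unfolding F_def
  proof (rule Weierstrass_m_test)
    show "cmod (summand n (z, w)) \<le> lam ^ n * (4 / (1 - cmod w))" if "z \<in> ball 0 1" for n z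
    proof -
      have "cmod z * cmod w \<le> 1 * cmod w"
        using that by (intro mult_right_mono) auto
      then have "lam ^ n * (4 / (1 - cmod z * cmod w)) \<le> lam ^ n * (4 / (1 - cmod w))"
        using assms lam by (intro mult_left_mono divide_left_mono) auto
      then show ?thesis using cmod_summand_le[of z w n] that assms by simp
    qed
    show "summable (\<lambda>n. lam ^ n * (4 / (1 - cmod w)))"
      using lam by (intro summable_mult2 summable_geometric) simp
  qed
  then show "\<exists>d>0. cball z0 d \<subseteq> ball 0 1 \<and>
      uniform_limit (cball z0 d) (\<lambda>n z. \<Sum>i<n. summand i (z, w)) (\<lambda>z. F (z, w)) sequentially"
    using d uniform_limit_on_subset by blast
qed simp

lemma H_infty_\<phi>: "H_infty \<phi>"
  unfolding H_infty_def
proof (intro conjI exI allI impI)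
  fix z w :: complex assume zw: "cmod z < 1 \<and> cmod w < 1"
  have "cmod (w - of_real lam * z) \<le> cmod w + cmod (of_real lam * z)" by (rule norm_triangle_ineq4)
  also have "\<dots> \<le> 1 + 1 * 1"
    using zw lam by (simp only: norm_mult norm_of_real) (intro add_mono mult_mono, auto)
  finally show "cmod (\<phi> (z, w)) \<le> 2 * bound"
    using cmod_G_disc[of z w] zw unfolding \<phi>_def norm_mult by (intro mult_mono) auto
next
  fix w :: complex assume w: "cmod w < 1"
  show "(\<lambda>z. \<phi> (z, w)) holomorphic_on ball 0 1"
    unfolding \<phi>_def G_def fst_conv snd_conv by (intro holomorphic_intros holomorphic_F[OF w])
next
  fix z :: complex assume z: "cmod z < 1"
  show "(\<lambda>w. \<phi> (z, w)) holomorphic_on ball 0 1"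
    unfolding \<phi>_def G_def fst_conv snd_conv F_commute[of z]
    by (intro holomorphic_intros holomorphic_F[OF z])
qed

text \<open>Tannery's theorem along the radius: at a generic point the denominators decay no faster
  than \<open>1 / (n + 1)^2\<close>, uniformly in \<open>r\<close>, and \<open>lam ^ n\<close>
  dominates that.\<close>

lemma radial_F:
  assumes "generic \<zeta>"
  shows "summable (\<lambda>n. summand n \<zeta>)" (is ?summable)
    and "((\<lambda>r. F (of_real r * fst \<zeta>, of_real r * snd \<zeta>)) \<longlongrightarrow> F \<zeta>) (at_left 1)" (is ?lim)
proof -
  define u where "u = fst \<zeta> * snd \<zeta>"
  define t where "t r n = summand n (of_real r * fst \<zeta>, of_real r * snd \<zeta>)" for r n
  have mod: "cmod (fst \<zeta>) = 1" "cmod (snd \<zeta>) = 1"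
    using assms by (auto simp: generic_def unit_torus_def)
  then have u1: "cmod u = 1" by (simp add: u_def norm_mult)
  have den: "(of_real r * fst \<zeta>) ^ n * (of_real r * snd \<zeta>) ^ n = of_real ((r ^ n)\<^sup>2) * u ^ n" for r :: real and n
    by (simp add: u_def power_mult_distrib power2_eq_square mult_ac)
  have lim_t: "((\<lambda>r. t r n) \<longlongrightarrow> summand n \<zeta>) (at_left 1)" for n
  proof (cases "n = 0")
    case True
    then show ?thesis by (simp add: t_def summand_def)
  next
    case False
    have ne: "1 - fst \<zeta> ^ n * snd \<zeta> ^ n \<noteq> 0"
      using generic_power_neq_1[OF assms, of n] False by (simp add: power_mult_distrib)
    have "((\<lambda>r. t r n) \<longlongrightarrow> summand n (of_real 1 * fst \<zeta>, of_real 1 * snd \<zeta>)) (at_left 1)"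
      unfolding t_def summand_def fst_conv snd_conv
      by (intro tendsto_intros) (use ne in simp)
    then show ?thesis by simp
  qed
  have ev: "eventually (\<lambda>r::real. 0 < r \<and> r < 1) (at_left 1)"
    using eventually_at_left_real[of 0 "1::real"] by (auto elim!: eventually_mono)
  obtain N where N: "\<And>n. n \<ge> N \<Longrightarrow> 1 / real ((Suc n)\<^sup>2) \<le> cmod (1 - u ^ n)"
    using assms by (auto simp: generic_def eventually_sequentially u_def)
  \<comment> \<open>The 8 is 4 from the squared numerator times 2 from comparing the denominator
    with its boundary value.\<close>
  have t_le: "cmod (t r n) \<le> 8 * (lam ^ n * (real (Suc n))\<^sup>2)" if "n \<ge> N" "0 < r" "r < 1" for r n
  proof -
    have "cmod ((of_real r * fst \<zeta>) ^ n + (of_real r * snd \<zeta>) ^ n) \<le> 1 + 1"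
      using that mod by (intro order_trans[OF norm_triangle_ineq] add_mono)
        (auto simp: norm_power norm_mult power_le_one)
    then have num: "(cmod ((of_real r * fst \<zeta>) ^ n + (of_real r * snd \<zeta>) ^ n))\<^sup>2 \<le> 4"
      using power_mono[of _ 2 2] by fastforce
    have "1 / real ((Suc n)\<^sup>2) \<le> 2 * cmod (1 - of_real ((r ^ n)\<^sup>2) * u ^ n)"
      using N[OF that(1)] cmod_one_minus_scaled[of "u ^ n" "(r ^ n)\<^sup>2"] that u1
      by (simp add: norm_power power_le_one)
    then have den': "1 / (2 * (real (Suc n))\<^sup>2) \<le> cmod (1 - of_real ((r ^ n)\<^sup>2) * u ^ n)"
      by simp
    have "cmod (t r n) = coef n * ((cmod ((of_real r * fst \<zeta>) ^ n + (of_real r * snd \<zeta>) ^ n))\<^sup>2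
        / cmod (1 - of_real ((r ^ n)\<^sup>2) * u ^ n))"
      unfolding t_def summand_def fst_conv snd_conv den
      using coef_bounds by (simp only: norm_mult norm_divide norm_power norm_of_real abs_of_nonneg)
    also have "\<dots> \<le> lam ^ n * (4 / (1 / (2 * (real (Suc n))\<^sup>2)))"
      using coef_bounds num den' lam by (intro mult_mono frac_le) auto
    finally show ?thesis by simp
  qed
  have "eventually (\<lambda>(n, r). norm (t r n) \<le> 8 * (lam ^ n * (real (Suc n))\<^sup>2)) (at_top \<times>\<^sub>F at_left 1)"
    by (rule eventually_mono[OF eventually_prodI[OF eventually_ge_at_top[of N] ev]])
       (use t_le in \<open>simp add: split_beta del: of_nat_Suc\<close>)
  moreover have "summable (\<lambda>n. 8 * (lam ^ n * (real (Suc n))\<^sup>2))"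
  proof -
    \<comment> \<open>With \<open>lam = q^4\<close> the majorant is
      \<open>((n + 1) q^n)^2 (q^2)^n\<close>: a bounded sequence times a geometric one.\<close>
    define q where "q = sqrt (sqrt lam)"
    have q: "0 < q" "q < 1" using lam by (auto simp: q_def)
    have lam_q: "lam = q ^ 2 * q ^ 2" using lam by (simp add: q_def)
    have "(\<lambda>n. real n * q ^ n + q ^ n) \<longlonglongrightarrow> 0 + 0"
      using q powser_times_n_limit_0[of q] by (intro tendsto_add LIMSEQ_realpow_zero) auto
    then have "Bseq (\<lambda>n. real (Suc n) * q ^ n)"
      by (intro convergent_imp_Bseq convergentI[of _ "0 + 0"]) (simp add: algebra_simps)
    then obtain K where K: "\<And>n. \<bar>real (Suc n) * q ^ n\<bar> \<le> K"
      unfolding Bseq_def real_norm_def by blast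
    have "summable (\<lambda>n. lam ^ n * (real (Suc n))\<^sup>2)"
    proof (rule summable_comparison_test')
      show "summable (\<lambda>n. K\<^sup>2 * (q\<^sup>2) ^ n)"
        using q by (intro summable_mult summable_geometric) (simp add: power_less_one_iff)
      fix n
      have "\<bar>real (Suc n) * q ^ n\<bar>\<^sup>2 \<le> K\<^sup>2" by (intro power_mono K) simp
      then have "(real (Suc n) * q ^ n)\<^sup>2 * (q\<^sup>2) ^ n \<le> K\<^sup>2 * (q\<^sup>2) ^ n"
        by (intro mult_right_mono) auto
      moreover have "lam ^ n * (real (Suc n))\<^sup>2 = (real (Suc n) * q ^ n)\<^sup>2 * (q\<^sup>2) ^ n"
        unfolding lam_q by (simp add: power_mult_distrib power2_eq_square mult_ac)
      ultimately show "norm (lam ^ n * (real (Suc n))\<^sup>2) \<le> K\<^sup>2 * (q\<^sup>2) ^ n"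
        using lam by simp
    qed
    then show ?thesis by (rule summable_mult)
  qed
  ultimately have "summable (\<lambda>n. norm (summand n \<zeta>)) \<and> ((\<lambda>r. \<Sum>n. t r n) \<longlongrightarrow> (\<Sum>n. summand n \<zeta>)) (at_left 1)"
    using tannerys_theorem[of "\<lambda>n r. t r n", OF lim_t] by auto
  then have "summable (\<lambda>n. norm (summand n \<zeta>))" "((\<lambda>r. \<Sum>n. t r n) \<longlongrightarrow> (\<Sum>n. summand n \<zeta>)) (at_left 1)"
    by blast+
  then show ?summable ?lim
    by (auto intro: summable_norm_cancel simp: F_def t_def)
qed

text \<open>The formula for \<open>\<phi>\<close> also makes sense at generic torus points, since
  \<open>F\<close> converges there. Radial limits are then plain values, and
  \<open>bdry \<phi>\<close> can be replaced by \<open>\<phi>\<close>.\<close>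

lemma radial_phi:
  assumes "generic \<zeta>"
  shows "(radial \<phi> \<zeta> \<longlongrightarrow> \<phi> \<zeta>) (at_left 1)"
proof -
  have "((\<lambda>r. (of_real r * snd \<zeta> - of_real lam * (of_real r * fst \<zeta>)) *
      (of_real (1 - lam) * exp (- F (of_real r * fst \<zeta>, of_real r * snd \<zeta>))))
      \<longlongrightarrow> (of_real 1 * snd \<zeta> - of_real lam * (of_real 1 * fst \<zeta>)) * (of_real (1 - lam) * exp (- F \<zeta>))) (at_left 1)"
    by (intro tendsto_intros radial_F(2)[OF assms])
  then show ?thesis
    by (simp add: radial_def[abs_def] \<phi>_def G_def)
qed

lemma bdry_phi: "generic \<zeta> \<Longrightarrow> bdry \<phi> \<zeta> = \<phi> \<zeta>"
  unfolding bdry_def by (intro tendsto_Lim radial_phi) simp_all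

text \<open>By \<open>Re_kernel_torus\<close> the real part of \<open>F\<close> splits into two
  logarithmic series: the constants sum to \<open>ln (1 - lam)\<close>, the powers of
  \<open>lam z (cnj w)\<close> to \<open>ln |1 - lam z (cnj w)|\<close>.\<close>

lemma cmod_G_generic:
  assumes "generic \<zeta>"
  shows "cmod (G \<zeta>) = 1 / cmod (1 - of_real lam * (fst \<zeta> * cnj (snd \<zeta>)))"
proof -
  define v where "v = fst \<zeta> * cnj (snd \<zeta>)"
  have mod: "cmod (fst \<zeta>) = 1" "cmod (snd \<zeta>) = 1"
    using assms by (auto simp: generic_def unit_torus_def)
  then have v1: "cmod v = 1" by (simp add: v_def norm_mult)
  have lv: "cmod (- of_real lam * v) < 1"
    using lam v1 by (simp add: norm_mult)
  have ne: "1 - of_real lam * v \<noteq> 0"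
    using lv by (metis norm_one less_irrefl eq_iff_diff_eq_0 norm_minus_cancel mult_minus_left)
  have Re_summand: "Re (summand n \<zeta>) = - coef n + Re (- ((of_real lam * v) ^ n) / of_nat n)" for n
  proof (cases "n = 0")
    case True
    then show ?thesis by (simp add: summand_def)
  next
    case False
    have "Re (summand n \<zeta>) = coef n * Re ((fst \<zeta> ^ n + snd \<zeta> ^ n)\<^sup>2 / (1 - fst \<zeta> ^ n * snd \<zeta> ^ n))"
      by (simp only: summand_def times_complex.sel Re_complex_of_real
          Im_complex_of_real mult_zero_left diff_zero)
    also have "\<dots> = coef n * - (1 + Re (fst \<zeta> ^ n * cnj (snd \<zeta> ^ n)))"
      using generic_power_neq_1[OF assms, of n] False mod
      by (subst Re_kernel_torus) (simp_all add: norm_power power_mult_distrib)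
    also have "fst \<zeta> ^ n * cnj (snd \<zeta> ^ n) = v ^ n"
      by (simp add: v_def power_mult_distrib)
    also have "Re (- ((of_real lam * v) ^ n) / of_nat n) = - (coef n * Re (v ^ n))"
    proof -
      have "- ((of_real lam * v) ^ n) / of_nat n = of_real (- coef n) * v ^ n"
        by (simp add: coef_def power_mult_distrib)
      then show ?thesis
        by (simp only: times_complex.sel Re_complex_of_real Im_complex_of_real mult_zero_left diff_zero
            mult_minus_left)
    qed
    ultimately show ?thesis by (simp add: algebra_simps)
  qed
  have "(\<lambda>n. - ((of_real lam * v) ^ n) / of_nat n) sums ln (1 - of_real lam * v)"
    using Ln_series'[OF lv] by simp
  from sums_Re[OF this]
  have s1: "(\<lambda>n. Re (- ((of_real lam * v) ^ n) / of_nat n)) sums ln (cmod (1 - of_real lam * v))"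
    by (simp only: Re_Ln[OF ne])
  have s2: "(\<lambda>n. - coef n) sums ln (1 - lam)"
    using ln_series'[of "- lam"] lam by (simp add: coef_def)
  have "(\<lambda>n. Re (summand n \<zeta>)) sums (ln (1 - lam) + ln (cmod (1 - of_real lam * v)))"
    unfolding Re_summand by (rule sums_add[OF s2 s1])
  then have "Re (F \<zeta>) = ln (1 - lam) + ln (cmod (1 - of_real lam * v))"
    unfolding F_def using sums_Re[OF summable_sums[OF radial_F(1)[OF assms]]] sums_unique2 by blast
  then have "cmod (G \<zeta>) = (1 - lam) * exp (- (ln (1 - lam) + ln (cmod (1 - of_real lam * v))))"
    unfolding G_def norm_mult norm_of_real norm_exp_eq_Re using lam by simp
  also have "\<dots> = (1 - lam) * (inverse (1 - lam) * inverse (cmod (1 - of_real lam * v)))"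
    using lam ne by (simp add: exp_diff exp_minus divide_inverse)
  finally show ?thesis
    using lam by (simp add: v_def divide_inverse)
qed

lemma one_minus_neq_0:
  assumes "\<zeta> \<in> unit_torus"
  shows "1 - of_real lam * (fst \<zeta> * cnj (snd \<zeta>)) \<noteq> 0"
proof
  assume "1 - of_real lam * (fst \<zeta> * cnj (snd \<zeta>)) = 0"
  then have "cmod (of_real lam * (fst \<zeta> * cnj (snd \<zeta>))) = 1" by simp
  then show False using assms lam by (simp add: norm_mult unit_torusD)
qed

text \<open>Up to a unimodular factor this is the denominator in the modulus of \<open>G\<close>,
  which is why their product \<open>\<phi>\<close> is unimodular.\<close>

lemma linear_factor:
  assumes "\<zeta> \<in> unit_torus"
  shows "snd \<zeta> - of_real lam * fst \<zeta> = snd \<zeta> * (1 - of_real lam * (fst \<zeta> * cnj (snd \<zeta>)))"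
  using assms by (simp add: cnj_unit unit_torusD field_simps)

lemma cmod_phi_generic:
  assumes "generic \<zeta>"
  shows "cmod (\<phi> \<zeta>) = 1"
proof -
  have T: "\<zeta> \<in> unit_torus" using assms by (simp add: generic_def)
  show ?thesis
    using one_minus_neq_0[OF T] T
    by (simp add: \<phi>_def linear_factor norm_mult cmod_G_generic[OF assms] unit_torusD)
qed

lemma inner_function_phi: "inner_function \<phi>"
  unfolding inner_function_def
proof
  show "AE \<zeta> in torus. \<exists>c. cmod c = 1 \<and> (radial \<phi> \<zeta> \<longlongrightarrow> c) (at_left 1)"
    using AE_generic by eventually_elim (use radial_phi cmod_phi_generic in blast)
qed (rule H_infty_\<phi>)

text \<open>On the torus the kernels \<open>kfun lam j\<close> have the pole of \<open>1 / (w - lam z)\<close>, which the zero of \<open>\<phi>\<close> cancels.\<close>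

lemma phi_kfun:
  assumes "\<zeta> \<in> unit_torus"
  shows "\<phi> \<zeta> * kfun lam j \<zeta> = fst \<zeta> ^ j * G \<zeta>"
proof -
  define d where "d = 1 - of_real lam * (fst \<zeta> * cnj (snd \<zeta>))"
  have "d \<noteq> 0" unfolding d_def by (rule one_minus_neq_0[OF assms])
  have w: "snd \<zeta> * cnj (snd \<zeta>) = 1"
    using assms by (simp add: complex_norm_square[symmetric] unit_torusD)
  have "\<phi> \<zeta> = snd \<zeta> * d * G \<zeta>" "kfun lam j \<zeta> = fst \<zeta> ^ j * cnj (snd \<zeta>) / d"
    by (simp_all add: \<phi>_def linear_factor[OF assms] d_def kfun_def mult.assoc)
  then have "\<phi> \<zeta> * kfun lam j \<zeta> = (snd \<zeta> * cnj (snd \<zeta>)) * (fst \<zeta> ^ j * G \<zeta>) * (d / d)"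
    by simp
  then show ?thesis using \<open>d \<noteq> 0\<close> w by simp
qed

text \<open>After dilation the products in the denominators have modulus at most
  \<open>r^(2 n) < 1\<close>, so \<open>F\<close> and then its exponential are uniform limits of
  polynomials on the torus.\<close>

lemma G_scaled_H2:
  assumes r: "0 < r" "r < 1"
  shows "(\<lambda>\<zeta>. G (of_real r * fst \<zeta>, of_real r * snd \<zeta>)) \<in> H2"
proof (rule unif_polys_H2)
  have pw: "(\<lambda>\<zeta>. (of_real r * fst \<zeta>) ^ n) \<in> unif_polys" "(\<lambda>\<zeta>. (of_real r * snd \<zeta>) ^ n) \<in> unif_polys" for n
    by (intro unif_polys_power polys_unif polys_mult polys_const polys_fst polys_snd)+
  have S: "(\<lambda>\<zeta>. summand n (of_real r * fst \<zeta>, of_real r * snd \<zeta>)) \<in> unif_polys" for n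
  proof (cases "n = 0")
    case True
    then show ?thesis using polys_unif[OF polys_const[of 0]] by (simp add: summand_def)
  next
    case False
    have "(\<lambda>\<zeta>. 1 / (1 - (of_real r * fst \<zeta>) ^ n * (of_real r * snd \<zeta>) ^ n)) \<in> unif_polys"
    proof (rule unif_polys_geometric)
      show "(\<lambda>\<zeta>. (of_real r * fst \<zeta>) ^ n * (of_real r * snd \<zeta>) ^ n) \<in> unif_polys"
        by (intro unif_polys_mult pw)
      show "cmod ((of_real r * fst \<zeta>) ^ n * (of_real r * snd \<zeta>) ^ n) \<le> r ^ n * r ^ n"
        if "\<zeta> \<in> unit_torus" for \<zeta>
        using that r by (simp add: norm_mult norm_power unit_torusD)
      show "r ^ n * r ^ n < 1"
        using r False mult_strict_mono'[of "r ^ n" 1 "r ^ n" 1] by (simp add: power_less_one_iff)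
    qed
    then have "(\<lambda>\<zeta>. of_real (coef n) * (((of_real r * fst \<zeta>) ^ n + (of_real r * snd \<zeta>) ^ n)\<^sup>2 *
        (1 / (1 - (of_real r * fst \<zeta>) ^ n * (of_real r * snd \<zeta>) ^ n)))) \<in> unif_polys"
      by (intro unif_polys_mult unif_polys_power unif_polys_add pw polys_unif[OF polys_const])
    then show ?thesis by (simp add: summand_def)
  qed
  have "(\<lambda>\<zeta>. F (of_real r * fst \<zeta>, of_real r * snd \<zeta>)) \<in> unif_polys"
    unfolding F_def
  proof (rule unif_polys_suminf[OF S])
    show "cmod (summand n (of_real r * fst \<zeta>, of_real r * snd \<zeta>)) \<le> lam ^ n * (4 / (1 - r * r))"
      if "\<zeta> \<in> unit_torus" for n \<zeta>
      using cmod_summand_le[of "of_real r * fst \<zeta>" "of_real r * snd \<zeta>" n] that r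
      by (simp add: norm_mult unit_torusD)
    show "summable (\<lambda>n. lam ^ n * (4 / (1 - r * r)))"
      using lam by (intro summable_mult2 summable_geometric) simp
  qed
  then have "(\<lambda>\<zeta>. of_real (1 - lam) * exp (- 1 * F (of_real r * fst \<zeta>, of_real r * snd \<zeta>))) \<in> unif_polys"
    by (intro unif_polys_mult unif_polys_exp polys_unif[OF polys_const])
  then show "(\<lambda>\<zeta>. G (of_real r * fst \<zeta>, of_real r * snd \<zeta>)) \<in> unif_polys"
    by (simp add: G_def)
  show "(\<lambda>\<zeta>. G (of_real r * fst \<zeta>, of_real r * snd \<zeta>)) \<in> borel_measurable torus"
    by (rule G_measurable') measurable
qed

text \<open>The dilates share the bound \<open>bound\<close> and converge at generic points, so
  dominated convergence applies.\<close>

lemma G_H2: "G \<in> H2"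
  unfolding H2_def
proof (rule L2_closure_dominated[OF polys_L2 _ G_measurable])
  define r where "r n = 1 - 1 / real (Suc (Suc n))" for n
  have r: "0 < r n" "r n < 1" for n
    by (auto simp: r_def field_simps)
  show "(\<lambda>\<zeta>. G (of_real (r n) * fst \<zeta>, of_real (r n) * snd \<zeta>)) \<in> L2_closure polys" for n
    using G_scaled_H2[OF r] by (simp add: H2_def)
  show "AE \<zeta> in torus. cmod (G (of_real (r n) * fst \<zeta>, of_real (r n) * snd \<zeta>)) \<le> bound" for n
    using r[of n] by (intro eventually_mono[OF AE_unit_torus] cmod_G_disc)
      (simp_all add: norm_mult unit_torusD)
  have "(\<lambda>n. 1 / real (Suc (Suc n))) \<longlonglongrightarrow> 0"
    using LIMSEQ_Suc[OF LIMSEQ_inverse_real_of_nat] by (simp only: inverse_eq_divide)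
  from tendsto_diff[OF tendsto_const this]
  have "(\<lambda>n. 1 - 1 / real (Suc (Suc n))) \<longlonglongrightarrow> 1 - 0" .
  then have "filterlim r (at_left 1) sequentially"
    unfolding r_def[abs_def] filterlim_at using r by (auto simp: r_def)
  then show "AE \<zeta> in torus. (\<lambda>n. G (of_real (r n) * fst \<zeta>, of_real (r n) * snd \<zeta>)) \<longlonglongrightarrow> G \<zeta>"
  proof (intro eventually_mono[OF AE_generic])
    fix \<zeta> assume "generic \<zeta>"
    assume "filterlim r (at_left 1) sequentially"
    from filterlim_compose[OF radial_F(2)[OF \<open>generic \<zeta>\<close>] this]
    show "(\<lambda>n. G (of_real (r n) * fst \<zeta>, of_real (r n) * snd \<zeta>)) \<longlonglongrightarrow> G \<zeta>"
      unfolding G_def by (intro tendsto_intros)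
  qed
qed

end

section \<open>Inner products of square integrable functions\<close>

lemma L2_inner_integrable:
  assumes f: "f \<in> L2" and g: "g \<in> L2"
  shows "integrable torus (\<lambda>\<zeta>. f \<zeta> * cnj (g \<zeta>))"
proof (rule Bochner_Integration.integrable_bound)
  note [measurable] = L2_measurable[OF f] L2_measurable[OF g]
  show "integrable torus (\<lambda>\<zeta>. (cmod (f \<zeta>))\<^sup>2 + (cmod (g \<zeta>))\<^sup>2)"
    by (intro Bochner_Integration.integrable_add L2_integrable f g)
  show "(\<lambda>\<zeta>. f \<zeta> * cnj (g \<zeta>)) \<in> borel_measurable torus" by measurable
  have "norm (f \<zeta> * cnj (g \<zeta>)) \<le> norm ((cmod (f \<zeta>))\<^sup>2 + (cmod (g \<zeta>))\<^sup>2)" for \<zeta>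
  proof -
    have "0 \<le> (cmod (f \<zeta>) - cmod (g \<zeta>))\<^sup>2" "0 \<le> cmod (f \<zeta>) * cmod (g \<zeta>)" by simp_all
    then have "cmod (f \<zeta>) * cmod (g \<zeta>) \<le> (cmod (f \<zeta>))\<^sup>2 + (cmod (g \<zeta>))\<^sup>2"
      unfolding power2_diff by linarith
    then show ?thesis by (simp add: norm_mult)
  qed
  then show "AE \<zeta> in torus. norm (f \<zeta> * cnj (g \<zeta>)) \<le> norm ((cmod (f \<zeta>))\<^sup>2 + (cmod (g \<zeta>))\<^sup>2)"
    by simp
qed

lemma L2_inner_self: "L2_inner f f = of_real ((L2_norm f)\<^sup>2)"
  unfolding L2_inner_def L2_norm_square complex_norm_square[symmetric] by (rule integral_complex_of_real)

lemma L2_inner_add_left: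
  "f \<in> L2 \<Longrightarrow> g \<in> L2 \<Longrightarrow> h \<in> L2 \<Longrightarrow> L2_inner (\<lambda>\<zeta>. f \<zeta> + g \<zeta>) h = L2_inner f h + L2_inner g h"
  by (simp add: L2_inner_def distrib_right L2_inner_integrable)

lemma L2_inner_scale_left: "L2_inner (\<lambda>\<zeta>. c * f \<zeta>) h = c * L2_inner f h"
  by (simp add: L2_inner_def mult.assoc)

lemma L2_inner_commute: "L2_inner g f = cnj (L2_inner f g)"
  unfolding L2_inner_def by (simp add: mult.commute flip: Bochner_Integration.integral_cnj)

lemma L2_inner_add_right:
  "f \<in> L2 \<Longrightarrow> g \<in> L2 \<Longrightarrow> h \<in> L2 \<Longrightarrow> L2_inner h (\<lambda>\<zeta>. f \<zeta> + g \<zeta>) = L2_inner h f + L2_inner h g"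
  unfolding L2_inner_commute[of h] by (simp add: L2_inner_add_left)

lemma L2_inner_scale_right: "L2_inner h (\<lambda>\<zeta>. c * f \<zeta>) = cnj c * L2_inner h f"
  unfolding L2_inner_commute[of h] by (simp add: L2_inner_scale_left)

lemma L2_inner_zero [simp]: "L2_inner (\<lambda>_. 0) f = 0" "L2_inner f (\<lambda>_. 0) = 0"
  by (simp_all add: L2_inner_def)

lemma L2_norm_add_square:
  assumes "f \<in> L2" "g \<in> L2"
  shows "(L2_norm (\<lambda>\<zeta>. f \<zeta> + g \<zeta>))\<^sup>2 = (L2_norm f)\<^sup>2 + (L2_norm g)\<^sup>2 + 2 * Re (L2_inner f g)"
proof -
  have "complex_of_real ((L2_norm (\<lambda>\<zeta>. f \<zeta> + g \<zeta>))\<^sup>2)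
      = of_real ((L2_norm f)\<^sup>2) + of_real ((L2_norm g)\<^sup>2) + (L2_inner f g + cnj (L2_inner f g))"
    using assms
    by (simp only: L2_inner_self[symmetric] L2_inner_add_left L2_inner_add_right L2_add
        L2_inner_commute[of g f]) simp
  also have "\<dots> = of_real ((L2_norm f)\<^sup>2 + (L2_norm g)\<^sup>2 + 2 * Re (L2_inner f g))"
    by (simp add: complex_add_cnj)
  finally show ?thesis unfolding of_real_eq_iff .
qed

lemma abs_L2_norm_diff_le:
  assumes "f \<in> L2" "g \<in> L2"
  shows "\<bar>L2_norm f - L2_norm g\<bar> \<le> L2_norm (\<lambda>\<zeta>. f \<zeta> - g \<zeta>)"
  using L2_norm_add_le[OF L2_diff[OF assms] assms(2)]
    L2_norm_add_le[OF L2_diff[OF assms(2,1)] assms(1)] L2_norm_minus_commute[of f g] by simp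

lemma L2_norm_LIMSEQ:
  assumes "f \<in> L2" "\<And>n. g n \<in> L2" "(\<lambda>n. L2_norm (\<lambda>\<zeta>. f \<zeta> - g n \<zeta>)) \<longlonglongrightarrow> 0"
  shows "(\<lambda>n. L2_norm (g n)) \<longlonglongrightarrow> L2_norm f"
proof (rule LIM_zero_cancel, rule tendsto_rabs_zero_cancel, rule LIMSEQ_0_le[OF assms(3)])
  show "\<bar>L2_norm (g n) - L2_norm f\<bar> \<le> L2_norm (\<lambda>\<zeta>. f \<zeta> - g n \<zeta>)" for n
    using abs_L2_norm_diff_le[OF assms(1,2)] by (simp add: abs_minus_commute)
qed simp

text \<open>By Pythagoras each component is controlled by the sum, so the components of a convergent
  sequence are themselves Cauchy and \<open>L2_complete\<close> applies to both. Decompositions hold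
  only almost everywhere.\<close>

lemma orthogonal_sum_closed:
  assumes A: "L2_subspace A" and B: "L2_subspace B"
    and orth: "\<And>p q. p \<in> A \<Longrightarrow> q \<in> B \<Longrightarrow> L2_inner p q = 0"
    and f: "f \<in> L2_closure {g \<in> L2. \<exists>h\<in>L2_closure A. \<exists>k\<in>L2_closure B. AE \<zeta> in torus. g \<zeta> = h \<zeta> + k \<zeta>}"
  shows "\<exists>h\<in>L2_closure A. \<exists>k\<in>L2_closure B. AE \<zeta> in torus. f \<zeta> = h \<zeta> + k \<zeta>"
proof -
  note A' = L2_subspace_closure[OF A] and B' = L2_subspace_closure[OF B]
  have sub: "A \<subseteq> L2" "B \<subseteq> L2" using A B by (auto simp: L2_subspace_def)
  \<comment> \<open>Orthogonality is assumed only before taking closures; the norm inequalities pass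
    to the limit.\<close>
  have pyth: "L2_norm h \<le> L2_norm (\<lambda>\<zeta>. h \<zeta> + k \<zeta>) \<and> L2_norm k \<le> L2_norm (\<lambda>\<zeta>. h \<zeta> + k \<zeta>)"
    if h: "h \<in> L2_closure A" and k: "k \<in> L2_closure B" for h k
  proof -
    obtain p where p: "h \<in> L2" "\<And>n. p n \<in> A" "(\<lambda>n. L2_norm (\<lambda>\<zeta>. h \<zeta> - p n \<zeta>)) \<longlonglongrightarrow> 0"
      using L2_closureE[OF h] by blast
    obtain q where q: "k \<in> L2" "\<And>n. q n \<in> B" "(\<lambda>n. L2_norm (\<lambda>\<zeta>. k \<zeta> - q n \<zeta>)) \<longlonglongrightarrow> 0"
      using L2_closureE[OF k] by blast
    have L2: "p n \<in> L2" "q n \<in> L2" for n using p(2) q(2) sub by blast+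
    have sq: "(L2_norm (\<lambda>\<zeta>. p n \<zeta> + q n \<zeta>))\<^sup>2 = (L2_norm (p n))\<^sup>2 + (L2_norm (q n))\<^sup>2" for n
      using L2_norm_add_square[OF L2] orth[OF p(2) q(2)] by simp
    have le: "L2_norm (p n) \<le> L2_norm (\<lambda>\<zeta>. p n \<zeta> + q n \<zeta>)" "L2_norm (q n) \<le> L2_norm (\<lambda>\<zeta>. p n \<zeta> + q n \<zeta>)" for n
      by (rule power2_le_imp_le; simp add: sq)+
    have lim: "(\<lambda>n. L2_norm (\<lambda>\<zeta>. p n \<zeta> + q n \<zeta>)) \<longlonglongrightarrow> L2_norm (\<lambda>\<zeta>. h \<zeta> + k \<zeta>)"
      by (rule L2_norm_LIMSEQ[OF L2_add[OF p(1) q(1)] L2_add[OF L2] L2_LIMSEQ_add[OF p(1) L2(1) p(3) q(1) L2(2) q(3)]])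
    show ?thesis
      using LIMSEQ_le[OF L2_norm_LIMSEQ[OF p(1) L2(1) p(3)] lim]
        LIMSEQ_le[OF L2_norm_LIMSEQ[OF q(1) L2(2) q(3)] lim] le by blast
  qed
  define S where "S = {g \<in> L2. \<exists>h\<in>L2_closure A. \<exists>k\<in>L2_closure B. AE \<zeta> in torus. g \<zeta> = h \<zeta> + k \<zeta>}"
  have "f \<in> L2_closure S" using f by (simp only: S_def)
  then obtain g where f_L2: "f \<in> L2" and g_S: "\<And>n. g n \<in> S"
    and g_lim: "(\<lambda>n. L2_norm (\<lambda>\<zeta>. f \<zeta> - g n \<zeta>)) \<longlonglongrightarrow> 0"
    using L2_closureE by blast
  note g_sum = g_S[unfolded S_def]
  have g_L2: "g n \<in> L2" for n using g_sum by blast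
  have "\<forall>n. \<exists>h k. h \<in> L2_closure A \<and> k \<in> L2_closure B \<and> (AE \<zeta> in torus. g n \<zeta> = h \<zeta> + k \<zeta>)"
    using g_sum by blast
  then obtain h k where h: "\<And>n. h n \<in> L2_closure A" and k: "\<And>n. k n \<in> L2_closure B"
    and hk: "\<And>n. AE \<zeta> in torus. g n \<zeta> = h n \<zeta> + k n \<zeta>"
    by metis
  note g = f_L2 g_L2 g_L2 g_lim
  note hL2 = L2_closure_L2[OF h] and kL2 = L2_closure_L2[OF k]
  note [measurable] = L2_measurable[OF hL2] L2_measurable[OF kL2] L2_measurable[OF g(2)] L2_measurable[OF g(1)]
  have diff_le: "L2_norm (\<lambda>\<zeta>. h m \<zeta> - h n \<zeta>) \<le> L2_norm (\<lambda>\<zeta>. f \<zeta> - g m \<zeta>) + L2_norm (\<lambda>\<zeta>. f \<zeta> - g n \<zeta>)"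
    "L2_norm (\<lambda>\<zeta>. k m \<zeta> - k n \<zeta>) \<le> L2_norm (\<lambda>\<zeta>. f \<zeta> - g m \<zeta>) + L2_norm (\<lambda>\<zeta>. f \<zeta> - g n \<zeta>)" for m n
  proof -
    have "(\<lambda>\<zeta>. h m \<zeta> + - 1 * h n \<zeta>) \<in> L2_closure A" "(\<lambda>\<zeta>. k m \<zeta> + - 1 * k n \<zeta>) \<in> L2_closure B"
      by (intro L2_subspaceD(2,3)[OF A'] L2_subspaceD(2,3)[OF B'] h k)+
    then have "L2_norm (\<lambda>\<zeta>. h m \<zeta> - h n \<zeta>) \<le> L2_norm (\<lambda>\<zeta>. (h m \<zeta> - h n \<zeta>) + (k m \<zeta> - k n \<zeta>)) \<and>
        L2_norm (\<lambda>\<zeta>. k m \<zeta> - k n \<zeta>) \<le> L2_norm (\<lambda>\<zeta>. (h m \<zeta> - h n \<zeta>) + (k m \<zeta> - k n \<zeta>))"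
      using pyth[of "\<lambda>\<zeta>. h m \<zeta> + - 1 * h n \<zeta>" "\<lambda>\<zeta>. k m \<zeta> + - 1 * k n \<zeta>"] by simp
    moreover have "L2_norm (\<lambda>\<zeta>. (h m \<zeta> - h n \<zeta>) + (k m \<zeta> - k n \<zeta>)) = L2_norm (\<lambda>\<zeta>. g m \<zeta> - g n \<zeta>)"
    proof (rule L2_norm_cong_AE)
      show "AE \<zeta> in torus. cmod ((h m \<zeta> - h n \<zeta>) + (k m \<zeta> - k n \<zeta>)) = cmod (g m \<zeta> - g n \<zeta>)"
        using hk[of m] hk[of n] by eventually_elim (simp add: algebra_simps)
    qed measurable
    moreover have "L2_norm (\<lambda>\<zeta>. g m \<zeta> - g n \<zeta>) \<le> L2_norm (\<lambda>\<zeta>. f \<zeta> - g m \<zeta>) + L2_norm (\<lambda>\<zeta>. f \<zeta> - g n \<zeta>)"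
      using L2_norm_diff_triangle[OF g(2) g(1) g(2), of m n] by (simp add: L2_norm_minus_commute[of f "g m"])
    ultimately show "L2_norm (\<lambda>\<zeta>. h m \<zeta> - h n \<zeta>) \<le> L2_norm (\<lambda>\<zeta>. f \<zeta> - g m \<zeta>) + L2_norm (\<lambda>\<zeta>. f \<zeta> - g n \<zeta>)"
      "L2_norm (\<lambda>\<zeta>. k m \<zeta> - k n \<zeta>) \<le> L2_norm (\<lambda>\<zeta>. f \<zeta> - g m \<zeta>) + L2_norm (\<lambda>\<zeta>. f \<zeta> - g n \<zeta>)"
      by linarith+
  qed
  have Cauchy: "\<exists>N. \<forall>m\<ge>N. \<forall>n\<ge>N. L2_norm (\<lambda>\<zeta>. f \<zeta> - g m \<zeta>) + L2_norm (\<lambda>\<zeta>. f \<zeta> - g n \<zeta>) < e" if "e > 0" for e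
  proof -
    have "e / 2 > 0" using that by simp
    from LIMSEQ_D[OF g(4) this] obtain N
      where "\<And>n. n \<ge> N \<Longrightarrow> norm (L2_norm (\<lambda>\<zeta>. f \<zeta> - g n \<zeta>) - 0) < e / 2"
      by blast
    then have small: "L2_norm (\<lambda>\<zeta>. f \<zeta> - g n \<zeta>) < e / 2" if "n \<ge> N" for n using that by simp
    have "L2_norm (\<lambda>\<zeta>. f \<zeta> - g m \<zeta>) + L2_norm (\<lambda>\<zeta>. f \<zeta> - g n \<zeta>) < e" if "m \<ge> N" "n \<ge> N" for m n
      using small[OF that(1)] small[OF that(2)] by linarith
    then show ?thesis by blast
  qed
  have "\<exists>N. \<forall>m\<ge>N. \<forall>n\<ge>N. L2_norm (\<lambda>\<zeta>. h m \<zeta> - h n \<zeta>) < e" if "e > 0" for e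
    using Cauchy[OF that] order_le_less_trans[OF diff_le(1)] by blast
  then obtain h' where h': "h' \<in> L2" "(\<lambda>n. L2_norm (\<lambda>\<zeta>. h n \<zeta> - h' \<zeta>)) \<longlonglongrightarrow> 0"
    by (rule L2_complete[OF hL2])
  have "\<exists>N. \<forall>m\<ge>N. \<forall>n\<ge>N. L2_norm (\<lambda>\<zeta>. k m \<zeta> - k n \<zeta>) < e" if "e > 0" for e
    using Cauchy[OF that] order_le_less_trans[OF diff_le(2)] by blast
  then obtain k' where k': "k' \<in> L2" "(\<lambda>n. L2_norm (\<lambda>\<zeta>. k n \<zeta> - k' \<zeta>)) \<longlonglongrightarrow> 0"
    by (rule L2_complete[OF kL2])
  note h'' = h'(2)[unfolded L2_norm_minus_commute[of "h _"]] and k'' = k'(2)[unfolded L2_norm_minus_commute[of "k _"]]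
  note [measurable] = L2_measurable[OF h'(1)] L2_measurable[OF k'(1)]
  have "h' \<in> L2_closure A" "k' \<in> L2_closure B"
    using L2_closureI[OF h'(1) h h''] L2_closureI[OF k'(1) k k''] L2_closure_closed sub by blast+
  moreover have "AE \<zeta> in torus. f \<zeta> = h' \<zeta> + k' \<zeta>"
  proof -
    have lim: "(\<lambda>n. L2_norm (\<lambda>\<zeta>. f \<zeta> - g n \<zeta>) + L2_norm (\<lambda>\<zeta>. h' \<zeta> + k' \<zeta> - (h n \<zeta> + k n \<zeta>))) \<longlonglongrightarrow> 0 + 0"
      by (intro tendsto_add g(4) L2_LIMSEQ_add[OF h'(1) hL2 h'' k'(1) kL2 k''])
    have "L2_norm (\<lambda>\<zeta>. f \<zeta> - (h' \<zeta> + k' \<zeta>))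
        \<le> L2_norm (\<lambda>\<zeta>. f \<zeta> - g n \<zeta>) + L2_norm (\<lambda>\<zeta>. h' \<zeta> + k' \<zeta> - (h n \<zeta> + k n \<zeta>))" for n
    proof -
      have "L2_norm (\<lambda>\<zeta>. f \<zeta> - (h' \<zeta> + k' \<zeta>))
        \<le> L2_norm (\<lambda>\<zeta>. f \<zeta> - g n \<zeta>) + L2_norm (\<lambda>\<zeta>. g n \<zeta> - (h' \<zeta> + k' \<zeta>))"
        by (intro L2_norm_diff_triangle g L2_add h' k')
      also have "L2_norm (\<lambda>\<zeta>. g n \<zeta> - (h' \<zeta> + k' \<zeta>)) = L2_norm (\<lambda>\<zeta>. h' \<zeta> + k' \<zeta> - (h n \<zeta> + k n \<zeta>))"
      proof (rule L2_norm_cong_AE)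
        show "AE \<zeta> in torus. cmod (g n \<zeta> - (h' \<zeta> + k' \<zeta>)) = cmod (h' \<zeta> + k' \<zeta> - (h n \<zeta> + k n \<zeta>))"
          using hk[of n] by eventually_elim (simp add: norm_minus_commute)
      qed measurable
      finally show ?thesis .
    qed
    then have "L2_norm (\<lambda>\<zeta>. f \<zeta> - (h' \<zeta> + k' \<zeta>)) \<le> 0 + 0"
      by (intro LIMSEQ_le_const[OF lim]) auto
    then have "L2_norm (\<lambda>\<zeta>. f \<zeta> - (h' \<zeta> + k' \<zeta>)) = 0"
      using L2_norm_nonneg[of "\<lambda>\<zeta>. f \<zeta> - (h' \<zeta> + k' \<zeta>)"] by linarith
    then have "AE \<zeta> in torus. f \<zeta> - (h' \<zeta> + k' \<zeta>) = 0"
      using L2_norm_eq_0_iff[OF L2_diff[OF g(1) L2_add[OF h'(1) k'(1)]]] by blast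
    then show ?thesis by eventually_elim simp
  qed
  ultimately show ?thesis by blast
qed

section \<open>Isometric extension\<close>

text \<open>The inductive form lets linear statements be proved by adding one multiple of a
  generator at a time. \<open>fspan_eq_sums\<close> links it to the finite sums in
  \<open>polys\<close> and \<open>closed_span\<close>.\<close>

inductive_set fspan :: "('i \<Rightarrow> tfun) \<Rightarrow> tfun set" for f where
  zero: "(\<lambda>_. 0) \<in> fspan f"
| step: "g \<in> fspan f \<Longrightarrow> (\<lambda>\<zeta>. g \<zeta> + c * f i \<zeta>) \<in> fspan f"

lemma fspan_base: "f i \<in> fspan f"
  using fspan.step[OF fspan.zero[of f], of 1 i] by simp

lemma fspan_add: "g \<in> fspan f \<Longrightarrow> h \<in> fspan f \<Longrightarrow> (\<lambda>\<zeta>. g \<zeta> + h \<zeta>) \<in> fspan f"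
proof (induction rule: fspan.induct)
  case (step g c i)
  then have "(\<lambda>\<zeta>. g \<zeta> + h \<zeta> + c * f i \<zeta>) \<in> fspan f" by (intro fspan.step) blast
  then show ?case by (simp add: add_ac)
qed simp

lemma fspan_scale: "g \<in> fspan f \<Longrightarrow> (\<lambda>\<zeta>. d * g \<zeta>) \<in> fspan f"
proof (induction rule: fspan.induct)
  case (step g c i)
  then show ?case using fspan.step[OF step.IH, of "d * c" i] by (simp add: algebra_simps)
qed (use fspan.zero in simp)

lemma fspan_subset:
  assumes A: "L2_subspace A" and "\<And>i. f i \<in> A"
  shows "fspan f \<subseteq> A"
proof
  fix g assume "g \<in> fspan f"
  then show "g \<in> A"
  proof induction
    case (step g c i)
    show ?case
      by (rule L2_subspaceD(2)[OF A step.IH L2_subspaceD(3)[OF A assms(2)]])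
  qed (rule L2_subspaceD(4)[OF A])
qed

lemma L2_subspace_L2: "L2_subspace L2"
  unfolding L2_subspace_def by (auto intro: L2_add L2_scale L2_bounded[where K = 0])

lemma L2_subspace_fspan: "(\<And>i. f i \<in> L2) \<Longrightarrow> L2_subspace (fspan f)"
  using fspan_subset[OF L2_subspace_L2, of f]
  by (simp add: L2_subspace_def fspan.zero fspan_add fspan_scale)

lemma fspan_eq_sums: "fspan f = {g. \<exists>F c. finite F \<and> g = (\<lambda>\<zeta>. \<Sum>j\<in>F. c j * f j \<zeta>)}"
proof (intro equalityI subsetI)
  fix g assume "g \<in> fspan f"
  then show "g \<in> {g. \<exists>F c. finite F \<and> g = (\<lambda>\<zeta>. \<Sum>j\<in>F. c j * f j \<zeta>)}"
  proof induction
    case zero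
    show ?case by (intro CollectI exI[of _ "{}"]) simp
  next
    case (step g c i)
    then obtain F d where F: "finite F" "g = (\<lambda>\<zeta>. \<Sum>j\<in>F. d j * f j \<zeta>)" by blast
    define d' where "d' j = (if j \<in> F then d j else 0) + (if j = i then c else 0)" for j
    have "(\<Sum>j\<in>insert i F. d' j * f j \<zeta>) = g \<zeta> + c * f i \<zeta>" for \<zeta>
    proof -
      have "(\<Sum>j\<in>insert i F. d' j * f j \<zeta>) = (\<Sum>j\<in>insert i F. (if j \<in> F then d j * f j \<zeta> else 0))
          + (\<Sum>j\<in>insert i F. (if j = i then c * f i \<zeta> else 0))"
        unfolding sum.distrib[symmetric] by (intro sum.cong) (auto simp: d'_def distrib_right)
      also have "(\<Sum>j\<in>insert i F. (if j \<in> F then d j * f j \<zeta> else 0)) = g \<zeta>"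
        using F by (simp add: sum.If_cases Int_absorb1 subset_insertI)
      finally show ?thesis using F by simp
    qed
    then show ?case using F(1) by (intro CollectI exI[of _ "insert i F"] exI[of _ d']) (auto simp: fun_eq_iff)
  qed
next
  fix g assume "g \<in> {g. \<exists>F c. finite F \<and> g = (\<lambda>\<zeta>. \<Sum>j\<in>F. c j * f j \<zeta>)}"
  then obtain F c where "finite F" and g: "g = (\<lambda>\<zeta>. \<Sum>j\<in>F. c j * f j \<zeta>)" by blast
  from this(1) have "(\<lambda>\<zeta>. \<Sum>j\<in>F. c j * f j \<zeta>) \<in> fspan f"
  proof induction
    case empty
    show ?case by (simp add: fspan.zero)
  next
    case (insert i F)
    then have "(\<lambda>\<zeta>. (\<Sum>j\<in>F. c j * f j \<zeta>) + c i * f i \<zeta>) \<in> fspan f"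
      by (intro fspan.step)
    with insert show ?case by (simp add: add.commute)
  qed
  then show "g \<in> fspan f" by (simp add: g)
qed

text \<open>Families with equal Gram matrices. Density is assumed on the Hilbert space side only, so
  the isometry is total and its image is the closure of the span of \<open>f\<close>.\<close>

locale gram_pair =
  fixes v :: "'i \<Rightarrow> 'a::chilbert_space" and f :: "'i \<Rightarrow> tfun"
  assumes f_L2: "f i \<in> L2" and gram_eq: "cinner (v i) (v j) = L2_inner (f i) (f j)"
    and dense_v: "closure (cvec.span (range v)) = UNIV"
begin

text \<open>The isometry sending \<open>v i\<close> to \<open>f i\<close> is extended by closing its graph: values are functions, not classes
  of functions, so it becomes a map only after a choice of representatives.\<close>

inductive_set graph0 :: "('a \<times> tfun) set" where
  zero: "(0, \<lambda>_. 0) \<in> graph0"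
| step: "(x, g) \<in> graph0 \<Longrightarrow> (x + c *\<^sub>C v i, \<lambda>\<zeta>. g \<zeta> + c * f i \<zeta>) \<in> graph0"

definition graph :: "('a \<times> tfun) set" where
  "graph = {(x, g). g \<in> L2 \<and> (\<forall>e>0. \<exists>y h. (y, h) \<in> graph0 \<and> norm (x - y) < e \<and> L2_norm (\<lambda>\<zeta>. g \<zeta> - h \<zeta>) < e)}"

lemma graph0_fspan: "(x, g) \<in> graph0 \<Longrightarrow> g \<in> fspan f"
  by (induction rule: graph0.induct) (auto intro: fspan.intros)

lemma graph0_L2: "(x, g) \<in> graph0 \<Longrightarrow> g \<in> L2"
  using graph0_fspan fspan_subset[of L2 f, OF L2_subspace_L2 f_L2] by blast

lemma graph0_add: "(x, g) \<in> graph0 \<Longrightarrow> (y, h) \<in> graph0 \<Longrightarrow> (x + y, \<lambda>\<zeta>. g \<zeta> + h \<zeta>) \<in> graph0"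
proof (induction rule: graph0.induct)
  case (step x g c i)
  then show ?case using graph0.step[OF step.IH, of c i] by (simp add: add_ac)
qed simp

lemma graph0_scale: "(x, g) \<in> graph0 \<Longrightarrow> (d *\<^sub>C x, \<lambda>\<zeta>. d * g \<zeta>) \<in> graph0"
proof (induction rule: graph0.induct)
  case (step x g c i)
  then show ?case using graph0.step[OF step.IH, of "d * c" i]
    by (simp add: scaleC_add_right scaleC_scaleC algebra_simps)
qed (simp add: graph0.zero)

text \<open>Equality of Gram matrices extends to spans by sesquilinearity, with an inner induction
  for the second argument. It implies that a vector 0 can only be paired with a function of norm
  0.\<close>

lemma graph0_inner: "(x, g) \<in> graph0 \<Longrightarrow> (y, h) \<in> graph0 \<Longrightarrow> cinner x y = L2_inner g h"
proof (induction rule: graph0.induct)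
  case (step x g c i)
  have "cinner (v i) y = L2_inner (f i) h"
    using step(3)
  proof (induction rule: graph0.induct)
    case (step y h d j)
    then show ?case
      by (simp add: cinner_add_right cinner_scaleC_right L2_inner_add_right L2_inner_scale_right
          graph0_L2 f_L2 L2_scale gram_eq)
  qed simp
  with step show ?case
    by (simp add: cinner_add_left cinner_scaleC_left L2_inner_add_left L2_inner_scale_left
        graph0_L2[OF step(1)] graph0_L2[OF step(3)] f_L2 L2_scale)
qed simp

lemma graph0_norm: "(x, g) \<in> graph0 \<Longrightarrow> norm x = L2_norm g"
proof -
  assume g: "(x, g) \<in> graph0"
  have "(norm x)\<^sup>2 = (L2_norm g)\<^sup>2"
    using graph0_inner[OF g g] unfolding cinner_self L2_inner_self of_real_eq_iff .
  then show ?thesis by simp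
qed

lemma graph0_diff: "(x, g) \<in> graph0 \<Longrightarrow> (y, h) \<in> graph0 \<Longrightarrow> (x - y, \<lambda>\<zeta>. g \<zeta> - h \<zeta>) \<in> graph0"
  using graph0_add[OF _ graph0_scale[of y h "- 1"]] by (simp add: cvec.scale_minus_left)

lemma graph0_fst: "x \<in> cvec.span (range v) \<Longrightarrow> \<exists>g. (x, g) \<in> graph0"
proof (induction rule: cvec.span_induct_alt)
  case base
  then show ?case using graph0.zero by blast
next
  case (step c w y)
  then obtain i g where "w = v i" "(y, g) \<in> graph0" by blast
  then have "(y + c *\<^sub>C w, \<lambda>\<zeta>. g \<zeta> + c * f i \<zeta>) \<in> graph0" using graph0.step by simp
  then show ?case by (metis add.commute)
qed

lemma graph0_snd: "g \<in> fspan f \<Longrightarrow> \<exists>x. (x, g) \<in> graph0"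
  by (induction rule: fspan.induct) (use graph0.intros in blast)+

lemma graph_L2: "(x, g) \<in> graph \<Longrightarrow> g \<in> L2"
  by (simp add: graph_def)

lemma graphD:
  assumes "(x, g) \<in> graph" "e > 0"
  obtains y h where "(y, h) \<in> graph0" "norm (x - y) < e" "L2_norm (\<lambda>\<zeta>. g \<zeta> - h \<zeta>) < e"
  using assms unfolding graph_def by blast

lemma graph0_graph: "(x, g) \<in> graph0 \<Longrightarrow> (x, g) \<in> graph"
  unfolding graph_def using graph0_L2 by (fastforce intro!: exI[of _ x] exI[of _ g])

lemma graph_closed:
  assumes "g \<in> L2"
    and "\<And>e. e > 0 \<Longrightarrow> \<exists>y h. (y, h) \<in> graph \<and> norm (x - y) < e \<and> L2_norm (\<lambda>\<zeta>. g \<zeta> - h \<zeta>) < e"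
  shows "(x, g) \<in> graph"
  unfolding graph_def
proof (intro CollectI case_prodI conjI allI impI assms(1))
  fix e :: real assume "e > 0"
  then obtain y h where h: "(y, h) \<in> graph" "norm (x - y) < e / 2" "L2_norm (\<lambda>\<zeta>. g \<zeta> - h \<zeta>) < e / 2"
    using assms(2)[of "e / 2"] by auto
  obtain y' h' where h': "(y', h') \<in> graph0" "norm (y - y') < e / 2" "L2_norm (\<lambda>\<zeta>. h \<zeta> - h' \<zeta>) < e / 2"
    using graphD[OF h(1), of "e / 2"] \<open>e > 0\<close> by auto
  have "norm (x - y') < e"
    using norm_triangle_ineq[of "x - y" "y - y'"] h h' by simp
  moreover have "L2_norm (\<lambda>\<zeta>. g \<zeta> - h' \<zeta>) < e"
    using L2_norm_diff_triangle[OF assms(1) graph_L2[OF h(1)] graph0_L2[OF h'(1)]] h h' by simp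
  ultimately show "\<exists>y h. (y, h) \<in> graph0 \<and> norm (x - y) < e \<and> L2_norm (\<lambda>\<zeta>. g \<zeta> - h \<zeta>) < e"
    using h'(1) by blast
qed

lemma graph_add:
  assumes g: "(x, g) \<in> graph" and h: "(y, h) \<in> graph"
  shows "(x + y, \<lambda>\<zeta>. g \<zeta> + h \<zeta>) \<in> graph"
  unfolding graph_def
proof (intro CollectI case_prodI conjI allI impI)
  show "(\<lambda>\<zeta>. g \<zeta> + h \<zeta>) \<in> L2" by (intro L2_add graph_L2[OF g] graph_L2[OF h])
  fix e :: real assume "e > 0"
  then have "e / 2 > 0" by simp
  obtain x' g' where g': "(x', g') \<in> graph0" "norm (x - x') < e / 2" "L2_norm (\<lambda>\<zeta>. g \<zeta> - g' \<zeta>) < e / 2"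
    using graphD[OF g \<open>e / 2 > 0\<close>] by blast
  obtain y' h' where h': "(y', h') \<in> graph0" "norm (y - y') < e / 2" "L2_norm (\<lambda>\<zeta>. h \<zeta> - h' \<zeta>) < e / 2"
    using graphD[OF h \<open>e / 2 > 0\<close>] by blast
  have "norm (x + y - (x' + y')) < e"
    using norm_triangle_ineq[of "x - x'" "y - y'"] g'(2) h'(2) by (simp add: add_diff_add)
  moreover have "L2_norm (\<lambda>\<zeta>. g \<zeta> + h \<zeta> - (g' \<zeta> + h' \<zeta>)) < e"
    using L2_norm_add_le[OF L2_diff[OF graph_L2[OF g] graph0_L2[OF g'(1)]]
        L2_diff[OF graph_L2[OF h] graph0_L2[OF h'(1)]]] g'(3) h'(3) by (simp add: add_diff_add)
  ultimately show "\<exists>z k. (z, k) \<in> graph0 \<and> norm (x + y - z) < e \<and> L2_norm (\<lambda>\<zeta>. g \<zeta> + h \<zeta> - k \<zeta>) < e"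
    using graph0_add[OF g'(1) h'(1)] by blast
qed

lemma graph_scale:
  assumes g: "(x, g) \<in> graph"
  shows "(c *\<^sub>C x, \<lambda>\<zeta>. c * g \<zeta>) \<in> graph"
  unfolding graph_def
proof (intro CollectI case_prodI conjI allI impI)
  show "(\<lambda>\<zeta>. c * g \<zeta>) \<in> L2" by (intro L2_scale graph_L2[OF g])
  fix e :: real assume "e > 0"
  define d where "d = e / (cmod c + 1)"
  have "cmod c + 1 > 0" by (simp add: add_nonneg_pos)
  then have "d > 0" "d * (cmod c + 1) = e" using \<open>e > 0\<close> by (simp_all add: d_def)
  obtain y h where h: "(y, h) \<in> graph0" "norm (x - y) < d" "L2_norm (\<lambda>\<zeta>. g \<zeta> - h \<zeta>) < d"
    using graphD[OF g \<open>d > 0\<close>] by blast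
  have small: "cmod c * t < e" if "t < d" "0 \<le> t" for t
  proof -
    have "cmod c * t \<le> cmod c * d" using that by (intro mult_left_mono) auto
    also have "\<dots> < d * (cmod c + 1)" using \<open>d > 0\<close> by (simp add: algebra_simps)
    finally show ?thesis using \<open>d * (cmod c + 1) = e\<close> by simp
  qed
  have "norm (c *\<^sub>C x - c *\<^sub>C y) < e"
    using small[OF h(2)] by (simp add: norm_scaleC flip: cvec.scale_right_diff_distrib)
  moreover have "L2_norm (\<lambda>\<zeta>. c * g \<zeta> - c * h \<zeta>) < e"
    using small[OF h(3)] by (simp add: L2_norm_scale flip: right_diff_distrib)
  ultimately show "\<exists>z k. (z, k) \<in> graph0 \<and> norm (c *\<^sub>C x - z) < e \<and> L2_norm (\<lambda>\<zeta>. c * g \<zeta> - k \<zeta>) < e"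
    using graph0_scale[OF h(1), of c] by blast
qed

lemma graph_norm:
  assumes g: "(x, g) \<in> graph"
  shows "norm x = L2_norm g"
proof -
  have "\<bar>norm x - L2_norm g\<bar> \<le> e" if "e > 0" for e
  proof -
    obtain y h where h: "(y, h) \<in> graph0" "norm (x - y) < e / 2" "L2_norm (\<lambda>\<zeta>. g \<zeta> - h \<zeta>) < e / 2"
      using graphD[OF g, of "e / 2"] \<open>e > 0\<close> by auto
    have "\<bar>norm x - norm y\<bar> < e / 2"
      using norm_triangle_ineq3[of x y] h(2) by linarith
    moreover have "\<bar>L2_norm g - L2_norm h\<bar> < e / 2"
      using abs_L2_norm_diff_le[OF graph_L2[OF g] graph0_L2[OF h(1)]] h(3) by linarith
    ultimately show ?thesis using graph0_norm[OF h(1)] by linarith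
  qed
  then have "\<bar>norm x - L2_norm g\<bar> \<le> 0"
    by (metis dense_ge)
  then show ?thesis by simp
qed

text \<open>The difference of two partners of \<open>x\<close> is a partner of 0 and has norm 0.
  Equality almost everywhere is the only uniqueness available for functions.\<close>

lemma graph_unique:
  assumes g: "(x, g) \<in> graph" and h: "(x, h) \<in> graph"
  shows "AE \<zeta> in torus. g \<zeta> = h \<zeta>"
proof -
  have "(x + (- 1) *\<^sub>C x, \<lambda>\<zeta>. g \<zeta> + - 1 * h \<zeta>) \<in> graph"
    by (intro graph_add graph_scale g h)
  then have "(0, \<lambda>\<zeta>. g \<zeta> - h \<zeta>) \<in> graph" by (simp add: cvec.scale_minus_left)
  then have "L2_norm (\<lambda>\<zeta>. g \<zeta> - h \<zeta>) = 0" using graph_norm by fastforce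
  then have "AE \<zeta> in torus. g \<zeta> - h \<zeta> = 0"
    using L2_norm_eq_0_iff[OF L2_diff[OF graph_L2[OF g] graph_L2[OF h]]] by blast
  then show ?thesis by eventually_elim simp
qed

lemma graph_LIMSEQ:
  assumes XY: "\<And>n. (X n, Y n) \<in> graph0" and X: "X \<longlonglongrightarrow> x"
    and g: "g \<in> L2" "(\<lambda>n. L2_norm (\<lambda>\<zeta>. g \<zeta> - Y n \<zeta>)) \<longlonglongrightarrow> 0"
  shows "(x, g) \<in> graph"
proof (rule graph_closed[OF g(1)])
  fix e :: real assume "e > 0"
  have "eventually (\<lambda>n. norm (X n - x) < e \<and> norm (L2_norm (\<lambda>\<zeta>. g \<zeta> - Y n \<zeta>) - 0) < e) sequentially"
    using tendstoD[OF X \<open>e > 0\<close>] tendstoD[OF g(2) \<open>e > 0\<close>]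
    by eventually_elim (simp add: dist_norm)
  then obtain n where "norm (X n - x) < e" "norm (L2_norm (\<lambda>\<zeta>. g \<zeta> - Y n \<zeta>) - 0) < e"
    by (auto simp: eventually_sequentially)
  then show "\<exists>y h. (y, h) \<in> graph \<and> norm (x - y) < e \<and> L2_norm (\<lambda>\<zeta>. g \<zeta> - h \<zeta>) < e"
    using graph0_graph[OF XY[of n]]
    by (intro exI[of _ "X n"] exI[of _ "Y n"]) (simp add: norm_minus_commute)
qed

text \<open>Approximating vectors have partners that are Cauchy because norms agree, and
  \<open>L2_complete\<close> supplies the limit.\<close>

lemma graph_total: "\<exists>g. (x, g) \<in> graph"
proof -
  have "x \<in> closure (cvec.span (range v))" by (simp add: dense_v)
  then obtain X where X: "\<And>n. X n \<in> cvec.span (range v)" "X \<longlonglongrightarrow> x"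
    unfolding closure_sequential by blast
  obtain Y where Y: "\<And>n. (X n, Y n) \<in> graph0" using graph0_fst[OF X(1)] by metis
  have "Cauchy X" using X(2) by (rule LIMSEQ_imp_Cauchy)
  have "\<exists>N. \<forall>m\<ge>N. \<forall>n\<ge>N. L2_norm (\<lambda>\<zeta>. Y m \<zeta> - Y n \<zeta>) < e" if "e > 0" for e
    using CauchyD[OF \<open>Cauchy X\<close> that] graph0_norm[OF graph0_diff[OF Y Y]] by simp
  then obtain g where g: "g \<in> L2" "(\<lambda>n. L2_norm (\<lambda>\<zeta>. Y n \<zeta> - g \<zeta>)) \<longlonglongrightarrow> 0"
    by (rule L2_complete[OF graph0_L2[OF Y]])
  have "(x, g) \<in> graph"
    by (rule graph_LIMSEQ[OF Y X(2) g(1)]) (use g(2) in \<open>simp only: L2_norm_minus_commute[of g]\<close>)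
  then show ?thesis by blast
qed

text \<open>The mirror image of \<open>graph_total\<close>, now with completeness of the Hilbert
  space.\<close>

lemma graph_onto:
  assumes "g \<in> L2_closure (fspan f)"
  shows "\<exists>x. (x, g) \<in> graph"
proof -
  obtain Y where Y: "g \<in> L2" "\<And>n. Y n \<in> fspan f" "(\<lambda>n. L2_norm (\<lambda>\<zeta>. g \<zeta> - Y n \<zeta>)) \<longlonglongrightarrow> 0"
    using L2_closureE[OF assms] by blast
  obtain X where X: "\<And>n. (X n, Y n) \<in> graph0" using graph0_snd[OF Y(2)] by metis
  note YL2 = graph0_L2[OF X]
  have "Cauchy X"
  proof (rule CauchyI)
    fix e :: real assume "e > 0"
    then obtain N where N: "\<And>n. n \<ge> N \<Longrightarrow> norm (L2_norm (\<lambda>\<zeta>. g \<zeta> - Y n \<zeta>) - 0) < e / 2"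
      using LIMSEQ_D[OF Y(3), of "e / 2"] by auto
    show "\<exists>M. \<forall>m\<ge>M. \<forall>n\<ge>M. norm (X m - X n) < e"
    proof (intro exI[of _ N] allI impI)
      fix m n assume "N \<le> m" "N \<le> n"
      then have "L2_norm (\<lambda>\<zeta>. g \<zeta> - Y m \<zeta>) < e / 2" "L2_norm (\<lambda>\<zeta>. g \<zeta> - Y n \<zeta>) < e / 2"
        using N[of m] N[of n] by simp_all
      moreover have "norm (X m - X n) \<le> L2_norm (\<lambda>\<zeta>. g \<zeta> - Y m \<zeta>) + L2_norm (\<lambda>\<zeta>. g \<zeta> - Y n \<zeta>)"
        using L2_norm_diff_triangle[OF YL2 Y(1) YL2, of m n] graph0_norm[OF graph0_diff[OF X X], of m n]
        by (simp add: L2_norm_minus_commute[of "Y m" g])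
      ultimately show "norm (X m - X n) < e" by linarith
    qed
  qed
  then obtain x where x: "X \<longlonglongrightarrow> x" using Cauchy_convergent convergent_def by blast
  have "(x, g) \<in> graph" by (rule graph_LIMSEQ[OF X x Y(1,3)])
  then show ?thesis by blast
qed

lemma graph_in_closure:
  assumes "(x, g) \<in> graph"
  shows "g \<in> L2_closure (fspan f)"
  unfolding L2_closure_def mem_Collect_eq L2_dist_eq
  using graph_L2[OF assms] graphD[OF assms] graph0_fspan by metis

text \<open>Intertwining is checked on the generators, extends linearly to \<open>graph0\<close>,
  and reaches the closure because \<open>T\<close> and multiplication by \<open>b\<close> are both
  bounded.\<close>

lemma graph_intertwine:
  assumes T: "bounded_clinear T" and b: "b \<in> borel_measurable torus" "AE \<zeta> in torus. cmod (b \<zeta>) \<le> 1"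
    and gen: "\<And>i. (T (v i), \<lambda>\<zeta>. b \<zeta> * f i \<zeta>) \<in> graph" and g: "(x, g) \<in> graph"
  shows "(T x, \<lambda>\<zeta>. b \<zeta> * g \<zeta>) \<in> graph"
proof (rule graph_closed)
  show "(\<lambda>\<zeta>. b \<zeta> * g \<zeta>) \<in> L2" by (rule L2_mult[OF graph_L2[OF g] b])
  have gen0: "(T y, \<lambda>\<zeta>. b \<zeta> * h \<zeta>) \<in> graph" if "(y, h) \<in> graph0" for y h
    using that
  proof (induction rule: graph0.induct)
    case zero
    then show ?case using graph0_graph[OF graph0.zero] by (simp add: bounded_clinear_zero[OF T])
  next
    case (step y h c i)
    then have "(T y + c *\<^sub>C T (v i), \<lambda>\<zeta>. b \<zeta> * h \<zeta> + c * (b \<zeta> * f i \<zeta>)) \<in> graph"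
      by (intro graph_add graph_scale gen)
    then show ?case
      by (simp add: bounded_clinear_add[OF T] bounded_clinear_scaleC[OF T] algebra_simps)
  qed
  obtain K where K: "\<And>y. norm (T y) \<le> norm y * K" "K > 0"
    using bounded_linear.pos_bounded[OF bounded_clinear_linear[OF T]] by metis
  fix e :: real assume "e > 0"
  define d where "d = min e (e / K)"
  have "d > 0" using \<open>e > 0\<close> K(2) by (simp add: d_def)
  then obtain y h where h: "(y, h) \<in> graph0" "norm (x - y) < d" "L2_norm (\<lambda>\<zeta>. g \<zeta> - h \<zeta>) < d"
    using graphD[OF g] by metis
  have "norm (T x - T y) < e"
  proof -
    have "norm (T x - T y) \<le> norm (x - y) * K"
      using K(1)[of "x - y"] by (simp add: bounded_clinear_diff[OF T])
    also have "\<dots> < e / K * K"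
      using h(2) K(2) by (intro mult_strict_right_mono) (auto simp: d_def)
    finally show ?thesis using K(2) by simp
  qed
  moreover have "L2_norm (\<lambda>\<zeta>. b \<zeta> * g \<zeta> - b \<zeta> * h \<zeta>) < e"
  proof -
    have gh: "(\<lambda>\<zeta>. g \<zeta> - h \<zeta>) \<in> L2" by (intro L2_diff graph_L2[OF g] graph0_L2[OF h(1)])
    have "L2_norm (\<lambda>\<zeta>. b \<zeta> * (g \<zeta> - h \<zeta>)) \<le> L2_norm (\<lambda>\<zeta>. g \<zeta> - h \<zeta>)"
      using L2_norm_mult_le[OF gh b] by simp
    then show ?thesis using h(3) by (simp add: right_diff_distrib d_def)
  qed
  ultimately show "\<exists>y h. (y, h) \<in> graph \<and> norm (T x - y) < e \<and> L2_norm (\<lambda>\<zeta>. b \<zeta> * g \<zeta> - h \<zeta>) < e"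
    using gen0[OF h(1)] by blast
qed

end

section \<open>The model space\<close>

context model
begin

text \<open>The sum of the powers of \<open>lam z (cnj w)\<close>, that is, the analytic half of the
  Poisson kernel, which is \<open>q + cnj q - 1\<close>.\<close>

definition q :: tfun where "q \<zeta> = 1 / (1 - of_real lam * (fst \<zeta> * cnj (snd \<zeta>)))"

lemma q_measurable [measurable]: "q \<in> borel_measurable torus"
  unfolding q_def[abs_def] by measurable

lemma q_bound:
  assumes "\<zeta> \<in> unit_torus"
  shows "cmod (q \<zeta>) \<le> 1 / (1 - lam)"
proof -
  have "1 - lam \<le> cmod (1 - of_real lam * (fst \<zeta> * cnj (snd \<zeta>)))"
    using norm_triangle_ineq2[of 1 "of_real lam * (fst \<zeta> * cnj (snd \<zeta>))"] lam assms
    by (simp add: norm_mult unit_torusD)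
  then show ?thesis using lam by (simp add: q_def norm_divide frac_le)
qed

text \<open>The Fourier coefficient of \<open>q\<close> at \<open>(- k, - l)\<close>; only the pairs
  \<open>(- n, n)\<close> give a nonzero value.\<close>

definition J :: "int \<Rightarrow> int \<Rightarrow> complex" where "J k l = (\<integral>\<zeta>. tmono k l \<zeta> * q \<zeta> \<partial>torus)"

lemma integrable_tmono_q: "integrable torus (\<lambda>\<zeta>. tmono k l \<zeta> * q \<zeta>)"
proof (rule integrable_torus_bounded)
  show "(\<lambda>\<zeta>. tmono k l \<zeta> * q \<zeta>) \<in> borel_measurable torus" by measurable
  show "norm (tmono k l \<zeta> * q \<zeta>) \<le> 1 / (1 - lam)" if "\<zeta> \<in> unit_torus" for \<zeta>
    using q_bound[OF that] by (simp add: norm_mult cmod_tmono[OF that])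
qed

lemma integrable_tmono: "integrable torus (tmono k l)"
  by (rule integrable_torus_bounded[where K = 1]) (simp_all add: cmod_tmono)

lemma J_bound: "cmod (J k l) \<le> 1 / (1 - lam)"
proof -
  have "cmod (J k l) \<le> (\<integral>\<zeta>. cmod (tmono k l \<zeta> * q \<zeta>) \<partial>torus)"
    unfolding J_def by (rule integral_norm_bound)
  also have "\<dots> \<le> (\<integral>\<zeta>. 1 / (1 - lam) \<partial>torus)"
  proof (rule integral_mono_AE)
    show "AE \<zeta> in torus. cmod (tmono k l \<zeta> * q \<zeta>) \<le> 1 / (1 - lam)"
      using AE_unit_torus by eventually_elim (use q_bound in \<open>simp add: norm_mult cmod_tmono\<close>)
  qed (auto intro: integrable_norm integrable_tmono_q)
  also have "\<dots> = 1 / (1 - lam)" by (simp add: measure_torus_UNIV)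
  finally show ?thesis .
qed

text \<open>Multiply \<open>q = 1 + lam z (cnj w) q\<close> by a monomial and integrate.\<close>

lemma J_rec: "J k l = (if k = 0 \<and> l = 0 then 1 else 0) + of_real lam * J (k + 1) (l - 1)"
proof -
  have "J k l = (\<integral>\<zeta>. tmono k l \<zeta> + of_real lam * (tmono (k + 1) (l - 1) \<zeta> * q \<zeta>) \<partial>torus)"
    unfolding J_def
  proof (rule integral_cong_AE)
    show "AE \<zeta> in torus. tmono k l \<zeta> * q \<zeta> = tmono k l \<zeta> + of_real lam * (tmono (k + 1) (l - 1) \<zeta> * q \<zeta>)"
      using AE_unit_torus
    proof eventually_elim
      case (elim \<zeta>)
      have t: "tmono (k + 1) (l - 1) \<zeta> = tmono k l \<zeta> * (fst \<zeta> * cnj (snd \<zeta>))"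
        using elim by (simp add: tmono_def cnj_unit unit_torusD power_int_add power_int_diff field_simps)
      show ?case
        unfolding t using one_minus_neq_0[OF elim] by (simp add: q_def field_simps)
    qed
  qed measurable
  also have "\<dots> = (\<integral>\<zeta>. tmono k l \<zeta> \<partial>torus) + of_real lam * J (k + 1) (l - 1)"
    unfolding J_def
    by (subst Bochner_Integration.integral_add)
       (auto intro: integrable_tmono integrable_mult_right integrable_tmono_q)
  finally show ?thesis by (simp add: integral_tmono)
qed

text \<open>Unless \<open>(k, l) = (- n, n)\<close> for some \<open>n >= 0\<close>, the recursion
  \<open>J_rec\<close> never meets its inhomogeneous term, and each iteration gains a factor
  \<open>lam\<close> over the uniform bound.\<close>

lemma J_eq_0:
  assumes "\<not> (k = - l \<and> 0 \<le> l)"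
  shows "J k l = 0"
proof -
  have iter: "cmod (J k l) \<le> lam ^ n * (1 / (1 - lam))" for n
    using assms
  proof (induction n arbitrary: k l)
    case 0
    then show ?case using J_bound[of k l] by simp
  next
    case (Suc n)
    have "J k l = of_real lam * J (k + 1) (l - 1)"
      using J_rec[of k l] Suc.prems by auto
    then have "cmod (J k l) = lam * cmod (J (k + 1) (l - 1))"
      using lam by (simp add: norm_mult)
    also have "\<dots> \<le> lam * (lam ^ n * (1 / (1 - lam)))"
      using Suc.prems lam by (intro mult_left_mono Suc.IH) auto
    finally show ?case by simp
  qed
  have "(\<lambda>n. lam ^ n * (1 / (1 - lam))) \<longlonglongrightarrow> 0 * (1 / (1 - lam))"
    using lam by (intro tendsto_mult LIMSEQ_realpow_zero tendsto_const) auto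
  then have "cmod (J k l) \<le> 0 * (1 / (1 - lam))"
    using iter by (intro LIMSEQ_le_const) auto
  then show ?thesis by simp
qed

lemma J_diagonal: "J (- int n) (int n) = of_real (lam ^ n)"
proof (induction n)
  case 0
  show ?case using J_rec[of 0 0] by (simp add: J_eq_0)
next
  case (Suc n)
  show ?case using J_rec[of "- int (Suc n)" "int (Suc n)"] Suc by simp
qed

lemma integral_tmono_cnj_q: "(\<integral>\<zeta>. tmono k l \<zeta> * cnj (q \<zeta>) \<partial>torus) = cnj (J (- k) (- l))"
proof -
  have "(\<integral>\<zeta>. tmono k l \<zeta> * cnj (q \<zeta>) \<partial>torus) = (\<integral>\<zeta>. cnj (tmono (- k) (- l) \<zeta> * q \<zeta>) \<partial>torus)"
  proof (rule integral_cong_AE)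
    show "AE \<zeta> in torus. tmono k l \<zeta> * cnj (q \<zeta>) = cnj (tmono (- k) (- l) \<zeta> * q \<zeta>)"
      using AE_unit_torus by eventually_elim (simp add: cnj_tmono)
  qed measurable
  also have "\<dots> = cnj (J (- k) (- l))" unfolding J_def by (rule Bochner_Integration.integral_cnj)
  finally show ?thesis .
qed

text \<open>The constant is the square root of the numerator \<open>1 - lam^2\<close> of the Poisson
  kernel. It gives \<open>e\<close> norm 1, matching the unit vector \<open>x\<close>.\<close>

definition e :: tfun where "e \<zeta> = of_real (sqrt (1 - lam\<^sup>2)) * G \<zeta>"

definition fm :: "nat \<times> nat \<Rightarrow> tfun" where "fm i \<zeta> = fst \<zeta> ^ fst i * snd \<zeta> ^ snd i * e \<zeta>"

lemma fm_H2: "fm i \<in> H2"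
proof -
  have "(\<lambda>\<zeta>. of_real (sqrt (1 - lam\<^sup>2)) * fst \<zeta> ^ fst i * snd \<zeta> ^ snd i * G \<zeta>) \<in> H2"
    by (intro H2_mult_polys polys_monom G_H2)
  then show ?thesis unfolding fm_def[abs_def] e_def by (simp add: mult_ac)
qed

lemma fm_L2: "fm i \<in> L2"
  using fm_H2 by (rule L2_subspaceD(1)[OF L2_subspace_H2])

text \<open>The right-hand side is the Poisson kernel of \<open>lam z (cnj w)\<close>.\<close>

lemma e_square:
  assumes "generic \<zeta>"
  shows "e \<zeta> * cnj (e \<zeta>) = q \<zeta> + cnj (q \<zeta>) - 1"
proof -
  have T: "\<zeta> \<in> unit_torus" using assms by (simp add: generic_def)
  define x where "x = of_real lam * (fst \<zeta> * cnj (snd \<zeta>))"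
  have x: "1 - x \<noteq> 0" unfolding x_def by (rule one_minus_neq_0[OF T])
  then have x': "1 - cnj x \<noteq> 0" by (metis complex_cnj_cancel_iff complex_cnj_diff complex_cnj_one complex_cnj_zero)
  have xx: "x * cnj x = of_real (lam\<^sup>2)"
  proof -
    have "cmod x = lam" using T lam by (simp add: x_def norm_mult unit_torusD)
    then show ?thesis using complex_norm_square[of x] by simp
  qed
  have "e \<zeta> * cnj (e \<zeta>) = of_real ((cmod (e \<zeta>))\<^sup>2)"
    by (rule complex_norm_square[symmetric])
  also have "(cmod (e \<zeta>))\<^sup>2 = (1 - lam\<^sup>2) / (cmod (1 - x))\<^sup>2"
  proof -
    have "lam\<^sup>2 \<le> 1" using lam by (simp add: power_le_one)
    then show ?thesis
      by (simp add: e_def norm_mult power_mult_distrib cmod_G_generic[OF assms] x_def power_divide)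
  qed
  also have "of_real ((1 - lam\<^sup>2) / (cmod (1 - x))\<^sup>2) = (1 - x * cnj x) / ((1 - x) * cnj (1 - x))"
    unfolding xx complex_norm_square[of "1 - x", symmetric] by simp
  also have "\<dots> = 1 / (1 - x) + 1 / (1 - cnj x) - 1"
    using x x' by (simp add: divide_simps) (simp add: algebra_simps)
  finally show ?thesis by (simp add: q_def x_def)
qed

text \<open>The monomials combine to \<open>tmono k l\<close>, integrated against
  \<open>q + cnj q - 1\<close>. Off the line \<open>l = - k\<close> everything vanishes; on it one
  of \<open>q\<close>, \<open>cnj q\<close> gives the power of \<open>lam\<close>, except at
  \<open>k = 0\<close>, where both give 1 and the \<open>- 1\<close> corrects.\<close>

lemma inner_fm:
  "L2_inner (fm (a, b)) (fm (c, d)) =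
     (if a + b = c + d then of_real (lam ^ (if c \<le> a then a - c else c - a)) else 0)"
proof -
  define k l where "k = int a - int c" and "l = int b - int d"
  have "L2_inner (fm (a, b)) (fm (c, d))
      = (\<integral>\<zeta>. tmono k l \<zeta> * q \<zeta> + tmono k l \<zeta> * cnj (q \<zeta>) - tmono k l \<zeta> \<partial>torus)"
    unfolding L2_inner_def
  proof (rule integral_cong_AE)
    note [measurable] = L2_measurable[OF fm_L2]
    show "(\<lambda>\<zeta>. fm (a, b) \<zeta> * cnj (fm (c, d) \<zeta>)) \<in> borel_measurable torus" by measurable
    show "AE \<zeta> in torus. fm (a, b) \<zeta> * cnj (fm (c, d) \<zeta>)
        = tmono k l \<zeta> * q \<zeta> + tmono k l \<zeta> * cnj (q \<zeta>) - tmono k l \<zeta>"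
      using AE_generic
    proof eventually_elim
      case (elim \<zeta>)
      then have T: "\<zeta> \<in> unit_torus" by (simp add: generic_def)
      have "fm (a, b) \<zeta> * cnj (fm (c, d) \<zeta>)
          = (tmono (int a) (int b) \<zeta> * cnj (tmono (int c) (int d) \<zeta>)) * (e \<zeta> * cnj (e \<zeta>))"
        by (simp add: fm_def tmono_def mult_ac)
      also have "tmono (int a) (int b) \<zeta> * cnj (tmono (int c) (int d) \<zeta>) = tmono k l \<zeta>"
        using T by (simp add: cnj_tmono tmono_mult k_def l_def)
      finally show ?case by (simp add: e_square[OF elim] algebra_simps)
    qed
  qed measurable
  also have "\<dots> = J k l + cnj (J (- k) (- l)) - (if k = 0 \<and> l = 0 then 1 else 0)"
  proof -
    have int: "integrable torus (\<lambda>\<zeta>. tmono k l \<zeta> * cnj (q \<zeta>))"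
    proof (rule integrable_torus_bounded)
      show "(\<lambda>\<zeta>. tmono k l \<zeta> * cnj (q \<zeta>)) \<in> borel_measurable torus" by measurable
      show "norm (tmono k l \<zeta> * cnj (q \<zeta>)) \<le> 1 / (1 - lam)" if "\<zeta> \<in> unit_torus" for \<zeta>
        using q_bound[OF that] by (simp add: norm_mult cmod_tmono[OF that])
    qed
    show ?thesis
      by (simp add: integrable_tmono_q integrable_tmono int integral_tmono integral_tmono_cnj_q flip: J_def)
  qed
  also have "\<dots> = (if a + b = c + d then of_real (lam ^ (if c \<le> a then a - c else c - a)) else 0)"
  proof (cases "a + b = c + d")
    case False
    then have "k \<noteq> - l" by (simp add: k_def l_def)
    then show ?thesis using False by (auto simp: J_eq_0)
  next
    case True
    then have kl: "l = - k" by (simp add: k_def l_def)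
    consider "a = c" | "c < a" | "a < c" by linarith
    then show ?thesis
    proof cases
      case 1
      then have "k = 0" "l = 0" using kl by (simp_all add: k_def)
      then show ?thesis using 1 True J_diagonal[of 0] by simp
    next
      case 2
      then have "k = int (a - c)" "l = - int (a - c)" "a - c > 0" using kl by (simp_all add: k_def)
      then show ?thesis using 2 True J_diagonal[of "a - c"] by (simp add: J_eq_0)
    next
      case 3
      then have "k = - int (c - a)" "l = int (c - a)" "c - a > 0" using kl by (simp_all add: k_def)
      then show ?thesis using 3 True J_diagonal[of "c - a"] by (simp add: J_eq_0)
    qed
  qed
  finally show ?thesis .
qed

lemma kfun_eq: "kfun lam j \<zeta> = fst \<zeta> ^ j * cnj (snd \<zeta>) * q \<zeta>"
  by (simp add: kfun_def q_def mult.assoc)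

lemma kfun_L2: "kfun lam j \<in> L2"
proof (rule L2_bounded)
  show "kfun lam j \<in> borel_measurable torus"
    unfolding kfun_eq[abs_def] by measurable
  show "cmod (kfun lam j \<zeta>) \<le> 1 / (1 - lam)" if "\<zeta> \<in> unit_torus" for \<zeta>
    using q_bound[OF that] that by (simp add: kfun_eq norm_mult norm_power unit_torusD)
qed

lemma closed_span_kfun: "closed_span (kfun lam) = L2_closure (fspan (kfun lam))"
  by (simp add: closed_span_def fspan_eq_sums)

lemma fspan_mult:
  assumes A: "L2_subspace A" and "\<And>i. (\<lambda>\<zeta>. b \<zeta> * f i \<zeta>) \<in> A" and "g \<in> fspan f"
  shows "(\<lambda>\<zeta>. b \<zeta> * g \<zeta>) \<in> A"
  using assms(3)
proof induction
  case zero
  then show ?case using L2_subspaceD(4)[OF A] by simp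
next
  case (step g c i)
  have "(\<lambda>\<zeta>. b \<zeta> * g \<zeta> + c * (b \<zeta> * f i \<zeta>)) \<in> A"
    by (rule L2_subspaceD(2)[OF A step.IH L2_subspaceD(3)[OF A assms(2)]])
  then show ?case by (simp add: algebra_simps)
qed

definition mon :: "nat \<times> nat \<Rightarrow> tfun" where "mon i \<zeta> = fst \<zeta> ^ fst i * snd \<zeta> ^ snd i"

lemma polys_eq_fspan: "polys = fspan mon"
  unfolding polys_def fspan_eq_sums mon_def by (simp add: split_beta mult.assoc)

text \<open>The Fourier exponents of \<open>kfun lam j\<close> in \<open>w\<close> are all negative
  because of the factor \<open>cnj w\<close>, while polynomials have nonnegative ones.\<close>

lemma polys_orthogonal_kfun:
  assumes "p \<in> polys" "g \<in> fspan (kfun lam)"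
  shows "L2_inner p g = 0"
proof -
  have mon_L2: "mon i \<in> L2" for i
    using polys_L2 fspan_base[of mon i] by (auto simp: polys_eq_fspan)
  have base: "L2_inner (mon i) (kfun lam j) = 0" for i j
  proof -
    have "L2_inner (mon i) (kfun lam j)
        = (\<integral>\<zeta>. tmono (int (fst i) - int j) (int (snd i) + 1) \<zeta> * cnj (q \<zeta>) \<partial>torus)"
      unfolding L2_inner_def
    proof (rule integral_cong_AE)
      note [measurable] = L2_measurable[OF mon_L2] L2_measurable[OF kfun_L2]
      show "(\<lambda>\<zeta>. mon i \<zeta> * cnj (kfun lam j \<zeta>)) \<in> borel_measurable torus" by measurable
      show "AE \<zeta> in torus. mon i \<zeta> * cnj (kfun lam j \<zeta>)
          = tmono (int (fst i) - int j) (int (snd i) + 1) \<zeta> * cnj (q \<zeta>)"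
        using AE_unit_torus
      proof eventually_elim
        case (elim \<zeta>)
        have "mon i \<zeta> * cnj (kfun lam j \<zeta>) = (tmono (int (fst i)) (int (snd i)) \<zeta> *
            (cnj (tmono (int j) 0 \<zeta>) * tmono 0 1 \<zeta>)) * cnj (q \<zeta>)"
          by (simp add: mon_def kfun_eq tmono_def mult_ac)
        also have "tmono (int (fst i)) (int (snd i)) \<zeta> * (cnj (tmono (int j) 0 \<zeta>) * tmono 0 1 \<zeta>)
            = tmono (int (fst i) - int j) (int (snd i) + 1) \<zeta>"
          using elim by (simp add: cnj_tmono tmono_mult)
        finally show ?case .
      qed
    qed measurable
    also have "\<dots> = 0" by (simp add: integral_tmono_cnj_q J_eq_0)
    finally show ?thesis .
  qed
  have g: "L2_inner (mon i) g = 0 \<and> g \<in> L2" for i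
    using assms(2)
  proof induction
    case (step g c j)
    then show ?case
      by (simp add: L2_inner_add_right L2_inner_scale_right mon_L2 kfun_L2 L2_scale L2_add base)
  qed (simp add: L2_subspaceD(4)[OF L2_subspace_L2])
  have "L2_inner p g = 0 \<and> p \<in> L2"
    using assms(1) unfolding polys_eq_fspan
  proof induction
    case (step p c i)
    then show ?case
      using g by (simp add: L2_inner_add_left L2_inner_scale_left mon_L2 L2_scale L2_add)
  qed (simp add: L2_subspaceD(4)[OF L2_subspace_L2])
  then show ?thesis by blast
qed

section \<open>The model space as the closed span of the functions \<open>fm\<close>\<close>

abbreviation "S \<equiv> S_space \<phi> lam"

abbreviation "FM \<equiv> fspan fm"

lemma L2_subspace_FM: "L2_subspace FM"
  by (rule L2_subspace_fspan[OF fm_L2])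

lemma FM_L2: "FM \<subseteq> L2"
  using L2_subspace_FM by (simp add: L2_subspace_def)

lemma L2_subspace_kfun: "L2_subspace (fspan (kfun lam))"
  by (rule L2_subspace_fspan[OF kfun_L2])

lemma S_iff:
  "f \<in> S \<longleftrightarrow> f \<in> L2 \<and> (\<exists>h\<in>H2. \<exists>k\<in>L2_closure (fspan (kfun lam)). AE \<zeta> in torus. f \<zeta> = \<phi> \<zeta> * (h \<zeta> + k \<zeta>))"
proof -
  have "(AE \<zeta> in torus. f \<zeta> = bdry \<phi> \<zeta> * (h \<zeta> + k \<zeta>)) \<longleftrightarrow> (AE \<zeta> in torus. f \<zeta> = \<phi> \<zeta> * (h \<zeta> + k \<zeta>))" for h k
  proof
    assume "AE \<zeta> in torus. f \<zeta> = bdry \<phi> \<zeta> * (h \<zeta> + k \<zeta>)"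
    then show "AE \<zeta> in torus. f \<zeta> = \<phi> \<zeta> * (h \<zeta> + k \<zeta>)"
      using AE_generic by eventually_elim (simp add: bdry_phi)
  next
    assume "AE \<zeta> in torus. f \<zeta> = \<phi> \<zeta> * (h \<zeta> + k \<zeta>)"
    then show "AE \<zeta> in torus. f \<zeta> = bdry \<phi> \<zeta> * (h \<zeta> + k \<zeta>)"
      using AE_generic by eventually_elim (simp add: bdry_phi)
  qed
  then show ?thesis by (simp add: S_space_def closed_span_kfun)
qed

lemma S_I:
  assumes "f \<in> L2" "h \<in> H2" "k \<in> L2_closure (fspan (kfun lam))"
    "AE \<zeta> in torus. f \<zeta> = \<phi> \<zeta> * (h \<zeta> + k \<zeta>)"
  shows "f \<in> S"
  unfolding S_iff using assms by blast

lemma S_E: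
  assumes "f \<in> S"
  obtains h k where "f \<in> L2" "h \<in> H2" "k \<in> L2_closure (fspan (kfun lam))"
    "AE \<zeta> in torus. f \<zeta> = \<phi> \<zeta> * (h \<zeta> + k \<zeta>)"
  using assms unfolding S_iff by blast

lemma kspan_L2: "fspan (kfun lam) \<subseteq> L2"
  using L2_subspace_kfun by (simp add: L2_subspace_def)

lemma AE_cmod_phi: "AE \<zeta> in torus. cmod (\<phi> \<zeta>) \<le> 1"
  by (rule eventually_mono[OF AE_generic]) (simp add: cmod_phi_generic)

lemma AE_cmod_cnj_phi: "AE \<zeta> in torus. cmod (cnj (\<phi> \<zeta>)) \<le> 1"
  using AE_cmod_phi by simp

lemma cnj_phi_phi: "generic \<zeta> \<Longrightarrow> cnj (\<phi> \<zeta>) * (\<phi> \<zeta> * t) = t"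
  using complex_norm_square[of "\<phi> \<zeta>"] cmod_phi_generic[of \<zeta>] by (simp add: mult_ac)

text \<open>Multiplication by \<open>cnj \<phi>\<close> undoes multiplication by the unimodular
  \<open>\<phi>\<close> and moves the question to the sum of \<open>H2\<close> and the closed kernel
  span, which is closed by orthogonality.\<close>

lemma S_closed: "L2_closure S \<subseteq> S"
proof
  fix f assume f: "f \<in> L2_closure S"
  define K where "K = {g \<in> L2. \<exists>h\<in>L2_closure polys. \<exists>k\<in>L2_closure (fspan (kfun lam)).
      AE \<zeta> in torus. g \<zeta> = h \<zeta> + k \<zeta>}"
  have cb: "(\<lambda>\<zeta>. cnj (\<phi> \<zeta>)) \<in> borel_measurable torus" by measurable
  have "(\<lambda>\<zeta>. cnj (\<phi> \<zeta>) * f \<zeta>) \<in> L2_closure K"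
  proof (rule L2_closure_mult[OF _ _ cb AE_cmod_cnj_phi _ f])
    show "S \<subseteq> L2" by (auto simp: S_iff)
    show K: "K \<subseteq> L2" by (auto simp: K_def)
    fix g assume g: "g \<in> S"
    then obtain h k where hk: "h \<in> H2" "k \<in> L2_closure (fspan (kfun lam))"
      "AE \<zeta> in torus. g \<zeta> = \<phi> \<zeta> * (h \<zeta> + k \<zeta>)" by (auto simp: S_iff)
    have "AE \<zeta> in torus. cnj (\<phi> \<zeta>) * g \<zeta> = h \<zeta> + k \<zeta>"
      using hk(3) AE_generic by eventually_elim (simp add: cnj_phi_phi)
    moreover have "(\<lambda>\<zeta>. cnj (\<phi> \<zeta>) * g \<zeta>) \<in> L2"
      using g by (intro L2_mult[OF _ cb AE_cmod_cnj_phi]) (simp add: S_iff)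
    ultimately have "(\<lambda>\<zeta>. cnj (\<phi> \<zeta>) * g \<zeta>) \<in> K"
      using hk(1,2) unfolding K_def H2_def by blast
    then show "(\<lambda>\<zeta>. cnj (\<phi> \<zeta>) * g \<zeta>) \<in> L2_closure K"
      using L2_closure_superset[OF K] by blast
  qed
  then have "\<exists>h\<in>L2_closure polys. \<exists>k\<in>L2_closure (fspan (kfun lam)).
      AE \<zeta> in torus. cnj (\<phi> \<zeta>) * f \<zeta> = h \<zeta> + k \<zeta>"
    unfolding K_def
    by (rule orthogonal_sum_closed[OF L2_subspace_polys L2_subspace_kfun, rotated])
       (rule polys_orthogonal_kfun)
  then obtain h k where hk: "h \<in> H2" "k \<in> L2_closure (fspan (kfun lam))"
    "AE \<zeta> in torus. cnj (\<phi> \<zeta>) * f \<zeta> = h \<zeta> + k \<zeta>" unfolding H2_def by blast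
  have "AE \<zeta> in torus. f \<zeta> = \<phi> \<zeta> * (h \<zeta> + k \<zeta>)"
    using hk(3) AE_generic
  proof eventually_elim
    case (elim \<zeta>)
    have "f \<zeta> = cnj (\<phi> \<zeta>) * (\<phi> \<zeta> * f \<zeta>)" by (simp only: cnj_phi_phi[OF elim(2)])
    then show ?case unfolding elim(1)[symmetric] by (simp add: mult_ac)
  qed
  then show "f \<in> S"
    using hk(1,2) L2_closure_L2[OF f] by (auto simp: S_iff)
qed

lemma L2_subspace_S: "L2_subspace S"
  unfolding L2_subspace_def
proof (intro conjI ballI allI)
  note A = L2_subspace_H2 and B = L2_subspace_closure[OF L2_subspace_kfun]
  show "S \<subseteq> L2" by (auto simp: S_iff)
  show "(\<lambda>_. 0) \<in> S"
    by (rule S_I[OF L2_subspaceD(4)[OF L2_subspace_L2] L2_subspaceD(4)[OF A] L2_subspaceD(4)[OF B]]) simp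
  fix f assume "f \<in> S"
  then obtain h k where f: "f \<in> L2" "h \<in> H2" "k \<in> L2_closure (fspan (kfun lam))"
    "AE \<zeta> in torus. f \<zeta> = \<phi> \<zeta> * (h \<zeta> + k \<zeta>)" by (rule S_E)
  show "(\<lambda>\<zeta>. f \<zeta> + g \<zeta>) \<in> S" if g_S: "g \<in> S" for g
  proof -
    obtain h' k' where g: "g \<in> L2" "h' \<in> H2" "k' \<in> L2_closure (fspan (kfun lam))"
      "AE \<zeta> in torus. g \<zeta> = \<phi> \<zeta> * (h' \<zeta> + k' \<zeta>)" using g_S by (rule S_E)
    show ?thesis
    proof (rule S_I[OF L2_add[OF f(1) g(1)] L2_subspaceD(2)[OF A f(2) g(2)] L2_subspaceD(2)[OF B f(3) g(3)]])
      show "AE \<zeta> in torus. f \<zeta> + g \<zeta> = \<phi> \<zeta> * ((h \<zeta> + h' \<zeta>) + (k \<zeta> + k' \<zeta>))"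
        using f(4) g(4) by eventually_elim (simp add: algebra_simps)
    qed
  qed
  show "(\<lambda>\<zeta>. c * f \<zeta>) \<in> S" for c
  proof (rule S_I[OF L2_scale[OF f(1)] L2_subspaceD(3)[OF A f(2)] L2_subspaceD(3)[OF B f(3)]])
    show "AE \<zeta> in torus. c * f \<zeta> = \<phi> \<zeta> * (c * h \<zeta> + c * k \<zeta>)"
      using f(4) by eventually_elim (simp add: algebra_simps)
  qed
qed

text \<open>Induction on the power of \<open>w\<close> through
  \<open>w G = \<phi> + lam z G\<close>; the power of \<open>z\<close> is arbitrary because the step
  raises it. For \<open>b = 0\<close> the function is \<open>\<phi>\<close> times a kernel.\<close>

lemma monomial_G_in_S: "(\<lambda>\<zeta>. fst \<zeta> ^ a * snd \<zeta> ^ b * G \<zeta>) \<in> S"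
proof (induction b arbitrary: a)
  case 0
  have "kfun lam a \<in> L2_closure (fspan (kfun lam))"
    by (rule subsetD[OF L2_closure_superset[OF kspan_L2] fspan_base])
  moreover have "AE \<zeta> in torus. fst \<zeta> ^ a * snd \<zeta> ^ 0 * G \<zeta> = \<phi> \<zeta> * (0 + kfun lam a \<zeta>)"
    using AE_unit_torus by eventually_elim (simp add: phi_kfun)
  moreover have "(\<lambda>\<zeta>. fst \<zeta> ^ a * snd \<zeta> ^ 0 * G \<zeta>) \<in> L2"
    using H2_mult_polys[OF polys_monom[of 1 a 0] G_H2] L2_subspaceD(1)[OF L2_subspace_H2] by simp
  ultimately show ?case
    by (intro S_I[OF _ L2_subspaceD(4)[OF L2_subspace_H2]])
next
  case (Suc b)
  have "(\<lambda>\<zeta>. fst \<zeta> ^ a * snd \<zeta> ^ b * \<phi> \<zeta>) \<in> S"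
  proof -
    have "(\<lambda>\<zeta>. 1 * fst \<zeta> ^ a * snd \<zeta> ^ b) \<in> polys" by (rule polys_monom)
    then have p: "(\<lambda>\<zeta>. fst \<zeta> ^ a * snd \<zeta> ^ b) \<in> polys" by simp
    have "(\<lambda>\<zeta>. \<phi> \<zeta> * (fst \<zeta> ^ a * snd \<zeta> ^ b)) \<in> L2"
      using p polys_L2 by (intro L2_mult[OF _ \<phi>_measurable AE_cmod_phi]) blast
    then have "(\<lambda>\<zeta>. fst \<zeta> ^ a * snd \<zeta> ^ b * \<phi> \<zeta>) \<in> L2" by (simp add: mult_ac)
    moreover have "(\<lambda>\<zeta>. fst \<zeta> ^ a * snd \<zeta> ^ b) \<in> H2" using p polys_H2 by blast
    moreover have "(\<lambda>_. 0) \<in> L2_closure (fspan (kfun lam))"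
      by (rule L2_subspaceD(4)[OF L2_subspace_closure[OF L2_subspace_kfun]])
    moreover have "AE \<zeta> in torus. fst \<zeta> ^ a * snd \<zeta> ^ b * \<phi> \<zeta> = \<phi> \<zeta> * (fst \<zeta> ^ a * snd \<zeta> ^ b + 0)"
      by (simp add: mult_ac)
    ultimately show ?thesis by (rule S_I)
  qed
  then have "(\<lambda>\<zeta>. fst \<zeta> ^ a * snd \<zeta> ^ b * \<phi> \<zeta> + of_real lam * (fst \<zeta> ^ Suc a * snd \<zeta> ^ b * G \<zeta>)) \<in> S"
    by (rule L2_subspaceD(2)[OF L2_subspace_S _ L2_subspaceD(3)[OF L2_subspace_S Suc.IH]])
  moreover have "(\<lambda>\<zeta>. fst \<zeta> ^ a * snd \<zeta> ^ b * \<phi> \<zeta> + of_real lam * (fst \<zeta> ^ Suc a * snd \<zeta> ^ b * G \<zeta>))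
      = (\<lambda>\<zeta>. fst \<zeta> ^ a * snd \<zeta> ^ Suc b * G \<zeta>)"
    by (rule ext) (simp add: \<phi>_def algebra_simps)
  ultimately show ?case by (simp only:)
qed

lemma fm_S: "fm i \<in> S"
  using L2_subspaceD(3)[OF L2_subspace_S monomial_G_in_S[of "fst i" "snd i"], of "of_real (sqrt (1 - lam\<^sup>2))"]
  by (simp add: fm_def[abs_def] e_def mult_ac)

lemma sqrt_pos: "0 < sqrt (1 - lam\<^sup>2)"
proof -
  have "lam\<^sup>2 < 1" using lam by (simp add: power_less_one_iff)
  then show ?thesis by simp
qed

lemma monomial_G_in_FM: "(\<lambda>\<zeta>. fst \<zeta> ^ a * snd \<zeta> ^ b * G \<zeta>) \<in> FM"
proof -
  define s where "s = complex_of_real (sqrt (1 - lam\<^sup>2))"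
  have "s \<noteq> 0" using sqrt_pos by (simp add: s_def)
  then have "(\<lambda>\<zeta>. inverse s * fm (a, b) \<zeta>) = (\<lambda>\<zeta>. fst \<zeta> ^ a * snd \<zeta> ^ b * G \<zeta>)"
    by (simp add: fun_eq_iff fm_def e_def flip: s_def)
  then show ?thesis
    using fspan_scale[OF fspan_base[of fm "(a, b)"], of "inverse s"] by (simp only:)
qed

text \<open>Conversely to \<open>monomial_G_in_S\<close>, \<open>\<phi>\<close> times a monomial is
  a combination of two monomials times \<open>G\<close>, and \<open>\<phi>\<close> times a kernel is
  almost everywhere a power of \<open>z\<close> times \<open>G\<close>.\<close>

lemma S_eq: "S = L2_closure FM"
proof
  have "FM \<subseteq> S" by (rule fspan_subset[OF L2_subspace_S fm_S])
  then have "L2_closure FM \<subseteq> L2_closure S"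
    unfolding L2_closure_def by blast
  then show "L2_closure FM \<subseteq> S" using S_closed by blast
  show "S \<subseteq> L2_closure FM"
  proof
    fix f assume "f \<in> S"
    then obtain h k where f: "f \<in> L2" and h: "h \<in> L2_closure (fspan mon)" and k: "k \<in> L2_closure (fspan (kfun lam))"
      and fhk: "AE \<zeta> in torus. f \<zeta> = \<phi> \<zeta> * (h \<zeta> + k \<zeta>)"
      by (auto simp: S_iff H2_def polys_eq_fspan)
    have "(\<lambda>\<zeta>. \<phi> \<zeta> * h \<zeta>) \<in> L2_closure FM"
    proof (rule L2_closure_mult[OF _ FM_L2 \<phi>_measurable AE_cmod_phi _ h])
      show "fspan mon \<subseteq> L2" using polys_L2 by (simp add: polys_eq_fspan)
      fix p assume p: "p \<in> fspan mon"
      have "(\<lambda>\<zeta>. \<phi> \<zeta> * p \<zeta>) \<in> FM"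
      proof (rule fspan_mult[OF L2_subspace_FM _ p])
        fix i
        have "(\<lambda>\<zeta>. fst \<zeta> ^ fst i * snd \<zeta> ^ Suc (snd i) * G \<zeta>
            + - of_real lam * (fst \<zeta> ^ Suc (fst i) * snd \<zeta> ^ snd i * G \<zeta>)) \<in> FM"
          by (intro fspan_add fspan_scale monomial_G_in_FM)
        then show "(\<lambda>\<zeta>. \<phi> \<zeta> * mon i \<zeta>) \<in> FM"
          by (simp add: \<phi>_def mon_def algebra_simps)
      qed
      then show "(\<lambda>\<zeta>. \<phi> \<zeta> * p \<zeta>) \<in> L2_closure FM" using L2_closure_superset[OF FM_L2] by blast
    qed
    moreover have "(\<lambda>\<zeta>. \<phi> \<zeta> * k \<zeta>) \<in> L2_closure FM"
    proof (rule L2_closure_mult[OF _ FM_L2 \<phi>_measurable AE_cmod_phi _ k])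
      show "fspan (kfun lam) \<subseteq> L2" by (rule kspan_L2)
      fix p assume p: "p \<in> fspan (kfun lam)"
      show "(\<lambda>\<zeta>. \<phi> \<zeta> * p \<zeta>) \<in> L2_closure FM"
      proof (rule fspan_mult[OF L2_subspace_closure[OF L2_subspace_FM] _ p])
        fix j
        have "(\<lambda>\<zeta>. fst \<zeta> ^ j * snd \<zeta> ^ 0 * G \<zeta>) \<in> L2_closure FM"
          using monomial_G_in_FM L2_closure_superset[OF FM_L2] by blast
        then show "(\<lambda>\<zeta>. \<phi> \<zeta> * kfun lam j \<zeta>) \<in> L2_closure FM"
        proof (rule L2_closure_cong_AE[OF _ FM_L2])
          show "(\<lambda>\<zeta>. \<phi> \<zeta> * kfun lam j \<zeta>) \<in> L2"
            by (rule L2_mult[OF kfun_L2 \<phi>_measurable AE_cmod_phi])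
          show "AE \<zeta> in torus. fst \<zeta> ^ j * snd \<zeta> ^ 0 * G \<zeta> = \<phi> \<zeta> * kfun lam j \<zeta>"
            using AE_unit_torus by eventually_elim (simp add: phi_kfun)
        qed
      qed
    qed
    ultimately have "(\<lambda>\<zeta>. \<phi> \<zeta> * h \<zeta> + \<phi> \<zeta> * k \<zeta>) \<in> L2_closure FM"
      by (rule L2_closure_add[OF L2_subspace_FM])
    then show "f \<in> L2_closure FM"
      by (rule L2_closure_cong_AE[OF _ FM_L2 f]) (use fhk in \<open>auto simp: distrib_left elim: eventually_mono\<close>)
  qed
qed

text \<open>Not visible from the definition, since the kernels are orthogonal to \<open>H2\<close>;
  the generators \<open>fm\<close>, however, are analytic.\<close>

lemma S_subset_H2: "S \<subseteq> H2"
proof -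
  have "FM \<subseteq> H2" by (rule fspan_subset[OF L2_subspace_H2 fm_H2])
  then have "L2_closure FM \<subseteq> L2_closure H2" unfolding L2_closure_def by blast
  then show ?thesis using L2_closure_closed[OF polys_L2] unfolding S_eq H2_def by blast
qed

lemma L2_closed_S: "L2_closed S"
  unfolding L2_closed_def using L2_subspace_S S_closed by (simp add: L2_subspace_def)

text \<open>On the generators \<open>fm\<close> both multiplications raise an exponent by
  one.\<close>

lemma S_invariant:
  assumes "f \<in> S"
  shows "(\<lambda>\<zeta>. fst \<zeta> * f \<zeta>) \<in> S" "(\<lambda>\<zeta>. snd \<zeta> * f \<zeta>) \<in> S"
proof -
  have bound: "AE \<zeta> in torus. cmod (fst \<zeta>) \<le> 1" "AE \<zeta> in torus. cmod (snd \<zeta>) \<le> 1"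
    by (rule eventually_mono[OF AE_unit_torus], simp add: unit_torusD)+
  have meas: "fst \<in> borel_measurable torus" "snd \<in> borel_measurable torus"
    by measurable
  have fm: "(\<lambda>\<zeta>. fst \<zeta> * fm i \<zeta>) \<in> FM" "(\<lambda>\<zeta>. snd \<zeta> * fm i \<zeta>) \<in> FM" for i
  proof -
    have "(\<lambda>\<zeta>. fst \<zeta> * fm i \<zeta>) = fm (Suc (fst i), snd i)"
      "(\<lambda>\<zeta>. snd \<zeta> * fm i \<zeta>) = fm (fst i, Suc (snd i))"
      by (simp_all add: fun_eq_iff fm_def mult_ac)
    then show "(\<lambda>\<zeta>. fst \<zeta> * fm i \<zeta>) \<in> FM" "(\<lambda>\<zeta>. snd \<zeta> * fm i \<zeta>) \<in> FM"
      by (simp_all only: fspan_base)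
  qed
  have f: "f \<in> L2_closure FM" using assms by (simp add: S_eq)
  show "(\<lambda>\<zeta>. fst \<zeta> * f \<zeta>) \<in> S" unfolding S_eq
  proof (rule L2_closure_mult[OF FM_L2 FM_L2 meas(1) bound(1) _ f])
    fix g assume "g \<in> FM"
    then show "(\<lambda>\<zeta>. fst \<zeta> * g \<zeta>) \<in> L2_closure FM"
      by (intro subsetD[OF L2_closure_superset[OF FM_L2]] fspan_mult[where f = fm, OF L2_subspace_FM fm(1)])
  qed
  show "(\<lambda>\<zeta>. snd \<zeta> * f \<zeta>) \<in> S" unfolding S_eq
  proof (rule L2_closure_mult[OF FM_L2 FM_L2 meas(2) bound(2) _ f])
    fix g assume "g \<in> FM"
    then show "(\<lambda>\<zeta>. snd \<zeta> * g \<zeta>) \<in> L2_closure FM"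
      by (intro subsetD[OF L2_closure_superset[OF FM_L2]] fspan_mult[where f = fm, OF L2_subspace_FM fm(2)])
  qed
qed

end

text \<open>\<open>U\<close> picks an arbitrary partner of each vector. Each required identity
  compares two partners of the same vector, hence holds almost everywhere by
  \<open>graph_unique\<close>.\<close>

lemma (in gram_pair) unitary_model:
  fixes V1 V2 :: "'a \<Rightarrow> 'a"
  assumes V: "bounded_clinear V1" "bounded_clinear V2" and "cmod \<gamma> = 1"
    and V1: "\<And>i. (V1 (v i), \<lambda>\<zeta>. \<gamma> * fst \<zeta> * f i \<zeta>) \<in> graph"
    and V2: "\<And>i. (V2 (v i), \<lambda>\<zeta>. snd \<zeta> * f i \<zeta>) \<in> graph"
  shows "unitarily_equiv_model V1 V2 \<gamma> (L2_closure (fspan f))"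
proof -
  obtain U where U: "\<And>x. (x, U x) \<in> graph" using graph_total by metis
  have bound: "AE \<zeta> in torus. cmod (\<gamma> * fst \<zeta>) \<le> 1" "AE \<zeta> in torus. cmod (snd \<zeta>) \<le> 1"
    by (rule eventually_mono[OF AE_unit_torus], simp add: unit_torusD norm_mult assms(3))+
  have meas: "(\<lambda>\<zeta>. \<gamma> * fst \<zeta>) \<in> borel_measurable torus" "snd \<in> borel_measurable torus"
    by measurable
  show ?thesis
    unfolding unitarily_equiv_model_def
  proof (intro exI[of _ U] conjI allI ballI)
    fix x y c
    show "U x \<in> L2_closure (fspan f)" by (rule graph_in_closure[OF U])
    show "AE \<zeta> in torus. U (x + y) \<zeta> = U x \<zeta> + U y \<zeta>"
      by (rule graph_unique[OF U graph_add[OF U U]])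
    show "AE \<zeta> in torus. U (c *\<^sub>C x) \<zeta> = c * U x \<zeta>"
      by (rule graph_unique[OF U graph_scale[OF U]])
    show "(norm x)\<^sup>2 = (\<integral>\<zeta>. (cmod (U x \<zeta>))\<^sup>2 \<partial>torus)"
      using graph_norm[OF U, of x] by (simp add: L2_norm_square)
    show "AE \<zeta> in torus. U (V1 x) \<zeta> = \<gamma> * fst \<zeta> * U x \<zeta>"
      by (rule graph_unique[OF U graph_intertwine[OF V(1) meas(1) bound(1) V1 U]])
    show "AE \<zeta> in torus. U (V2 x) \<zeta> = snd \<zeta> * U x \<zeta>"
      by (rule graph_unique[OF U graph_intertwine[OF V(2) meas(2) bound(2) V2 U]])
  next
    fix g assume "g \<in> L2_closure (fspan f)"
    then obtain x where "(x, g) \<in> graph" using graph_onto by blast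
    then show "\<exists>x. AE \<zeta> in torus. U x \<zeta> = g \<zeta>" using graph_unique[OF U] by blast
  qed
qed

theorem theorem5p6:
  fixes V1 V2 :: "'a::{chilbert_space, second_countable_topology} \<Rightarrow> 'a"
  assumes "three_finite_pair V1 V2"
    and "irreducible_pair V1 V2"
  shows "\<exists>(lam::real) (\<gamma>::complex) \<phi>. 0 < lam \<and> lam < 1 \<and> cmod \<gamma> = 1 \<and> inner_function \<phi> \<and>
           spectrum (defect_op V1 V2) \<inter> complex_of_real ` {0<..<1} = {complex_of_real lam} \<and>
           spectrum (cross_comm V1 V2) - {0} = {\<gamma> * complex_of_real lam} \<and>
           unitarily_equiv_model V1 V2 \<gamma> (S_space \<phi> lam) \<and>
           S_space \<phi> lam \<subseteq> H2 \<and> L2_closed (S_space \<phi> lam) \<and>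
           (\<forall>f\<in>S_space \<phi> lam. (\<lambda>\<zeta>. fst \<zeta> * f \<zeta>) \<in> S_space \<phi> lam \<and>
                               (\<lambda>\<zeta>. snd \<zeta> * f \<zeta>) \<in> S_space \<phi> lam)"
proof -
  have rank: "has_rank (defect_op V1 V2) 3" and normal: "normal_op (cross_comm V1 V2)"
    and pair: "isometric_pair V1 V2"
    using assms(1) by (auto simp: three_finite_pair_def compact_normal_pair_def BCL_pair_def)
  interpret normal_cross_comm V1 V2
    using pair normal by unfold_locales (auto simp: isometric_pair_def fun_eq_iff)
  obtain x \<mu> where x: "norm x = 1" "adj V1 x = 0" "adj V2 x = 0" "cross_comm V1 V2 x = \<mu> *\<^sub>C x"
    using exists_wandering_eigenvector[OF rank] by auto
  interpret wandering_eigenvector V1 V2 x \<mu>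
    using x assms(2) by unfold_locales
  define lam where "lam = cmod \<mu>"
  define \<gamma> where "\<gamma> = \<mu> / complex_of_real lam"
  have lam: "0 < lam" "lam < 1" using \<mu>_bounds[OF rank] by (simp_all add: lam_def)
  interpret model lam using lam by unfold_locales
  have \<mu>: "\<mu> = \<gamma> * complex_of_real lam" using lam by (simp add: \<gamma>_def)
  have \<gamma>: "cmod \<gamma> = 1" using lam by (simp add: \<gamma>_def norm_divide lam_def)
  then have \<gamma>_cnj: "cnj \<gamma> * \<gamma> = 1" "\<gamma> * cnj \<gamma> = 1"
    by (simp_all add: complex_norm_square[symmetric] mult.commute)
  \<comment> \<open>The factor \<open>cnj \<gamma>\<close> per \<open>V1\<close> absorbs the phase
    of \<open>\<mu>\<close>, so the Gram matrix becomes that of \<open>fm\<close>, with powers of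
    \<open>lam\<close>. The price is \<open>V1 v = \<gamma> v\<close> with the first index raised,
    which is where \<open>\<gamma> M_z\<close> comes from.\<close>
  define v where "v i = cnj \<gamma> ^ fst i *\<^sub>C w x (fst i) (snd i)" for i
  have w_v: "w x a b = \<gamma> ^ a *\<^sub>C v (a, b)" for a b
    by (simp add: v_def scaleC_scaleC \<gamma>_cnj flip: power_mult_distrib)
  interpret gram_pair v fm
  proof
    show "fm i \<in> L2" for i by (rule fm_L2)
    show "cinner (v i) (v j) = L2_inner (fm i) (fm j)" for i j
    proof -
      obtain a b where i: "i = (a, b)" by force
      obtain c d where j: "j = (c, d)" by force
      have cancel: "cnj \<gamma> ^ (c + n) * (\<gamma> ^ c * \<gamma> ^ n) = 1" "cnj \<gamma> ^ c * (\<gamma> ^ (c + n) * cnj \<gamma> ^ n) = 1" for c n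
        by (simp_all add: power_add \<gamma>_cnj mult_ac flip: power_mult_distrib)
      show ?thesis
      proof (cases "c \<le> a")
        case True
        then obtain n where "a = c + n" using le_Suc_ex by blast
        then show ?thesis using cancel(1)[of c n]
          by (simp add: i j v_def cinner_scaleC_left cinner_scaleC_right gram inner_fm \<mu>
              power_mult_distrib mult_ac)
      next
        case False
        then obtain n where "c = a + n" by (metis le_Suc_ex nat_le_linear)
        then show ?thesis using False cancel(2)[of a n]
          by (simp add: i j v_def cinner_scaleC_left cinner_scaleC_right gram inner_fm \<mu>
              power_mult_distrib mult_ac)
      qed
    qed
    have "W \<subseteq> cvec.span (range v)"
      by (auto simp: w_v intro: cvec.span_scale[OF cvec.span_base])
    then have "cvec.span W \<subseteq> cvec.span (range v)"
      by (rule cvec.span_minimal) (rule cvec.subspace_span)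
    then show "closure (cvec.span (range v)) = UNIV"
      using closure_mono dense by blast
  qed
  have base: "(v i, fm i) \<in> graph" for i
    using graph0_graph[OF graph0.step[OF graph0.zero, of 1 i]] by simp
  have V1_v: "(V1 (v i), \<lambda>\<zeta>. \<gamma> * fst \<zeta> * fm i \<zeta>) \<in> graph" for i
  proof -
    have "V1 (v i) = \<gamma> *\<^sub>C v (Suc (fst i), snd i)"
      by (simp add: v_def lin_simps scaleC_scaleC \<gamma>_cnj flip: mult.assoc)
    moreover have "(\<lambda>\<zeta>. \<gamma> * fst \<zeta> * fm i \<zeta>) = (\<lambda>\<zeta>. \<gamma> * fm (Suc (fst i), snd i) \<zeta>)"
      by (simp add: fm_def mult_ac)
    ultimately show ?thesis using graph_scale[OF base] by simp
  qed
  have V2_v: "(V2 (v i), \<lambda>\<zeta>. snd \<zeta> * fm i \<zeta>) \<in> graph" for i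
  proof -
    have "V2 (v i) = v (fst i, Suc (snd i))"
      by (simp add: v_def lin_simps)
    moreover have "(\<lambda>\<zeta>. snd \<zeta> * fm i \<zeta>) = fm (fst i, Suc (snd i))"
      by (simp add: fm_def[abs_def] mult_ac)
    ultimately show ?thesis using base[of "(fst i, Suc (snd i))"] by simp
  qed
  have "unitarily_equiv_model V1 V2 \<gamma> (S_space \<phi> lam)"
    unfolding S_eq by (rule unitary_model[OF bcl(1,2) \<gamma> V1_v V2_v])
  moreover have "spectrum (cross_comm V1 V2) - {0} = {\<gamma> * complex_of_real lam}"
    unfolding \<mu>[symmetric] using lam by (intro spectrum_X) (auto simp: lam_def)
  moreover have "spectrum (defect_op V1 V2) \<inter> complex_of_real ` {0<..<1} = {complex_of_real lam}"
    unfolding lam_def using spectrum_D lam by (simp add: lam_def)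
  ultimately show ?thesis
    using lam \<gamma> inner_function_phi S_subset_H2 L2_closed_S S_invariant
    by (intro exI[of _ lam] exI[of _ \<gamma>] exI[of _ \<phi>]) blast
qed

end
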